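(* Let $\Theta\in\mathbf\Theta[A,C;B,D]$ and let $Q_0\in\mathbb S^n$ with $Q_0>0$. Suppose $\Pi\in\mathbb S^n$ satisfies the Lyapunov inequality $$\Pi(A+B\Theta)+(A+B\Theta)^\top\Pi+(C+D\Theta)^\top\Pi(C+D\Theta)+S^\top\Theta+\Theta^\top S+\Theta^\top R\Theta+Q-Q_0\geqslant0$$ and $$R+D^\top\Pi D-\big[\Pi B+(C+D\Theta)^\top\Pi D+S^\top+\Theta^\top R\big]^\top Q_0^{-1}\big[\Pi B+(C+D\Theta)^\top\Pi D+S^\top+\Theta^\top R\big]\geqslant\delta I$$ for some $\delta>0$. Then the cost functional of the stabilized LQ problem is uniformly convex: for some $\delta'>0$, $$\widehat J^{\,0,\Theta}_\infty(0;v(\cdot))\geqslant\delta'\,\mathbb E\int_0^\infty|v(t)|^2dt,\qquad\forall v(\cdot)\in\mathscr U[0,\infty).$$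
   Context: $W$ is a standard one-dimensional Brownian motion on a complete filtered probability space with its augmented natural filtration $\mathbb F$. $A,C\in\mathbb R^{n\times n}$, $B,D\in\mathbb R^{n\times m}$, $Q\in\mathbb S^n$, $R\in\mathbb S^m$, $S\in\mathbb R^{m\times n}$ are constant ($\mathbb S^k$: symmetric real $k\times k$ matrices). $\mathbf\Theta[A,C;B,D]$ is the set of $\Theta\in\mathbb R^{m\times n}$ (stabilizers) such that for every $x\in\mathbb R^n$ the solution of $dX_0=(A+B\Theta)X_0\,dt+(C+D\Theta)X_0\,dW$, $X_0(0)=x$, satisfies $\mathbb E\int_0^\infty|X_0(t)|^2dt<\infty$; it is assumed nonempty. $\mathscr U[0,\infty)=L^2_{\mathbb F}(0,\infty;\mathbb R^m)$ is the set of $\mathbb F$-progressively measurable $\mathbb R^m$-valued processes $v$ with $\mathbb E\int_0^\infty|v(t)|^2dt<\infty$. For $v(\cdot)\in\mathscr U[0,\infty)$ let $X_0^\Theta$ solve $$dX_0^\Theta=[(A+B\Theta)X_0^\Theta+Bv]dt+[(C+D\Theta)X_0^\Theta+Dv]dW,\qquad X_0^\Theta(0)=0,$$ and set $$\widehat J^{\,0,\Theta}_\infty(0;v(\cdot))=\mathbb E\int_0^\infty\Big[\langle Q_\Theta X_0^\Theta,X_0^\Theta\rangle+2\langle S_\Theta X_0^\Theta,v\rangle+\langle Rv,v\rangle\Big]dt,$$ with $Q_\Theta=Q+S^\top\Theta+\Theta^\top S+\Theta^\top R\Theta$ and $S_\Theta=S+R\Theta$. *)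

theory Defs
  imports "HOL-Probability.Probability"
begin

section \<open>Brownian motion, its augmented filtration, and the Ito integral\<close>

text \<open>Stochastic processes are functions \<open>X t \<omega>\<close> with time \<open>t :: real\<close>; only \<open>t \<ge> 0\<close> is ever used.\<close>

definition natural_filtration ::
    "'a measure \<Rightarrow> (real \<Rightarrow> 'a \<Rightarrow> 'b::topological_space) \<Rightarrow> real \<Rightarrow> 'a measure" where
  "natural_filtration M W t =
     sigma (space M) {W s -` U \<inter> space M | s U. 0 \<le> s \<and> s \<le> t \<and> U \<in> sets borel}"

definition augmented_filtration ::
    "'a measure \<Rightarrow> (real \<Rightarrow> 'a \<Rightarrow> 'b::topological_space) \<Rightarrow> real \<Rightarrow> 'a measure" where
  "augmented_filtration M W t =
     sigma (space M) (sets (natural_filtration M W t) \<union> null_sets M)"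

locale standard_brownian_motion = prob_space M + complete_measure M
  for M :: "'a measure" +
  fixes W :: "real \<Rightarrow> 'a \<Rightarrow> real"
  assumes measurable_W: "\<And>t. 0 \<le> t \<Longrightarrow> W t \<in> borel_measurable M"
    and start_zero: "AE \<omega> in M. W 0 \<omega> = 0"
    and continuous_paths: "AE \<omega> in M. continuous_on {0..} (\<lambda>t. W t \<omega>)"
    and normal_increments: "\<And>s t. 0 \<le> s \<Longrightarrow> s < t \<Longrightarrow>
      distributed M lborel (\<lambda>\<omega>. W t \<omega> - W s \<omega>) (normal_density 0 (sqrt (t - s)))"
    and independent_increments: "\<And>s t. 0 \<le> s \<Longrightarrow> s < t \<Longrightarrow>
      indep_set (sets (natural_filtration M W s))
        {(\<lambda>\<omega>. W t \<omega> - W s \<omega>) -` U \<inter> space M | U. U \<in> sets borel}"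

definition progressively_measurable ::
    "(real \<Rightarrow> 'a measure) \<Rightarrow> (real \<Rightarrow> 'a \<Rightarrow> 'b::topological_space) \<Rightarrow> bool" where
  "progressively_measurable F X \<longleftrightarrow>
     (\<forall>T\<ge>0. (\<lambda>(t, \<omega>). X t \<omega>) \<in> borel_measurable (restrict_space borel {0..T} \<Otimes>\<^sub>M F T))"

text \<open>The (extended) value of \<open>\<bbbE> \<integral>\<^sub>I |X(t)|\<^sup>2 dt\<close>.\<close>

definition mean_square ::
    "'a measure \<Rightarrow> real set \<Rightarrow> (real \<Rightarrow> 'a \<Rightarrow> 'b::real_normed_vector) \<Rightarrow> ennreal" where
  "mean_square M I X = (\<integral>\<^sup>+ \<omega>. (\<integral>\<^sup>+ t\<in>I. ennreal ((norm (X t \<omega>))\<^sup>2) \<partial>lborel) \<partial>M)"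

text \<open>The simple process \<open>\<Sum>i<k. \<xi>\<^sub>i 1\<^bsub>(\<tau>\<^sub>i, \<tau>\<^sub>i\<^sub>+\<^sub>1]\<^esub>\<close> and its elementary stochastic integral.\<close>

definition simple_process ::
    "nat \<Rightarrow> (nat \<Rightarrow> real) \<Rightarrow> (nat \<Rightarrow> 'a \<Rightarrow> 'b::real_normed_vector) \<Rightarrow> real \<Rightarrow> 'a \<Rightarrow> 'b" where
  "simple_process k \<tau> \<xi> t \<omega> = (\<Sum>i<k. indicator {\<tau> i<..\<tau> (Suc i)} t *\<^sub>R \<xi> i \<omega>)"

definition simple_integrand ::
    "'a measure \<Rightarrow> (real \<Rightarrow> 'a measure) \<Rightarrow> nat \<Rightarrow> (nat \<Rightarrow> real) \<Rightarrow>
     (nat \<Rightarrow> 'a \<Rightarrow> 'b::real_normed_vector) \<Rightarrow> bool" where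
  "simple_integrand M F k \<tau> \<xi> \<longleftrightarrow>
     0 \<le> \<tau> 0 \<and> (\<forall>i<k. \<tau> i \<le> \<tau> (Suc i)) \<and>
     (\<forall>i<k. \<xi> i \<in> borel_measurable (F (\<tau> i)) \<and> bounded (\<xi> i ` space M))"

definition simple_integral ::
    "(real \<Rightarrow> 'a \<Rightarrow> real) \<Rightarrow> nat \<Rightarrow> (nat \<Rightarrow> real) \<Rightarrow>
     (nat \<Rightarrow> 'a \<Rightarrow> 'b::real_normed_vector) \<Rightarrow> real \<Rightarrow> 'a \<Rightarrow> 'b" where
  "simple_integral W k \<tau> \<xi> T \<omega> =
     (\<Sum>i<k. (W (min T (\<tau> (Suc i))) \<omega> - W (min T (\<tau> i)) \<omega>) *\<^sub>R \<xi> i \<omega>)"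

text \<open>\<open>has_ito_integral M W H T Y\<close>: almost surely \<open>Y = \<integral>\<^sub>0\<^sup>T H(t) dW(t)\<close>. This is Ito's
  \<open>L\<^sup>2\<close> construction: \<open>Y\<close> is the \<open>L\<^sup>2\<close>-limit of the elementary integrals of simple processes
  which converge to \<open>H\<close> in \<open>L\<^sup>2([0,T] \<times> \<Omega>)\<close>.\<close>

definition has_ito_integral ::
    "'a measure \<Rightarrow> (real \<Rightarrow> 'a \<Rightarrow> real) \<Rightarrow> (real \<Rightarrow> 'a \<Rightarrow> 'b::euclidean_space) \<Rightarrow> real \<Rightarrow>
     ('a \<Rightarrow> 'b) \<Rightarrow> bool" where
  "has_ito_integral M W H T Y \<longleftrightarrow>
     progressively_measurable (augmented_filtration M W) H \<and>
     mean_square M {0..T} H < \<infinity> \<and>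
     Y \<in> borel_measurable M \<and>
     (\<exists>k \<tau> \<xi>. (\<forall>j::nat. simple_integrand M (augmented_filtration M W) (k j) (\<tau> j) (\<xi> j)) \<and>
       (\<lambda>j. mean_square M {0..T} (\<lambda>t \<omega>. H t \<omega> - simple_process (k j) (\<tau> j) (\<xi> j) t \<omega>))
         \<longlonglongrightarrow> 0 \<and>
       (\<lambda>j. \<integral>\<^sup>+ \<omega>. ennreal ((norm (Y \<omega> - simple_integral W (k j) (\<tau> j) (\<xi> j) T \<omega>))\<^sup>2) \<partial>M)
         \<longlonglongrightarrow> 0)"

text \<open>\<open>is_solution M W x b \<sigma> X\<close>: the process \<open>X\<close> satisfies \<open>X(0) = x\<close> and
  \<open>dX(t) = b(t, X(t)) dt + \<sigma>(t, X(t)) dW(t)\<close> on \<open>[0,\<infinity>)\<close>, where \<open>b\<close> and \<open>\<sigma>\<close> may be random.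
  Solutions are continuous and square integrable on bounded time intervals, the class in which
  linear equations with square integrable inhomogeneities have exactly one solution.\<close>

definition is_solution ::
    "'a measure \<Rightarrow> (real \<Rightarrow> 'a \<Rightarrow> real) \<Rightarrow> 'b::euclidean_space \<Rightarrow>
     (real \<Rightarrow> 'a \<Rightarrow> 'b \<Rightarrow> 'b) \<Rightarrow> (real \<Rightarrow> 'a \<Rightarrow> 'b \<Rightarrow> 'b) \<Rightarrow> (real \<Rightarrow> 'a \<Rightarrow> 'b) \<Rightarrow> bool" where
  "is_solution M W x b \<sigma> X \<longleftrightarrow>
     progressively_measurable (augmented_filtration M W) X \<and>
     (AE \<omega> in M. continuous_on {0..} (\<lambda>t. X t \<omega>)) \<and>
     (\<forall>T\<ge>0. mean_square M {0..T} X < \<infinity>) \<and>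
     (\<forall>T\<ge>0. (AE \<omega> in M. set_integrable lborel {0..T} (\<lambda>t. b t \<omega> (X t \<omega>))) \<and>
        has_ito_integral M W (\<lambda>t \<omega>. \<sigma> t \<omega> (X t \<omega>)) T
          (\<lambda>\<omega>. X T \<omega> - x - (LINT t:{0..T}|lborel. b t \<omega> (X t \<omega>))))"


section \<open>The stabilized linear-quadratic problem\<close>

text \<open>An \<open>n \<times> m\<close> matrix has type \<^typ>\<open>real ^ 'm ^ 'n\<close>.\<close>

definition symmetric_matrix :: "real ^ 'n ^ 'n \<Rightarrow> bool" where
  "symmetric_matrix P \<longleftrightarrow> transpose P = P"

definition pos_semidef :: "real ^ 'n ^ 'n \<Rightarrow> bool" where
  "pos_semidef P \<longleftrightarrow> symmetric_matrix P \<and> (\<forall>x. 0 \<le> (P *v x) \<bullet> x)"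

definition pos_def :: "real ^ 'n ^ 'n \<Rightarrow> bool" where
  "pos_def P \<longleftrightarrow> symmetric_matrix P \<and> (\<forall>x. x \<noteq> 0 \<longrightarrow> 0 < (P *v x) \<bullet> x)"

text \<open>Solutions being unique, membership asks for a solution with finite total mean square.\<close>

definition stabilizers ::
    "'a measure \<Rightarrow> (real \<Rightarrow> 'a \<Rightarrow> real) \<Rightarrow> real ^ 'n ^ 'n \<Rightarrow> real ^ 'n ^ 'n \<Rightarrow>
     real ^ 'm ^ 'n \<Rightarrow> real ^ 'm ^ 'n \<Rightarrow> (real ^ 'n ^ 'm) set" where
  "stabilizers M W A C B D = {\<Theta>. \<forall>x. \<exists>X.
     is_solution M W x (\<lambda>t \<omega> y. (A + B ** \<Theta>) *v y) (\<lambda>t \<omega> y. (C + D ** \<Theta>) *v y) X \<and>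
     mean_square M {0..} X < \<infinity>}"

definition admissible_controls ::
    "'a measure \<Rightarrow> (real \<Rightarrow> 'a \<Rightarrow> real) \<Rightarrow> (real \<Rightarrow> 'a \<Rightarrow> real ^ 'm) set" where
  "admissible_controls M W =
     {v. progressively_measurable (augmented_filtration M W) v \<and> mean_square M {0..} v < \<infinity>}"

definition is_state ::
    "'a measure \<Rightarrow> (real \<Rightarrow> 'a \<Rightarrow> real) \<Rightarrow> real ^ 'n ^ 'n \<Rightarrow> real ^ 'n ^ 'n \<Rightarrow>
     real ^ 'm ^ 'n \<Rightarrow> real ^ 'm ^ 'n \<Rightarrow> real ^ 'n ^ 'm \<Rightarrow> (real \<Rightarrow> 'a \<Rightarrow> real ^ 'm) \<Rightarrow>
     (real \<Rightarrow> 'a \<Rightarrow> real ^ 'n) \<Rightarrow> bool" where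
  "is_state M W A C B D \<Theta> v X \<longleftrightarrow>
     is_solution M W 0
       (\<lambda>t \<omega> y. (A + B ** \<Theta>) *v y + B *v v t \<omega>) (\<lambda>t \<omega> y. (C + D ** \<Theta>) *v y + D *v v t \<omega>) X"

text \<open>The cost of the control \<open>v\<close>, where \<open>X\<close> is the corresponding state.\<close>

definition stabilized_cost ::
    "'a measure \<Rightarrow> real ^ 'n ^ 'n \<Rightarrow> real ^ 'n ^ 'm \<Rightarrow> real ^ 'm ^ 'm \<Rightarrow> real ^ 'n ^ 'm \<Rightarrow>
     (real \<Rightarrow> 'a \<Rightarrow> real ^ 'n) \<Rightarrow> (real \<Rightarrow> 'a \<Rightarrow> real ^ 'm) \<Rightarrow> real" where
  "stabilized_cost M Q S R \<Theta> X v =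
     (let Q\<Theta> = Q + transpose S ** \<Theta> + transpose \<Theta> ** S + transpose \<Theta> ** R ** \<Theta>;
          S\<Theta> = S + R ** \<Theta>
      in LINT \<omega>|M. (LINT t:{0..}|lborel.
           ((Q\<Theta> *v X t \<omega>) \<bullet> X t \<omega> + 2 * ((S\<Theta> *v X t \<omega>) \<bullet> v t \<omega>) + (R *v v t \<omega>) \<bullet> v t \<omega>)))"

end

theory Submission
  imports Defs
begin

text \<open>Applying Ito's formula to \<open>\<langle>P X, X\<rangle>\<close> and completing the square with \<open>Q\<^sub>0\<close> bounds the cost on
  \<open>[0, T]\<close> from below by \<open>\<delta> \<bbbE> \<integral>\<^sub>0\<^sup>T |v|\<^sup>2 - \<bbbE> \<langle>P X(T), X(T)\<rangle>\<close>, so the theorem holds with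
  \<open>\<delta>' = \<delta>\<close> once the boundary term disappears along some \<open>T \<longrightarrow> \<infinity>\<close>. This follows from
  \<open>\<bbbE> \<integral>\<^sub>0\<^sup>\<infinity> |X|\<^sup>2 < \<infinity>\<close>, which in turn comes from a second Lyapunov function: for a stabilizer, the
  Lyapunov operator is injective on symmetric matrices, hence takes the value \<open>- I\<close> at some \<open>P\<close>, and
  this \<open>P\<close> is positive semidefinite.

  Only the expectation of Ito's formula for quadratic forms is needed. By polarization it suffices to
  treat \<open>X\<^sup>2\<close> for scalar \<open>X = x + V + N\<close> with \<open>V = \<integral> b dt\<close> and \<open>N = \<integral> \<sigma> dW\<close>, where
  \<open>\<bbbE> N\<^sup>2\<close> is given by the isometry, \<open>\<bbbE> V N = \<bbbE> \<integral> b N dt\<close> by the martingale property, and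
  \<open>V\<^sup>2 = 2 \<integral> b V dt\<close> by Fubini on a triangle.\<close>

section \<open>Square integrable functions\<close>

text \<open>Ito integrals are characterised one horizon at a time, by approximating simple processes
  that are unrelated for different \<open>T\<close>; the isometry is the only link between them. The
  matrix \<open>P\<close> of the theorem is not assumed semidefinite, so the sign of the boundary
  term is unknown, and the term can only be removed by making E|X(T)|^2 small at arbitrarily late
  times. Stability concerns the homogeneous equation; a Lyapunov function with strict decay carries
  it over to the controlled one, because the decay absorbs the cross terms between state and
  control. Its existence is again a boundary-term argument: if the Lyapunov operator sends a
  symmetric \<open>P\<close> to 0, then E<P X(T), X(T)> equals <P x, x> for every \<open>T\<close>
  and yet becomes arbitrarily small. The slack \<open>Q0\<close> in the first matrix inequality pays
  for the cross term between \<open>x\<close> and \<open>v\<close>; the second inequality is what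
  minimizing over \<open>x\<close> leaves, so nothing of \<delta> is lost.\<close>

definition L2 :: "'a measure \<Rightarrow> ('a \<Rightarrow> real) \<Rightarrow> bool" where
  "L2 \<mu> f \<longleftrightarrow> f \<in> borel_measurable \<mu> \<and> integrable \<mu> (\<lambda>x. (f x)\<^sup>2)"

lemma L2_measurable: "L2 \<mu> f \<Longrightarrow> f \<in> borel_measurable \<mu>"
  and L2_square: "L2 \<mu> f \<Longrightarrow> integrable \<mu> (\<lambda>x. (f x)\<^sup>2)"
  by (simp_all add: L2_def)

lemma two_mult_le: "2 * \<bar>a * b\<bar> \<le> a\<^sup>2 + (b::real)\<^sup>2"
  using sum_squares_bound[of "\<bar>a\<bar>" "\<bar>b\<bar>"] by (simp add: abs_mult mult.assoc)

lemma L2_mult: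
  assumes "L2 \<mu> f" "L2 \<mu> g"
  shows "integrable \<mu> (\<lambda>x. f x * g x)"
proof (rule Bochner_Integration.integrable_bound)
  show "integrable \<mu> (\<lambda>x. (f x)\<^sup>2 + (g x)\<^sup>2)"
    using assms by (intro Bochner_Integration.integrable_add L2_square)
  show "(\<lambda>x. f x * g x) \<in> borel_measurable \<mu>"
    using assms[THEN L2_measurable] by measurable
  have "\<bar>f x * g x\<bar> \<le> \<bar>(f x)\<^sup>2 + (g x)\<^sup>2\<bar>" for x
    using two_mult_le[of "f x" "g x"] abs_ge_zero[of "f x * g x"] by linarith
  then show "AE x in \<mu>. norm (f x * g x) \<le> norm ((f x)\<^sup>2 + (g x)\<^sup>2)" by simp
qed

lemma L2_bound:
  assumes "L2 \<mu> g" "f \<in> borel_measurable \<mu>" "AE x in \<mu>. \<bar>f x\<bar> \<le> \<bar>g x\<bar>"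
  shows "L2 \<mu> f"
  unfolding L2_def
proof
  show "integrable \<mu> (\<lambda>x. (f x)\<^sup>2)"
  proof (rule Bochner_Integration.integrable_bound)
    show "integrable \<mu> (\<lambda>x. (g x)\<^sup>2)" using assms L2_square by blast
    show "(\<lambda>x. (f x)\<^sup>2) \<in> borel_measurable \<mu>" using assms by measurable
    show "AE x in \<mu>. norm ((f x)\<^sup>2) \<le> norm ((g x)\<^sup>2)"
      using assms(3) by eventually_elim (simp add: abs_le_square_iff)
  qed
qed fact

lemma L2_cmult: "L2 \<mu> f \<Longrightarrow> L2 \<mu> (\<lambda>x. c * f x)"
  by (auto simp: L2_def power_mult_distrib)

lemma L2_add:
  assumes "L2 \<mu> f" "L2 \<mu> g" shows "L2 \<mu> (\<lambda>x. f x + g x)"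
proof -
  have "integrable \<mu> (\<lambda>x. (f x)\<^sup>2 + (g x)\<^sup>2 + 2 * (f x * g x))"
    using assms by (intro Bochner_Integration.integrable_add L2_square integrable_mult_right L2_mult)
  then show ?thesis using assms
    by (auto simp: L2_def power2_sum mult.assoc)
qed

lemma L2_diff:
  assumes "L2 \<mu> f" "L2 \<mu> g" shows "L2 \<mu> (\<lambda>x. f x - g x)"
  using L2_add[OF assms(1) L2_cmult[OF assms(2), of "-1"]] by simp

lemma L2_sum: "(\<And>i. i \<in> I \<Longrightarrow> L2 \<mu> (f i)) \<Longrightarrow> L2 \<mu> (\<lambda>x. \<Sum>i\<in>I. f i x)"
proof (induction I rule: infinite_finite_induct)
  case (insert i I)
  then show ?case by (simp add: L2_add)
qed (auto simp: L2_def)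

lemma L2_nn_integral:
  assumes "L2 \<mu> f"
  shows "(\<integral>\<^sup>+ x. ennreal ((f x)\<^sup>2) \<partial>\<mu>) = ennreal (LINT x|\<mu>. (f x)\<^sup>2)"
  using assms by (intro nn_integral_eq_integral) (auto simp: L2_def)

lemma L2I_nn_integral:
  assumes "f \<in> borel_measurable \<mu>" "(\<integral>\<^sup>+ x. ennreal ((f x)\<^sup>2) \<partial>\<mu>) < \<infinity>"
  shows "L2 \<mu> f"
  using assms by (auto simp: L2_def integrable_iff_bounded)

lemma tendsto_nn_integral_L2_iff:
  assumes "\<And>j. L2 \<mu> (f j)"
  shows "(\<lambda>j. \<integral>\<^sup>+ x. ennreal ((f j x)\<^sup>2) \<partial>\<mu>) \<longlonglongrightarrow> 0 \<longleftrightarrow> (\<lambda>j. LINT x|\<mu>. (f j x)\<^sup>2) \<longlonglongrightarrow> 0"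
  using tendsto_ennreal_iff[where f="\<lambda>j. LINT x|\<mu>. (f j x)\<^sup>2" and x=0 and F=sequentially]
  by (simp add: L2_nn_integral[OF assms])

text \<open>The quadratic polynomial \<integral>(f - r g)^2 in \<open>r\<close> is nonnegative; its
  value at \<open>b / c\<close> gives the inequality.\<close>

lemma L2_Cauchy_Schwarz:
  assumes "L2 \<mu> f" "L2 \<mu> g"
  shows "(LINT x|\<mu>. f x * g x)\<^sup>2 \<le> (LINT x|\<mu>. (f x)\<^sup>2) * (LINT x|\<mu>. (g x)\<^sup>2)"
proof -
  define a b c where "a = (LINT x|\<mu>. (f x)\<^sup>2)" and "b = (LINT x|\<mu>. f x * g x)"
    and "c = (LINT x|\<mu>. (g x)\<^sup>2)"
  have q: "0 \<le> a - 2 * r * b + r\<^sup>2 * c" for r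
  proof -
    have "0 \<le> (LINT x|\<mu>. (f x - r * g x)\<^sup>2)" by (rule integral_nonneg_AE) simp
    also have "\<dots> = (LINT x|\<mu>. (f x)\<^sup>2 - 2 * r * (f x * g x) + r\<^sup>2 * (g x)\<^sup>2)"
      by (intro Bochner_Integration.integral_cong) (auto simp: power2_diff power_mult_distrib)
    also have "\<dots> = a - 2 * r * b + r\<^sup>2 * c"
      unfolding a_def b_def c_def using assms
      by (simp add: L2_mult L2_square)
    finally show ?thesis .
  qed
  have c0: "0 \<le> c" unfolding c_def by (rule integral_nonneg_AE) simp
  show ?thesis
  proof (cases "c = 0")
    case True
    have "b = 0"
    proof (rule ccontr)
      assume "b \<noteq> 0"
      \<comment> \<open>With \<open>c = 0\<close> the polynomial is affine in \<open>r\<close>, and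
        this \<open>r\<close> gives it the value -1.\<close>
      with q[of "(a + 1) / (2 * b)"] True show False by simp
    qed
    then show ?thesis unfolding a_def[symmetric] b_def[symmetric] c_def[symmetric] using True by simp
  next
    case False
    then have "0 \<le> (a - 2 * (b / c) * b + (b / c)\<^sup>2 * c) * c"
      using q[of "b / c"] c0 by simp
    also have "\<dots> = a * c - b\<^sup>2" using False by (simp add: field_simps power2_eq_square)
    finally show ?thesis unfolding a_def[symmetric] b_def[symmetric] c_def[symmetric] by simp
  qed
qed

lemma L2_tendsto_inner:
  assumes f: "\<And>j. L2 \<mu> (f j)" "L2 \<mu> f'" and g: "L2 \<mu> g"
    and lim: "(\<lambda>j. LINT x|\<mu>. (f' x - f j x)\<^sup>2) \<longlonglongrightarrow> 0"
  shows "(\<lambda>j. LINT x|\<mu>. f j x * g x) \<longlonglongrightarrow> (LINT x|\<mu>. f' x * g x)"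
proof -
  let ?G = "LINT x|\<mu>. (g x)\<^sup>2"
  have 1: "(\<lambda>j. (LINT x|\<mu>. (f' x - f j x) * g x)\<^sup>2) \<longlonglongrightarrow> 0"
  proof (rule tendsto_sandwich[OF _ _ tendsto_const])
    show "\<forall>\<^sub>F j in sequentially. (LINT x|\<mu>. (f' x - f j x) * g x)\<^sup>2 \<le> (LINT x|\<mu>. (f' x - f j x)\<^sup>2) * ?G"
      using L2_Cauchy_Schwarz[OF L2_diff[OF f(2,1)] g] by auto
    show "(\<lambda>j. (LINT x|\<mu>. (f' x - f j x)\<^sup>2) * ?G) \<longlonglongrightarrow> 0"
      using tendsto_mult_right[OF lim, of ?G] by simp
  qed auto
  have 2: "(LINT x|\<mu>. (f' x - f j x) * g x) = (LINT x|\<mu>. f' x * g x) - (LINT x|\<mu>. f j x * g x)" for j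
    using L2_mult[OF f(1) g] L2_mult[OF f(2) g] by (simp add: left_diff_distrib)
  have "(\<lambda>j. (LINT x|\<mu>. f' x * g x) - (LINT x|\<mu>. f j x * g x)) \<longlonglongrightarrow> 0"
    using 1 unfolding 2 by simp
  from tendsto_diff[OF tendsto_const[of "LINT x|\<mu>. f' x * g x"] this] show ?thesis by simp
qed

text \<open>Expanding (f' - f_j)^2 expresses the squared norm of \<open>f j\<close> by terms with
  known limits, so convergence of inner products with \<open>f'\<close> suffices.\<close>

lemma L2_tendsto_norm:
  assumes f: "\<And>j. L2 \<mu> (f j)" "L2 \<mu> f'"
    and lim: "(\<lambda>j. LINT x|\<mu>. (f' x - f j x)\<^sup>2) \<longlonglongrightarrow> 0"
  shows "(\<lambda>j. LINT x|\<mu>. (f j x)\<^sup>2) \<longlonglongrightarrow> (LINT x|\<mu>. (f' x)\<^sup>2)"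
proof -
  have "(LINT x|\<mu>. (f j x)\<^sup>2)
      = (LINT x|\<mu>. (f' x - f j x)\<^sup>2) + 2 * (LINT x|\<mu>. f j x * f' x) - (LINT x|\<mu>. (f' x)\<^sup>2)" for j
  proof -
    have "(LINT x|\<mu>. (f' x - f j x)\<^sup>2) + 2 * (LINT x|\<mu>. f j x * f' x) - (LINT x|\<mu>. (f' x)\<^sup>2)
      = (LINT x|\<mu>. (f' x - f j x)\<^sup>2 + 2 * (f j x * f' x) - (f' x)\<^sup>2)"
      using L2_mult[OF f(1,2)] L2_square[OF f(2)] L2_square[OF L2_diff[OF f(2,1)]] by simp
    also have "\<dots> = (LINT x|\<mu>. (f j x)\<^sup>2)"
      by (intro Bochner_Integration.integral_cong) (auto simp: power2_diff)
    finally show ?thesis by simp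
  qed
  moreover have "(\<lambda>j. (LINT x|\<mu>. (f' x - f j x)\<^sup>2) + 2 * (LINT x|\<mu>. f j x * f' x) - (LINT x|\<mu>. (f' x)\<^sup>2))
    \<longlonglongrightarrow> 0 + 2 * (LINT x|\<mu>. f' x * f' x) - (LINT x|\<mu>. (f' x)\<^sup>2)"
    by (intro tendsto_intros lim L2_tendsto_inner f)
  ultimately show ?thesis by (simp add: power2_eq_square)
qed

text \<open>Only convergence to 0 matters, so (a + b)^2 \<le> 2 a^2 + 2 b^2 replaces the triangle
  inequality of the norm.\<close>

lemma L2_tendsto_zero_triangle:
  assumes f: "\<And>j. L2 \<mu> (f j)" and g: "\<And>j. L2 \<mu> (g j)" and h: "\<And>j. L2 \<mu> (h j)"
    and 1: "(\<lambda>j. LINT x|\<mu>. (f j x - g j x)\<^sup>2) \<longlonglongrightarrow> 0"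
    and 2: "(\<lambda>j. LINT x|\<mu>. (g j x - h j x)\<^sup>2) \<longlonglongrightarrow> 0"
  shows "(\<lambda>j. LINT x|\<mu>. (f j x - h j x)\<^sup>2) \<longlonglongrightarrow> 0"
proof (rule tendsto_sandwich[OF _ _ tendsto_const])
  let ?r = "\<lambda>j. 2 * (LINT x|\<mu>. (f j x - g j x)\<^sup>2) + 2 * (LINT x|\<mu>. (g j x - h j x)\<^sup>2)"
  show "?r \<longlonglongrightarrow> 0" using tendsto_add[OF tendsto_mult_left[OF 1, of 2] tendsto_mult_left[OF 2, of 2]] by simp
  have "(LINT x|\<mu>. (f j x - h j x)\<^sup>2) \<le> ?r j" for j
  proof -
    have "(LINT x|\<mu>. (f j x - h j x)\<^sup>2) \<le> (LINT x|\<mu>. 2 * (f j x - g j x)\<^sup>2 + 2 * (g j x - h j x)\<^sup>2)"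
    proof (rule integral_mono)
      fix x
      have "(a + b)\<^sup>2 \<le> 2 * a\<^sup>2 + 2 * b\<^sup>2" for a b :: real
        using sum_squares_bound[of a b] by (simp add: power2_sum)
      from this[of "f j x - g j x" "g j x - h j x"]
      show "(f j x - h j x)\<^sup>2 \<le> 2 * (f j x - g j x)\<^sup>2 + 2 * (g j x - h j x)\<^sup>2" by simp
    qed (use f g h in \<open>auto intro!: L2_square L2_diff Bochner_Integration.integrable_add integrable_mult_right\<close>)
    also have "\<dots> = ?r j" using f g h by (simp add: L2_square L2_diff)
    finally show ?thesis .
  qed
  then show "\<forall>\<^sub>F j in sequentially. (LINT x|\<mu>. (f j x - h j x)\<^sup>2) \<le> ?r j" by simp
qed auto

section \<open>The augmented filtration\<close>

text \<open>Extension by zero of a process restricted to \<open>I\<close>, as a function on the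
  whole product space. A single product measure then serves all horizons, and comparing horizons
  means comparing functions.\<close>

definition cutoff :: "real set \<Rightarrow> (real \<Rightarrow> 'a \<Rightarrow> 'b::real_vector) \<Rightarrow> real \<times> 'a \<Rightarrow> 'b" where
  "cutoff I X = (\<lambda>(t, \<omega>). indicator I t *\<^sub>R X t \<omega>)"

lemma space_augmented_filtration [simp]: "space (augmented_filtration M W t) = space M"
  by (simp add: augmented_filtration_def space_measure_of_conv)

lemma space_natural_filtration [simp]: "space (natural_filtration M W t) = space M"
  by (simp add: natural_filtration_def space_measure_of_conv)

lemma sets_natural_filtration:
  "sets (natural_filtration M W t) =
     sigma_sets (space M) {W s -` U \<inter> space M | s U. 0 \<le> s \<and> s \<le> t \<and> U \<in> sets borel}"
  unfolding natural_filtration_def by (rule sets_measure_of) auto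

lemma sets_augmented_filtration:
  "sets (augmented_filtration M W t) =
     sigma_sets (space M) (sets (natural_filtration M W t) \<union> null_sets M)"
  unfolding augmented_filtration_def
  by (rule sets_measure_of) (use sets.sets_into_space[of _ "natural_filtration M W t"] sets.sets_into_space[of _ M] in \<open>auto simp: null_sets_def\<close>)

lemma natural_filtration_mono:
  "s \<le> t \<Longrightarrow> sets (natural_filtration M W s) \<subseteq> sets (natural_filtration M W t)"
  unfolding sets_natural_filtration by (rule sigma_sets_mono') (auto intro: order_trans)

lemma augmented_filtration_mono:
  "s \<le> t \<Longrightarrow> sets (augmented_filtration M W s) \<subseteq> sets (augmented_filtration M W t)"
  unfolding sets_augmented_filtration
  using natural_filtration_mono by (intro sigma_sets_mono') blast

lemma measurable_augmented_filtration_mono: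
  assumes "f \<in> measurable (augmented_filtration M W s) N" "s \<le> t"
  shows "f \<in> measurable (augmented_filtration M W t) N"
  using assms augmented_filtration_mono[of s t M W] by (auto simp: measurable_def)

text \<open>The slice is taken at the right endpoint of the horizon \<open>t\<close>, so nothing
  later than \<open>t\<close> enters.\<close>

lemma progressively_measurable_augmented_section:
  assumes "progressively_measurable (augmented_filtration M W) X" "0 \<le> t"
  shows "X t \<in> borel_measurable (augmented_filtration M W t)"
proof -
  have "(\<lambda>(s, \<omega>). X s \<omega>) \<in> borel_measurable (restrict_space borel {0..t} \<Otimes>\<^sub>M augmented_filtration M W t)"
    using assms by (auto simp: progressively_measurable_def)
  from measurable_compose[OF measurable_Pair1' this, of t] assms(2) show ?thesis
    by (simp add: space_restrict_space)
qed

section \<open>Independence and moments of Brownian increments over the augmented past\<close>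

context standard_brownian_motion
begin

abbreviation "\<F> \<equiv> augmented_filtration M W"

sublocale time_prob: pair_sigma_finite lborel M ..

abbreviation \<mu> where "\<mu> \<equiv> (lborel :: real measure) \<Otimes>\<^sub>M M"

lemma natural_filtration_subset: "sets (natural_filtration M W t) \<subseteq> sets M"
  unfolding sets_natural_filtration
  by (rule sets.sigma_sets_subset) (use measurable_W in \<open>auto intro: measurable_sets\<close>)

lemma augmented_filtration_subset: "sets (\<F> t) \<subseteq> sets M"
  unfolding sets_augmented_filtration
  by (rule sets.sigma_sets_subset) (use natural_filtration_subset in auto)

lemma measurable_augmented_filtration:
  "f \<in> measurable (\<F> t) N \<Longrightarrow> f \<in> measurable M N"
  using augmented_filtration_subset[of t] by (auto simp: measurable_def)

lemma W_adapted:
  assumes "0 \<le> s" "s \<le> t" shows "W s \<in> borel_measurable (\<F> t)"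
proof (rule measurableI)
  fix U :: "real set" assume "U \<in> sets borel"
  then have "W s -` U \<inter> space M \<in> sets (natural_filtration M W t)"
    unfolding sets_natural_filtration using assms by blast
  then show "W s -` U \<inter> space (\<F> t) \<in> sets (\<F> t)"
    unfolding sets_augmented_filtration by auto
qed auto

text \<open>The sets with an almost surely equal partner in the natural filtration form a
  sigma-algebra that contains the null sets. Null sets can thus be ignored when independence is
  transferred to the augmentation.\<close>

lemma augmented_filtration_AE_eq_natural:
  assumes "A \<in> sets (\<F> t)"
  shows "\<exists>B\<in>sets (natural_filtration M W t). AE \<omega> in M. \<omega> \<in> A \<longleftrightarrow> \<omega> \<in> B"
  using assms unfolding sets_augmented_filtration
proof (induction rule: sigma_sets.induct)
  case (Basic A)
  then show ?case
  proof
    assume "A \<in> null_sets M"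
    then have "AE \<omega> in M. \<omega> \<in> A \<longleftrightarrow> \<omega> \<in> {}" using AE_not_in by fastforce
    then show ?thesis by blast
  qed (auto intro!: bexI[of _ A])
next
  case Empty
  show ?case by (rule bexI[of _ "{}"]) auto
next
  case (Compl A)
  then obtain B where B: "B\<in>sets (natural_filtration M W t)" "AE \<omega> in M. \<omega> \<in> A \<longleftrightarrow> \<omega> \<in> B" by auto
  have "space M - B \<in> sets (natural_filtration M W t)"
    using B(1) sets.compl_sets by fastforce
  moreover from B(2) AE_space have "AE \<omega> in M. \<omega> \<in> space M - A \<longleftrightarrow> \<omega> \<in> space M - B"
    by eventually_elim auto
  ultimately show ?case by blast
next
  case (Union A)
  then obtain B where B: "\<And>i::nat. B i\<in>sets (natural_filtration M W t)" "\<And>i. AE \<omega> in M. \<omega> \<in> A i \<longleftrightarrow> \<omega> \<in> B i"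
    by metis
  have "AE \<omega> in M. \<forall>i. \<omega> \<in> A i \<longleftrightarrow> \<omega> \<in> B i" using B(2) by (simp add: AE_all_countable)
  then have "AE \<omega> in M. \<omega> \<in> (\<Union>i. A i) \<longleftrightarrow> \<omega> \<in> (\<Union>i. B i)" by (auto elim: eventually_mono)
  moreover have "(\<Union>i. B i) \<in> sets (natural_filtration M W t)" using B(1) by blast
  ultimately show ?case by (rule bexI)
qed

lemma indep_set_mono:
  "indep_set A' B' \<Longrightarrow> A \<subseteq> A' \<Longrightarrow> B \<subseteq> B' \<Longrightarrow> indep_set A B"
  unfolding indep_sets2_eq by blast

text \<open>Independence is assumed for the natural filtration only; replacing a past event by its
  almost surely equal natural partner changes no probability. The function \<open>f\<close> is there
  because both the increment and its square are used.\<close>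

lemma increment_indep_augmented:
  assumes "0 \<le> s" "s < t" and Z: "Z \<in> borel_measurable (\<F> s)" and f: "f \<in> borel_measurable borel"
  shows "indep_var borel Z borel (\<lambda>\<omega>. f (W t \<omega> - W s \<omega>) :: real)"
proof -
  let ?E = "{(\<lambda>\<omega>. W t \<omega> - W s \<omega>) -` U \<inter> space M | U. U \<in> sets borel}"
  have ind: "indep_set (sets (natural_filtration M W s)) ?E"
    by (rule independent_increments[OF assms(1,2)])
  have Zm: "Z \<in> borel_measurable M" using Z measurable_augmented_filtration by blast
  have Wm: "(\<lambda>\<omega>. W t \<omega> - W s \<omega>) \<in> borel_measurable M"
    using measurable_W[of s] measurable_W[of t] assms by auto
  have fWm: "(\<lambda>\<omega>. f (W t \<omega> - W s \<omega>)) \<in> borel_measurable M" using measurable_compose[OF Wm f] .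
  have sub1: "sigma_sets (space M) {Z -` A \<inter> space M |A. A \<in> sets borel} \<subseteq> sets (\<F> s)"
  proof -
    have "{Z -` A \<inter> space M |A. A \<in> sets borel} \<subseteq> sets (\<F> s)"
      using measurable_sets[OF Z] by auto
    from sets.sigma_sets_subset[OF this] show ?thesis by simp
  qed
  have sub2: "sigma_sets (space M) {(\<lambda>\<omega>. f (W t \<omega> - W s \<omega>)) -` A \<inter> space M |A. A \<in> sets borel} \<subseteq> ?E"
  proof -
    have "{(\<lambda>\<omega>. f (W t \<omega> - W s \<omega>)) -` A \<inter> space M |A. A \<in> sets borel} \<subseteq> ?E"
    proof safe
      fix A :: "real set" assume "A \<in> sets borel"
      then have "f -` A \<in> sets borel" using measurable_sets[OF f] by simp
      moreover have "(\<lambda>\<omega>. f (W t \<omega> - W s \<omega>)) -` A \<inter> space M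
         = (\<lambda>\<omega>. W t \<omega> - W s \<omega>) -` (f -` A) \<inter> space M" by auto
      ultimately show "\<exists>U. (\<lambda>\<omega>. f (W t \<omega> - W s \<omega>)) -` A \<inter> space M
         = (\<lambda>\<omega>. W t \<omega> - W s \<omega>) -` U \<inter> space M \<and> U \<in> sets borel" by blast
    qed
    then have "sigma_sets (space M) {(\<lambda>\<omega>. f (W t \<omega> - W s \<omega>)) -` A \<inter> space M |A. A \<in> sets borel}
       \<subseteq> sigma_sets (space M) ?E" by (rule sigma_sets_mono')
    \<comment> \<open>The preimages of the Borel sets already form a sigma-algebra.\<close>
    also have "\<dots> = ?E"
      using sigma_sets_vimage_commute[of "\<lambda>\<omega>. W t \<omega> - W s \<omega>" "space M" UNIV "sets borel"]
        sets.sigma_sets_eq[of "borel :: real measure"] unfolding space_borel by simp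
    finally show ?thesis .
  qed
  have "indep_set (sets (\<F> s)) ?E"
  proof (rule indep_setI)
    show "?E \<subseteq> events" using measurable_sets[OF Wm] by blast
    fix a e assume a: "a \<in> sets (\<F> s)" and e: "e \<in> ?E"
    have am: "a \<in> sets M" using a augmented_filtration_subset by auto
    have em: "e \<in> sets M" using e measurable_sets[OF Wm] by blast
    obtain b where b: "b\<in>sets (natural_filtration M W s)" "AE \<omega> in M. \<omega> \<in> a \<longleftrightarrow> \<omega> \<in> b"
      using augmented_filtration_AE_eq_natural[OF a] by auto
    have bm: "b \<in> sets M" using b natural_filtration_subset by auto
    have "prob (a \<inter> e) = prob (b \<inter> e)"
      proof (rule measure_eq_AE)
      show "AE \<omega> in M. (\<omega> \<in> a \<inter> e) = (\<omega> \<in> b \<inter> e)"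
        using b(2) by eventually_elim simp
    qed (use am em bm in simp_all)
    also have "\<dots> = prob b * prob e" using indep_setD[OF ind b(1) e] .
    also have "prob b = prob a"
      proof (rule measure_eq_AE)
      show "AE \<omega> in M. (\<omega> \<in> b) = (\<omega> \<in> a)"
        using b(2) by eventually_elim simp
    qed (use am em bm in simp_all)
    finally show "prob (a \<inter> e) = prob a * prob e" .
  qed (rule augmented_filtration_subset)
  then have *: "indep_set (sigma_sets (space M) {Z -` A \<inter> space M |A. A \<in> sets borel})
     (sigma_sets (space M) {(\<lambda>\<omega>. f (W t \<omega> - W s \<omega>)) -` A \<inter> space M |A. A \<in> sets borel})"
    using sub1 sub2 by (rule indep_set_mono)
  show ?thesis unfolding indep_var_eq by (intro conjI Zm fWm *)
qed

lemma increment_moments: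
  assumes "0 \<le> s" "s \<le> t"
  shows "integrable M (\<lambda>\<omega>. W t \<omega> - W s \<omega>)" "(LINT \<omega>|M. W t \<omega> - W s \<omega>) = 0"
    "integrable M (\<lambda>\<omega>. (W t \<omega> - W s \<omega>)\<^sup>2)" "(LINT \<omega>|M. (W t \<omega> - W s \<omega>)\<^sup>2) = t - s"
proof -
  have "integrable M (\<lambda>\<omega>. W t \<omega> - W s \<omega>) \<and> (LINT \<omega>|M. W t \<omega> - W s \<omega>) = 0 \<and>
    integrable M (\<lambda>\<omega>. (W t \<omega> - W s \<omega>)\<^sup>2) \<and> (LINT \<omega>|M. (W t \<omega> - W s \<omega>)\<^sup>2) = t - s"
  \<comment> \<open>Normality is assumed for \<open>s < t\<close> only; the degenerate increment is
    0.\<close>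
  proof (cases "s = t")
    case False
    then have st: "s < t" and p: "0 < sqrt (t - s)" using assms by auto
    have D: "distributed M lborel (\<lambda>\<omega>. W t \<omega> - W s \<omega>) (normal_density 0 (sqrt (t - s)))"
      by (rule normal_increments[OF assms(1) st])
    have 1: "integrable M (\<lambda>\<omega>. W t \<omega> - W s \<omega>)"
      using distributed_integrable[OF D, of "\<lambda>x. x"] integrable_normal_moment[OF p, of 0 1] by auto
    have 2: "(LINT \<omega>|M. W t \<omega> - W s \<omega>) = 0"
      using normal_distributed_expectation[OF p D] .
    have 3: "integrable M (\<lambda>\<omega>. (W t \<omega> - W s \<omega>)\<^sup>2)"
      using distributed_integrable[OF D, of "\<lambda>x. x\<^sup>2"] integrable_normal_moment[OF p, of 0 2] by auto
    have 4: "(LINT \<omega>|M. (W t \<omega> - W s \<omega>)\<^sup>2) = t - s"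
      using normal_distributed_variance[OF p D] st by (simp add: 2)
    from 1 2 3 4 show ?thesis by simp
  qed auto
  then show "integrable M (\<lambda>\<omega>. W t \<omega> - W s \<omega>)" "(LINT \<omega>|M. W t \<omega> - W s \<omega>) = 0"
    "integrable M (\<lambda>\<omega>. (W t \<omega> - W s \<omega>)\<^sup>2)" "(LINT \<omega>|M. (W t \<omega> - W s \<omega>)\<^sup>2) = t - s" by auto
qed

lemma increment_mult:
  assumes "0 \<le> s" "s \<le> t" and Z: "Z \<in> borel_measurable (\<F> s)" "integrable M Z"
  shows "integrable M (\<lambda>\<omega>. Z \<omega> * (W t \<omega> - W s \<omega>))"
    "(LINT \<omega>|M. Z \<omega> * (W t \<omega> - W s \<omega>)) = 0"
    "integrable M (\<lambda>\<omega>. Z \<omega> * (W t \<omega> - W s \<omega>)\<^sup>2)"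
    "(LINT \<omega>|M. Z \<omega> * (W t \<omega> - W s \<omega>)\<^sup>2) = (LINT \<omega>|M. Z \<omega>) * (t - s)"
proof -
  have "integrable M (\<lambda>\<omega>. Z \<omega> * (W t \<omega> - W s \<omega>)) \<and>
    (LINT \<omega>|M. Z \<omega> * (W t \<omega> - W s \<omega>)) = 0 \<and>
    integrable M (\<lambda>\<omega>. Z \<omega> * (W t \<omega> - W s \<omega>)\<^sup>2) \<and>
    (LINT \<omega>|M. Z \<omega> * (W t \<omega> - W s \<omega>)\<^sup>2) = (LINT \<omega>|M. Z \<omega>) * (t - s)"
  proof (cases "s = t")
    case False
    then have st: "s < t" using assms by auto
    note 1 = increment_indep_augmented[OF assms(1) st Z(1), of "\<lambda>x. x", simplified]
    note 2 = increment_indep_augmented[OF assms(1) st Z(1), of "\<lambda>x. x\<^sup>2", simplified]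
    note m = increment_moments[OF assms(1,2)]
    show ?thesis
      using indep_var_integrable[OF 1 Z(2) m(1)] indep_var_lebesgue_integral[OF 1 Z(2) m(1)]
       indep_var_integrable[OF 2 Z(2) m(3)] indep_var_lebesgue_integral[OF 2 Z(2) m(3)] m by simp
  qed auto
  then show "integrable M (\<lambda>\<omega>. Z \<omega> * (W t \<omega> - W s \<omega>))"
    "(LINT \<omega>|M. Z \<omega> * (W t \<omega> - W s \<omega>)) = 0"
    "integrable M (\<lambda>\<omega>. Z \<omega> * (W t \<omega> - W s \<omega>)\<^sup>2)"
    "(LINT \<omega>|M. Z \<omega> * (W t \<omega> - W s \<omega>)\<^sup>2) = (LINT \<omega>|M. Z \<omega>) * (t - s)" by auto
qed

end

section \<open>The Ito isometry and the martingale property\<close>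

lemma (in pair_sigma_finite) integral_mult_pair:
  fixes f g :: "_ \<Rightarrow> real"
  assumes f: "integrable M1 f" and g: "integrable M2 g"
  shows "integrable (M1 \<Otimes>\<^sub>M M2) (\<lambda>(x, y). f x * g y)"
    "(LINT z|(M1 \<Otimes>\<^sub>M M2). (case z of (x, y) \<Rightarrow> f x * g y)) = (LINT x|M1. f x) * (LINT y|M2. g y)"
proof -
  have [measurable]: "f \<in> borel_measurable M1" "g \<in> borel_measurable M2" using f g by auto
  show *: "integrable (M1 \<Otimes>\<^sub>M M2) (\<lambda>(x, y). f x * g y)"
    by (rule Fubini_integrable) (use f g in \<open>auto simp: abs_mult\<close>)
  show "(LINT z|(M1 \<Otimes>\<^sub>M M2). (case z of (x, y) \<Rightarrow> f x * g y)) = (LINT x|M1. f x) * (LINT y|M2. g y)"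
    using integral_fst'[OF *, symmetric] by simp
qed

section \<open>Covariances of Brownian increments weighted by a past variable\<close>

context standard_brownian_motion
begin

lemma integrable_bounded_mult:
  assumes "integrable M f" "g \<in> borel_measurable M" "\<And>\<omega>. \<omega> \<in> space M \<Longrightarrow> \<bar>g \<omega>\<bar> \<le> (K::real)"
  shows "integrable M (\<lambda>\<omega>. g \<omega> * f \<omega> :: real)"
proof (rule Bochner_Integration.integrable_bound)
  show "integrable M (\<lambda>\<omega>. K * f \<omega>)" using assms by simp
  show "(\<lambda>\<omega>. g \<omega> * f \<omega>) \<in> borel_measurable M" using assms by measurable
  show "AE \<omega> in M. norm (g \<omega> * f \<omega>) \<le> norm (K * f \<omega>)"
  proof (rule AE_I2)
    fix \<omega> assume "\<omega> \<in> space M"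
    from assms(3)[OF this] have "\<bar>g \<omega>\<bar> \<le> \<bar>K\<bar>" by linarith
    then show "norm (g \<omega> * f \<omega>) \<le> norm (K * f \<omega>)" by (simp add: abs_mult mult_right_mono)
  qed
qed

lemma increment_L2: "0 \<le> s \<Longrightarrow> 0 \<le> t \<Longrightarrow> L2 M (\<lambda>\<omega>. W t \<omega> - W s \<omega>)"
proof (induction s t rule: linorder_wlog)
  case (le s t)
  then show ?case using increment_moments[of s t] measurable_W[of s] measurable_W[of t] by (simp add: L2_def)
next
  case (sym s t)
  then show ?case using L2_cmult[of M "\<lambda>\<omega>. W s \<omega> - W t \<omega>" "-1"] by simp
qed

text \<open>As \<open>b \<le> c\<close>, the product of \<open>Z\<close> and the earlier increment
  is known at time \<open>c\<close>, and the later increment has mean 0 independently of it.\<close>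

lemma increments_disjoint:
  assumes "0 \<le> a" "a \<le> b" "b \<le> c" "c \<le> d"
    and Z: "Z \<in> borel_measurable (\<F> c)" "\<And>\<omega>. \<omega> \<in> space M \<Longrightarrow> \<bar>Z \<omega>\<bar> \<le> K"
  shows "(LINT \<omega>|M. Z \<omega> * ((W b \<omega> - W a \<omega>) * (W d \<omega> - W c \<omega>))) = 0"
proof -
  have [measurable]: "Z \<in> borel_measurable (\<F> c)" "W a \<in> borel_measurable (\<F> c)" "W b \<in> borel_measurable (\<F> c)"
    using Z W_adapted assms by auto
  have 1: "(\<lambda>\<omega>. Z \<omega> * (W b \<omega> - W a \<omega>)) \<in> borel_measurable (\<F> c)" by measurable
  have 2: "integrable M (\<lambda>\<omega>. Z \<omega> * (W b \<omega> - W a \<omega>))"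
    using assms measurable_augmented_filtration[OF Z(1)]
    by (intro integrable_bounded_mult[where K=K] increment_moments) auto
  show ?thesis using increment_mult(2)[OF _ assms(4) 1 2] assms by (simp add: mult.assoc)
qed

text \<open>Splitting the longer increment at \<open>p\<close> leaves a square, which contributes
  the length \<open>p - c\<close>, and a product of disjoint increments, which contributes
  0.\<close>

lemma increments_same_start:
  assumes "0 \<le> c" "c \<le> p" "p \<le> q"
    and Z: "Z \<in> borel_measurable (\<F> c)" "\<And>\<omega>. \<omega> \<in> space M \<Longrightarrow> \<bar>Z \<omega>\<bar> \<le> K"
  shows "(LINT \<omega>|M. Z \<omega> * ((W p \<omega> - W c \<omega>) * (W q \<omega> - W c \<omega>))) = (LINT \<omega>|M. Z \<omega>) * (p - c)"
proof -
  have Zm: "Z \<in> borel_measurable M" using measurable_augmented_filtration[OF Z(1)] .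
  have Zi: "integrable M Z" by (rule integrable_const_bound[of Z K]) (use Z Zm in auto)
  have Zp: "Z \<in> borel_measurable (\<F> p)" using Z(1) assms(2) by (rule measurable_augmented_filtration_mono)
  have "(LINT \<omega>|M. Z \<omega> * ((W p \<omega> - W c \<omega>) * (W q \<omega> - W c \<omega>)))
     = (LINT \<omega>|M. Z \<omega> * (W p \<omega> - W c \<omega>)\<^sup>2 + Z \<omega> * ((W p \<omega> - W c \<omega>) * (W q \<omega> - W p \<omega>)))"
    by (intro Bochner_Integration.integral_cong) (auto simp: algebra_simps power2_eq_square)
  also have "\<dots> = (LINT \<omega>|M. Z \<omega> * (W p \<omega> - W c \<omega>)\<^sup>2) + (LINT \<omega>|M. Z \<omega> * ((W p \<omega> - W c \<omega>) * (W q \<omega> - W p \<omega>)))"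
    using assms by (intro Bochner_Integration.integral_add integrable_bounded_mult[OF _ Zm Z(2)] L2_mult increment_moments increment_L2) auto
  also have "\<dots> = (LINT \<omega>|M. Z \<omega>) * (p - c)"
    using increment_mult(4)[OF assms(1,2) Z(1) Zi] increments_disjoint[OF assms(1-2) order.refl assms(3) Zp Z(2)] by simp
  finally show ?thesis .
qed

text \<open>The factor \<open>max 0 (min b d - max a c)\<close> is the length of the intersection of
  the two intervals. By symmetry \<open>a \<le> c\<close>; the part of the first increment before
  \<open>c\<close> is uncorrelated with the second, and the rest starts at the common time
  \<open>c\<close>. Being known at \<open>max a c\<close>, the start of the overlap, is exactly what
  a product of two coefficients satisfies.\<close>

lemma increments_overlap:
  assumes "0 \<le> a" "a \<le> b" "0 \<le> c" "c \<le> d"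
    and "Z \<in> borel_measurable (\<F> (max a c))" "\<And>\<omega>. \<omega> \<in> space M \<Longrightarrow> \<bar>Z \<omega>\<bar> \<le> K"
  shows "(LINT \<omega>|M. Z \<omega> * ((W b \<omega> - W a \<omega>) * (W d \<omega> - W c \<omega>)))
    = (LINT \<omega>|M. Z \<omega>) * max 0 (min b d - max a c)"
  using assms
proof (induction a c arbitrary: b d rule: linorder_wlog)
  case (sym a c)
  from sym(1)[of d b] sym show ?case by (simp add: max.commute min.commute mult.commute)
next
  case (le a c)
  then have Z: "Z \<in> borel_measurable (\<F> c)" "\<And>\<omega>. \<omega> \<in> space M \<Longrightarrow> \<bar>Z \<omega>\<bar> \<le> K"
    and ord: "0 \<le> a" "a \<le> b" "0 \<le> c" "c \<le> d" "a \<le> c" by (auto simp: max_absorb2)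
  have Zm: "Z \<in> borel_measurable M" using measurable_augmented_filtration[OF Z(1)] .
  show ?case
  proof (cases "b \<le> c")
    case True
    then have "max 0 (min b d - max a c) = 0" by auto
    then show ?thesis using increments_disjoint[OF ord(1,2) True ord(4) Z] by simp
  next
    case False
    have "(LINT \<omega>|M. Z \<omega> * ((W b \<omega> - W a \<omega>) * (W d \<omega> - W c \<omega>)))
      = (LINT \<omega>|M. Z \<omega> * ((W c \<omega> - W a \<omega>) * (W d \<omega> - W c \<omega>)) + Z \<omega> * ((W b \<omega> - W c \<omega>) * (W d \<omega> - W c \<omega>)))"
      by (intro Bochner_Integration.integral_cong) (auto simp: algebra_simps)
    also have "\<dots> = (LINT \<omega>|M. Z \<omega> * ((W c \<omega> - W a \<omega>) * (W d \<omega> - W c \<omega>)))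
       + (LINT \<omega>|M. Z \<omega> * ((W b \<omega> - W c \<omega>) * (W d \<omega> - W c \<omega>)))"
      using ord by (intro Bochner_Integration.integral_add integrable_bounded_mult[OF _ Zm Z(2)] L2_mult increment_L2) auto
    also have "\<dots> = (LINT \<omega>|M. Z \<omega> * ((W b \<omega> - W c \<omega>) * (W d \<omega> - W c \<omega>)))"
      using increments_disjoint[OF ord(1,5) order.refl ord(4) Z] by simp
    also have "\<dots> = (LINT \<omega>|M. Z \<omega>) * (min b d - c)"
    proof (cases "b \<le> d")
      case True
      then show ?thesis using increments_same_start[OF ord(3) _ True Z] False by simp
    next
      case F: False
      then have "d \<le> b" by simp
      from increments_same_start[OF ord(3,4) this Z] F show ?thesis by (simp add: mult.commute[of "W b _ - _"])
    qed
    also have "min b d - c = max 0 (min b d - max a c)" using False ord by auto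
    finally show ?thesis .
  qed
qed

section \<open>Elementary stochastic integrals\<close>

text \<open>Unlike in a simple process, the intervals \<open>(a\<^sub>i, b\<^sub>i]\<close> may overlap: the difference of two
  elementary processes is then elementary, and no common refinement of partitions is needed.\<close>

definition elementary :: "'i set \<Rightarrow> ('i \<Rightarrow> real) \<Rightarrow> ('i \<Rightarrow> real) \<Rightarrow> ('i \<Rightarrow> 'a \<Rightarrow> real) \<Rightarrow> bool" where
  "elementary I a b \<xi> \<longleftrightarrow> finite I \<and> (\<forall>i\<in>I. 0 \<le> a i \<and> a i \<le> b i \<and> \<xi> i \<in> borel_measurable (\<F> (a i)) \<and>
     (\<exists>K. \<forall>\<omega>\<in>space M. \<bar>\<xi> i \<omega>\<bar> \<le> K))"

definition elementary_integral :: "'i set \<Rightarrow> ('i \<Rightarrow> real) \<Rightarrow> ('i \<Rightarrow> real) \<Rightarrow> ('i \<Rightarrow> 'a \<Rightarrow> real) \<Rightarrow> real \<Rightarrow> 'a \<Rightarrow> real" where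
  "elementary_integral I a b \<xi> T \<omega> = (\<Sum>i\<in>I. \<xi> i \<omega> * (W (min T (b i)) \<omega> - W (min T (a i)) \<omega>))"

definition elementary_process :: "'i set \<Rightarrow> ('i \<Rightarrow> real) \<Rightarrow> ('i \<Rightarrow> real) \<Rightarrow> ('i \<Rightarrow> 'a \<Rightarrow> real) \<Rightarrow> real \<Rightarrow> 'a \<Rightarrow> real" where
  "elementary_process I a b \<xi> t \<omega> = (\<Sum>i\<in>I. indicator {a i<..b i} t * \<xi> i \<omega>)"

text \<open>The isometry term by term: both sides equal the mean of
  \<open>\<xi> \<omega> * \<eta> \<omega>\<close> times the length of the overlap of the two
  intervals within [0, T].\<close>

lemma elementary_term_isometry:
  assumes T: "0 \<le> T" and ord: "0 \<le> a" "a \<le> b" "0 \<le> c" "c \<le> d"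
    and \<xi>: "\<xi> \<in> borel_measurable (\<F> a)" "\<And>\<omega>. \<omega> \<in> space M \<Longrightarrow> \<bar>\<xi> \<omega>\<bar> \<le> K"
    and \<eta>: "\<eta> \<in> borel_measurable (\<F> c)" "\<And>\<omega>. \<omega> \<in> space M \<Longrightarrow> \<bar>\<eta> \<omega>\<bar> \<le> L"
  shows "(LINT \<omega>|M. (\<xi> \<omega> * \<eta> \<omega>) * ((W (min T b) \<omega> - W (min T a) \<omega>) * (W (min T d) \<omega> - W (min T c) \<omega>)))
     = (LINT z|\<mu>. (case z of (t, \<omega>) \<Rightarrow> (indicator {0..T} t * indicator {a<..b} t * indicator {c<..d} t) * (\<xi> \<omega> * \<eta> \<omega>)))" (is "?l = ?r")
    "integrable \<mu> (\<lambda>(t, \<omega>). (indicator {0..T} t * indicator {a<..b} t * indicator {c<..d} t) * (\<xi> \<omega> * \<eta> \<omega>))"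
proof -
  let ?i = "\<lambda>t::real. indicator {0..T} t * indicator {a<..b} t * indicator {c<..d} t :: real"
  have [measurable]: "\<xi> \<in> borel_measurable M" "\<eta> \<in> borel_measurable M"
    using \<xi>(1) \<eta>(1) measurable_augmented_filtration by blast+
  have "\<xi> \<in> borel_measurable (\<F> (max a c))" "\<eta> \<in> borel_measurable (\<F> (max a c))"
    using \<xi>(1) \<eta>(1) by (auto intro: measurable_augmented_filtration_mono)
  then have Z: "(\<lambda>\<omega>. \<xi> \<omega> * \<eta> \<omega>) \<in> borel_measurable (\<F> (max a c))" by measurable
  have ZK: "\<bar>\<xi> \<omega> * \<eta> \<omega>\<bar> \<le> K * L" if "\<omega> \<in> space M" for \<omega>
    using mult_mono[OF \<xi>(2)[OF that] \<eta>(2)[OF that]] \<xi>(2)[OF that] by (simp add: abs_mult)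
  have Zi: "integrable M (\<lambda>\<omega>. \<xi> \<omega> * \<eta> \<omega>)"
    by (rule integrable_const_bound[of _ "K * L"]) (use ZK in auto)
  have ind: "?i t = indicator {max a c<..min T (min b d)} t" for t
    using ord by (auto simp: indicator_def)
  have meas: "measure lborel {x<..y::real} = max 0 (y - x)" for x y
    by (cases "x \<le> y") simp_all
  have fin: "emeasure lborel {x<..y::real} < \<infinity>" for x y by (cases "x \<le> y") simp_all
  have ii: "integrable lborel ?i" unfolding ind by (rule integrable_real_indicator[OF _ fin]) simp
  have iv: "(LINT t|lborel. ?i t) = max 0 (min T (min b d) - max a c)"
    unfolding ind using meas by simp
  show "integrable \<mu> (\<lambda>(t, \<omega>). ?i t * (\<xi> \<omega> * \<eta> \<omega>))"
    by (rule time_prob.integral_mult_pair(1)[OF ii Zi])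
  have r: "?r = max 0 (min T (min b d) - max a c) * (LINT \<omega>|M. \<xi> \<omega> * \<eta> \<omega>)"
    using time_prob.integral_mult_pair(2)[OF ii Zi] iv by simp
  show "?l = ?r"
  \<comment> \<open>If the overlap could start only at \<open>T\<close> or later, the coefficients
    need not be known at the truncated times and the covariance formula does not apply; but then one
    of the two truncated increments is 0.\<close>
  proof (cases "T \<le> max a c")
    case True
    then have "min T a = min T b \<or> min T c = min T d" using ord by auto
    then have "?l = 0" by auto
    moreover have "max 0 (min T (min b d) - max a c) = 0" using True by linarith
    ultimately show ?thesis using r by (simp only: mult_zero_left)
  next
    case False
    then have m: "min T a = a" "min T c = c" by linarith+
    have o: "a \<le> min T b" "c \<le> min T d" using False ord by linarith+
    have "?l = (LINT \<omega>|M. \<xi> \<omega> * \<eta> \<omega>) * max 0 (min (min T b) (min T d) - max a c)"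
      unfolding m(1) m(2) by (rule increments_overlap[OF ord(1) o(1) ord(3) o(2) Z ZK])
    also have "min (min T b) (min T d) = min T (min b d)" by linarith
    finally have "?l = (LINT \<omega>|M. \<xi> \<omega> * \<eta> \<omega>) * max 0 (min T (min b d) - max a c)" .
    then show ?thesis unfolding r by (subst (2) mult.commute)
  qed
qed

text \<open>Equal, overlapping and disjoint intervals obey one covariance formula, so the square
  expands into a double sum whose diagonal needs no separate treatment.\<close>

lemma elementary_isometry:
  assumes el: "elementary I a b \<xi>" and T: "0 \<le> T"
  shows "L2 M (elementary_integral I a b \<xi> T)"
    "L2 \<mu> (cutoff {0..T} (elementary_process I a b \<xi>))"
    "(LINT \<omega>|M. (elementary_integral I a b \<xi> T \<omega>)\<^sup>2) = (LINT z|\<mu>. (cutoff {0..T} (elementary_process I a b \<xi>) z)\<^sup>2)"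
proof -
  have ab: "0 \<le> a i" "a i \<le> b i" "\<xi> i \<in> borel_measurable (\<F> (a i))" if "i \<in> I" for i
    using el that by (auto simp: elementary_def)
  obtain K where K: "\<bar>\<xi> i \<omega>\<bar> \<le> K i" if "i \<in> I" "\<omega> \<in> space M" for i \<omega>
    using el unfolding elementary_def by metis
  have \<xi>m: "\<xi> i \<in> borel_measurable M" if "i \<in> I" for i
    using ab(3)[OF that] measurable_augmented_filtration by blast
  have L2t: "L2 M (\<lambda>\<omega>. \<xi> i \<omega> * (W (min T (b i)) \<omega> - W (min T (a i)) \<omega>))" if "i \<in> I" for i
  proof (rule L2_bound[OF L2_cmult[OF increment_L2], where c1="K i"])
    show "(\<lambda>\<omega>. \<xi> i \<omega> * (W (min T (b i)) \<omega> - W (min T (a i)) \<omega>)) \<in> borel_measurable M"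
      using \<xi>m[OF that] ab[OF that] T measurable_W[of "min T (b i)"] measurable_W[of "min T (a i)"] by simp
    show "AE x in M. \<bar>\<xi> i x * (W (min T (b i)) x - W (min T (a i)) x)\<bar> \<le> \<bar>K i * (W (min T (b i)) x - W (min T (a i)) x)\<bar>"
    proof (rule AE_I2)
      fix x assume "x \<in> space M"
      from K[OF that this] have "\<bar>\<xi> i x\<bar> \<le> \<bar>K i\<bar>" by linarith
      then show "\<bar>\<xi> i x * (W (min T (b i)) x - W (min T (a i)) x)\<bar> \<le> \<bar>K i * (W (min T (b i)) x - W (min T (a i)) x)\<bar>"
        by (simp add: abs_mult mult_right_mono)
    qed
  qed (use ab[OF that] T in auto)
  show "L2 M (elementary_integral I a b \<xi> T)"
    unfolding elementary_integral_def[abs_def] by (rule L2_sum) (rule L2t)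
  let ?f = "\<lambda>i j (t, \<omega>). (indicator {0..T} t * indicator {a i<..b i} t * indicator {a j<..b j} t) * (\<xi> i \<omega> * \<xi> j \<omega>) :: real"
  have sq: "(cutoff {0..T} (elementary_process I a b \<xi>) z)\<^sup>2 = (\<Sum>i\<in>I. \<Sum>j\<in>I. ?f i j z)" for z
  proof (cases z)
    case (Pair t \<omega>)
    have "cutoff {0..T} (elementary_process I a b \<xi>) z = (\<Sum>i\<in>I. indicator {0..T} t * (indicator {a i<..b i} t * \<xi> i \<omega>))"
      by (simp only: Pair cutoff_def elementary_process_def sum_distrib_left prod.case real_scaleR_def)
    then show ?thesis unfolding power2_eq_square
      by (simp only: sum_product Pair prod.case) (intro sum.cong refl, auto simp: indicator_def)
  qed
  have int: "integrable \<mu> (?f i j)" if "i \<in> I" "j \<in> I" for i j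
    using elementary_term_isometry(2)[OF T ab(1,2)[OF that(1)] ab(1,2)[OF that(2)] ab(3)[OF that(1)] K[OF that(1)] ab(3)[OF that(2)] K[OF that(2)]] .
  have "cutoff {0..T} (elementary_process I a b \<xi>) \<in> borel_measurable \<mu>"
    unfolding cutoff_def elementary_process_def using \<xi>m by measurable
  then show "L2 \<mu> (cutoff {0..T} (elementary_process I a b \<xi>))"
    unfolding L2_def sq using int by auto
  have "(LINT \<omega>|M. (elementary_integral I a b \<xi> T \<omega>)\<^sup>2) = (LINT \<omega>|M. (\<Sum>i\<in>I. \<Sum>j\<in>I.
    (\<xi> i \<omega> * (W (min T (b i)) \<omega> - W (min T (a i)) \<omega>)) * (\<xi> j \<omega> * (W (min T (b j)) \<omega> - W (min T (a j)) \<omega>))))"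
    by (simp add: elementary_integral_def power2_eq_square sum_product)
  also have "\<dots> = (\<Sum>i\<in>I. \<Sum>j\<in>I. (LINT \<omega>|M.
    (\<xi> i \<omega> * (W (min T (b i)) \<omega> - W (min T (a i)) \<omega>)) * (\<xi> j \<omega> * (W (min T (b j)) \<omega> - W (min T (a j)) \<omega>))))"
    using L2_mult[OF L2t L2t] by (simp add: integrable_sum)
  also have "\<dots> = (\<Sum>i\<in>I. \<Sum>j\<in>I. (LINT z|\<mu>. ?f i j z))"
  proof (intro sum.cong refl)
    fix i j assume that: "i \<in> I" "j \<in> I"
    have "(LINT \<omega>|M.
    (\<xi> i \<omega> * (W (min T (b i)) \<omega> - W (min T (a i)) \<omega>)) * (\<xi> j \<omega> * (W (min T (b j)) \<omega> - W (min T (a j)) \<omega>)))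
      = (LINT \<omega>|M. (\<xi> i \<omega> * \<xi> j \<omega>) * ((W (min T (b i)) \<omega> - W (min T (a i)) \<omega>) * (W (min T (b j)) \<omega> - W (min T (a j)) \<omega>)))"
      by (simp only: mult_ac)
    also have "\<dots> = (LINT z|\<mu>. ?f i j z)"
      by (rule elementary_term_isometry(1)[OF T ab(1,2)[OF that(1)] ab(1,2)[OF that(2)] ab(3)[OF that(1)] K[OF that(1)] ab(3)[OF that(2)] K[OF that(2)]])
    finally show "(LINT \<omega>|M.
    (\<xi> i \<omega> * (W (min T (b i)) \<omega> - W (min T (a i)) \<omega>)) * (\<xi> j \<omega> * (W (min T (b j)) \<omega> - W (min T (a j)) \<omega>)))
      = (LINT z|\<mu>. ?f i j z)" .
  qed
  also have "\<dots> = (LINT z|\<mu>. (\<Sum>i\<in>I. \<Sum>j\<in>I. ?f i j z))"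
    using int by (simp add: integrable_sum)
  finally show "(LINT \<omega>|M. (elementary_integral I a b \<xi> T \<omega>)\<^sup>2) = (LINT z|\<mu>. (cutoff {0..T} (elementary_process I a b \<xi>) z)\<^sup>2)"
    unfolding sq .
qed

lemma elementary_isometry_diff:
  assumes el: "elementary I a b \<xi>" "elementary J c d \<eta>" and T: "0 \<le> T"
  shows "(LINT \<omega>|M. (elementary_integral I a b \<xi> T \<omega> - elementary_integral J c d \<eta> T \<omega>)\<^sup>2)
    = (LINT z|\<mu>. (cutoff {0..T} (elementary_process I a b \<xi>) z - cutoff {0..T} (elementary_process J c d \<eta>) z)\<^sup>2)"
proof -
  \<comment> \<open>The difference is one elementary process over the disjoint union of the index
    sets, with the second family of coefficients negated.\<close>
  let ?a = "case_sum a c" and ?b = "case_sum b d" and ?\<xi> = "case_sum \<xi> (\<lambda>j \<omega>. - \<eta> j \<omega>)"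
  have fin: "finite I" "finite J" using el by (auto simp: elementary_def)
  have "elementary (I <+> J) ?a ?b ?\<xi>"
    using el by (auto simp: elementary_def)
  from elementary_isometry(3)[OF this T]
  have "(LINT \<omega>|M. (elementary_integral (I <+> J) ?a ?b ?\<xi> T \<omega>)\<^sup>2)
     = (LINT z|\<mu>. (cutoff {0..T} (elementary_process (I <+> J) ?a ?b ?\<xi>) z)\<^sup>2)" .
  moreover have "elementary_integral (I <+> J) ?a ?b ?\<xi> T \<omega>
    = elementary_integral I a b \<xi> T \<omega> - elementary_integral J c d \<eta> T \<omega>" for \<omega>
    using fin by (simp add: elementary_integral_def sum.Plus sum_negf)
  moreover have "cutoff {0..T} (elementary_process (I <+> J) ?a ?b ?\<xi>) z
     = cutoff {0..T} (elementary_process I a b \<xi>) z - cutoff {0..T} (elementary_process J c d \<eta>) z" for z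
    using fin by (cases z) (simp add: elementary_process_def cutoff_def sum.Plus sum_negf right_diff_distrib del: sum_mult_indicator sum_indicator_mult)
  ultimately show ?thesis by simp
qed

text \<open>Cutting each interval at \<open>t\<close> shows that the integrals up to
  \<open>T\<close> and up to \<open>t\<close> differ by increments starting at \<open>t\<close> or
  later. Where such an increment starts, its factor \<open>\<xi> i \<omega> * Z \<omega>\<close> is
  already known, so its contribution has mean 0.\<close>

lemma elementary_martingale:
  assumes el: "elementary I a b \<xi>" and t: "0 \<le> t" "t \<le> T"
    and Z: "Z \<in> borel_measurable (\<F> t)" "L2 M Z"
  shows "(LINT \<omega>|M. elementary_integral I a b \<xi> T \<omega> * Z \<omega>) = (LINT \<omega>|M. elementary_integral I a b \<xi> t \<omega> * Z \<omega>)"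
proof -
  have Zi: "integrable M Z"
    using square_integrable_imp_integrable[of Z] L2_measurable[OF Z(2)] L2_square[OF Z(2)] by simp
  have "(LINT \<omega>|M. elementary_integral I a b \<xi> T \<omega> * Z \<omega>) - (LINT \<omega>|M. elementary_integral I a b \<xi> t \<omega> * Z \<omega>)
     = (LINT \<omega>|M. elementary_integral I a b \<xi> T \<omega> * Z \<omega> - elementary_integral I a b \<xi> t \<omega> * Z \<omega>)"
    using elementary_isometry(1)[OF el] t Z(2) by (simp add: L2_mult)
  also have "\<dots> = (LINT \<omega>|M. (\<Sum>i\<in>I. (\<xi> i \<omega> * Z \<omega>) * (W (min T (max t (b i))) \<omega> - W (min T (max t (a i))) \<omega>)))"
  proof (intro Bochner_Integration.integral_cong refl)
    fix \<omega>
    have "W (min T (b i)) \<omega> - W (min T (a i)) \<omega> - (W (min t (b i)) \<omega> - W (min t (a i)) \<omega>)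
       = W (min T (max t (b i))) \<omega> - W (min T (max t (a i))) \<omega>" if "i \<in> I" for i
    proof -
      \<comment> \<open>Either way this is the increment from \<open>t\<close> to \<open>s\<close>
        clamped to [t, T].\<close>
      have "W (min T s) \<omega> - W (min t s) \<omega> = W (min T (max t s)) \<omega> - W t \<omega>" for s
        using t by (cases "s \<le> t") (auto simp: min_def max_def)
      from this[of "b i"] this[of "a i"] show ?thesis by linarith
    qed
    then show "elementary_integral I a b \<xi> T \<omega> * Z \<omega> - elementary_integral I a b \<xi> t \<omega> * Z \<omega>
      = (\<Sum>i\<in>I. (\<xi> i \<omega> * Z \<omega>) * (W (min T (max t (b i))) \<omega> - W (min T (max t (a i))) \<omega>))"
      unfolding elementary_integral_def sum_distrib_right sum_subtractf[symmetric]
      by (intro sum.cong refl) (simp flip: left_diff_distrib right_diff_distrib add: mult_ac)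
  qed
  also have "\<dots> = 0"
  proof -
    have "integrable M (\<lambda>\<omega>. (\<xi> i \<omega> * Z \<omega>) * (W (min T (max t (b i))) \<omega> - W (min T (max t (a i))) \<omega>))
      \<and> (LINT \<omega>|M. (\<xi> i \<omega> * Z \<omega>) * (W (min T (max t (b i))) \<omega> - W (min T (max t (a i))) \<omega>)) = 0" if i: "i \<in> I" for i
    proof (cases "a i \<le> T")
      case True
      then have p: "min T (max t (a i)) = max t (a i)" using t by auto
      have \<xi>: "\<xi> i \<in> borel_measurable (\<F> (a i))" and ab: "a i \<le> b i" using el i by (auto simp: elementary_def)
      obtain K where K: "\<And>\<omega>. \<omega> \<in> space M \<Longrightarrow> \<bar>\<xi> i \<omega>\<bar> \<le> K" using el i unfolding elementary_def by blast
      have "\<xi> i \<in> borel_measurable (\<F> (max t (a i)))" "Z \<in> borel_measurable (\<F> (max t (a i)))"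
        using \<xi> Z(1) by (auto intro: measurable_augmented_filtration_mono)
      then have 1: "(\<lambda>\<omega>. \<xi> i \<omega> * Z \<omega>) \<in> borel_measurable (\<F> (max t (a i)))" by measurable
      have 2: "integrable M (\<lambda>\<omega>. \<xi> i \<omega> * Z \<omega>)"
        by (rule integrable_bounded_mult[OF Zi measurable_augmented_filtration[OF \<xi>] K])
      have 3: "0 \<le> max t (a i)" "max t (a i) \<le> min T (max t (b i))" using t ab True by auto
      show ?thesis unfolding p using increment_mult(1,2)[OF 3 1 2] by blast
    next
      \<comment> \<open>For an interval beyond the horizon, \<open>\<xi> i\<close> need not be known
        at \<open>T\<close>, but both clamped endpoints equal \<open>T\<close> and the increment is
        0.\<close>
      case False
      moreover have "a i \<le> b i" using el i by (auto simp: elementary_def)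
      ultimately have "min T (max t (a i)) = T" "min T (max t (b i)) = T" using t by auto
      then show ?thesis by simp
    qed
    then show ?thesis by (simp add: integrable_sum)
  qed
  finally show ?thesis by simp
qed


section \<open>Processes as functions on time times sample space\<close>

lemma progressively_measurable_cutoff:
  fixes X :: "real \<Rightarrow> 'a \<Rightarrow> 'b::{real_normed_vector, second_countable_topology}"
  assumes X: "progressively_measurable \<F> X" and T: "0 \<le> T"
  shows "cutoff {0..T} X \<in> borel_measurable \<mu>"
proof -
  have "(\<lambda>(t, \<omega>). X t \<omega>) \<in> borel_measurable (restrict_space borel {0..T} \<Otimes>\<^sub>M \<F> T)"
    using X T by (auto simp: progressively_measurable_def)
  moreover have "(\<lambda>z. z) \<in> measurable (restrict_space borel {0..T} \<Otimes>\<^sub>M M) (restrict_space borel {0..T} \<Otimes>\<^sub>M \<F> T)"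
    using measurable_augmented_filtration[OF measurable_ident, of T]
    by (intro measurable_pair) (auto simp: comp_def id_def intro: measurable_compose[OF measurable_snd])
  ultimately have 1: "(\<lambda>(t, \<omega>). X t \<omega>) \<in> borel_measurable (restrict_space borel {0..T} \<Otimes>\<^sub>M M)"
    using measurable_compose by blast
  \<comment> \<open>Bridges the product with the restricted time axis, where progressive
    measurability is stated, and the restriction of the product space, from which a function can be
    extended by zero.\<close>
  have 2: "(\<lambda>z. z) \<in> measurable (restrict_space \<mu> ({0..T} \<times> space M)) (restrict_space borel {0..T} \<Otimes>\<^sub>M M)"
  proof (rule measurable_pair)
    have "fst \<in> measurable (restrict_space \<mu> ({0..T} \<times> space M)) borel"
      by (intro measurable_restrict_space1) (auto intro: measurable_fst'')
    then show "fst \<circ> (\<lambda>z. z) \<in> measurable (restrict_space \<mu> ({0..T} \<times> space M)) (restrict_space borel {0..T})"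
      by (auto simp: comp_def space_restrict_space intro!: measurable_restrict_space2)
    show "snd \<circ> (\<lambda>z. z) \<in> measurable (restrict_space \<mu> ({0..T} \<times> space M)) M"
      by (auto simp: comp_def intro!: measurable_restrict_space1)
  qed
  have 3: "(\<lambda>(t, \<omega>). X t \<omega>) \<in> borel_measurable (restrict_space \<mu> ({0..T} \<times> space M))"
    using measurable_compose[OF 2 1] by simp
  have "{0..T} \<times> space M \<inter> space \<mu> \<in> sets \<mu>"
    by (auto simp: space_pair_measure Times_Int_Times)
  then have "(\<lambda>z. indicator ({0..T} \<times> space M) z *\<^sub>R (case z of (t, \<omega>) \<Rightarrow> X t \<omega>)) \<in> borel_measurable \<mu>"
    using 3 by (subst (asm) borel_measurable_restrict_space_iff) auto
  then show ?thesis
    by (rule measurable_cong[THEN iffD1, rotated]) (auto simp: cutoff_def space_pair_measure indicator_def)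
qed

lemma mean_square_eq_cutoff:
  fixes X :: "real \<Rightarrow> 'a \<Rightarrow> 'b::{real_normed_vector, second_countable_topology}"
  assumes [measurable]: "cutoff I X \<in> borel_measurable \<mu>"
  shows "mean_square M I X = (\<integral>\<^sup>+ z. ennreal ((norm (cutoff I X z))\<^sup>2) \<partial>\<mu>)"
proof -
  have "mean_square M I X = (\<integral>\<^sup>+ \<omega>. (\<integral>\<^sup>+ t. ennreal ((norm (cutoff I X (t, \<omega>)))\<^sup>2) \<partial>lborel) \<partial>M)"
    unfolding mean_square_def cutoff_def
    by (intro nn_integral_cong) (auto simp: indicator_def)
  also have "\<dots> = (\<integral>\<^sup>+ z. ennreal ((norm (cutoff I X z))\<^sup>2) \<partial>\<mu>)"
    by (rule time_prob.nn_integral_snd) measurable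
  finally show ?thesis .
qed

lemma cutoff_inner: "cutoff I (\<lambda>t \<omega>. u \<bullet> X t \<omega>) z = u \<bullet> cutoff I X z"
  by (cases z) (simp add: cutoff_def)

lemma cutoff_diff: "cutoff I (\<lambda>t \<omega>. X t \<omega> - Y t \<omega>) z = cutoff I X z - cutoff I Y z"
  by (cases z) (simp add: cutoff_def scaleR_right_diff_distrib)

lemma nn_integral_inner_square_le:
  fixes f :: "'c \<Rightarrow> 'b::euclidean_space"
  assumes [measurable]: "f \<in> borel_measurable N"
  shows "(\<integral>\<^sup>+ x. ennreal ((u \<bullet> f x)\<^sup>2) \<partial>N) \<le> ennreal ((norm u)\<^sup>2) * (\<integral>\<^sup>+ x. ennreal ((norm (f x))\<^sup>2) \<partial>N)"
proof -
  have "(\<integral>\<^sup>+ x. ennreal ((u \<bullet> f x)\<^sup>2) \<partial>N) \<le> (\<integral>\<^sup>+ x. ennreal ((norm u)\<^sup>2) * ennreal ((norm (f x))\<^sup>2) \<partial>N)"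
  proof (rule nn_integral_mono)
    fix x
    have "(u \<bullet> f x)\<^sup>2 \<le> (norm u * norm (f x))\<^sup>2"
      using Cauchy_Schwarz_ineq2[of u "f x"] by (rule power2_le_iff_abs_le[THEN iffD2, rotated]) simp
    then show "ennreal ((u \<bullet> f x)\<^sup>2) \<le> ennreal ((norm u)\<^sup>2) * ennreal ((norm (f x))\<^sup>2)"
      by (simp add: ennreal_mult'[symmetric] power_mult_distrib ennreal_leI)
  qed
  also have "\<dots> = ennreal ((norm u)\<^sup>2) * (\<integral>\<^sup>+ x. ennreal ((norm (f x))\<^sup>2) \<partial>N)"
    by (rule nn_integral_cmult) measurable
  finally show ?thesis .
qed

lemma L2_cutoff_inner:
  fixes X :: "real \<Rightarrow> 'a \<Rightarrow> 'b::euclidean_space"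
  assumes [measurable]: "cutoff I X \<in> borel_measurable \<mu>" and fin: "mean_square M I X < \<infinity>"
  shows "L2 \<mu> (cutoff I (\<lambda>t \<omega>. u \<bullet> X t \<omega>))"
proof (rule L2I_nn_integral)
  show "cutoff I (\<lambda>t \<omega>. u \<bullet> X t \<omega>) \<in> borel_measurable \<mu>"
    unfolding cutoff_inner[abs_def] by measurable
  have "(\<integral>\<^sup>+ z. ennreal ((cutoff I (\<lambda>t \<omega>. u \<bullet> X t \<omega>) z)\<^sup>2) \<partial>\<mu>) \<le> ennreal ((norm u)\<^sup>2) * mean_square M I X"
    unfolding cutoff_inner mean_square_eq_cutoff[OF assms(1)] by (rule nn_integral_inner_square_le) measurable
  also have "\<dots> < \<infinity>" using fin by (simp add: ennreal_mult_less_top)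
  finally show "(\<integral>\<^sup>+ z. ennreal ((cutoff I (\<lambda>t \<omega>. u \<bullet> X t \<omega>) z)\<^sup>2) \<partial>\<mu>) < \<infinity>" .
qed

text \<open>A scalar relaxation of \<open>has_ito_integral\<close>: the approximants are elementary
  processes, so their intervals may overlap, and the limits are stated with real integrals, on which
  the \<open>L2\<close> lemmas act.\<close>

definition ito :: "(real \<Rightarrow> 'a \<Rightarrow> real) \<Rightarrow> real \<Rightarrow> ('a \<Rightarrow> real) \<Rightarrow> bool" where
  "ito H T Y \<longleftrightarrow> 0 \<le> T \<and> L2 \<mu> (cutoff {0..T} H) \<and> L2 M Y \<and>
     (\<exists>k a b \<xi>. (\<forall>j::nat. elementary {..<k j::nat} (a j) (b j) (\<xi> j)) \<and>
       (\<lambda>j. LINT z|\<mu>. (cutoff {0..T} H z - cutoff {0..T} (elementary_process {..<k j} (a j) (b j) (\<xi> j)) z)\<^sup>2) \<longlonglongrightarrow> 0 \<and>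
       (\<lambda>j. LINT \<omega>|M. (Y \<omega> - elementary_integral {..<k j} (a j) (b j) (\<xi> j) T \<omega>)\<^sup>2) \<longlonglongrightarrow> 0)"

lemma tendsto_zero_ennreal_mult_bound:
  assumes "\<And>j. f j \<le> ennreal c * g j" "(g :: nat \<Rightarrow> ennreal) \<longlonglongrightarrow> 0"
  shows "f \<longlonglongrightarrow> 0"
proof (rule tendsto_sandwich[OF _ _ tendsto_const])
  show "(\<lambda>j. ennreal c * g j) \<longlonglongrightarrow> 0"
    using ennreal_tendsto_cmult[OF _ assms(2), of "ennreal c"] by simp
qed (use assms in auto)

lemma simple_process_measurable:
  fixes \<xi> :: "nat \<Rightarrow> 'a \<Rightarrow> 'b::euclidean_space"
  assumes "simple_integrand M \<F> k \<tau> \<xi>" "I' \<in> sets borel"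
  shows "cutoff I' (simple_process k \<tau> \<xi>) \<in> borel_measurable \<mu>"
proof -
  have [measurable]: "\<xi> i \<in> borel_measurable M" if "i < k" for i
    using assms that measurable_augmented_filtration unfolding simple_integrand_def by blast
  have [measurable]: "I' \<in> sets borel" by fact
  show ?thesis unfolding cutoff_def simple_process_def by measurable
qed

lemma simple_integrand_times_nonneg:
  assumes s: "simple_integrand M F k \<tau> \<xi>" and "i \<le> k"
  shows "0 \<le> \<tau> i"
  using assms(2)
proof (induction i)
  case 0
  then show ?case using s by (simp add: simple_integrand_def)
next
  case (Suc i)
  then have "0 \<le> \<tau> i" "\<tau> i \<le> \<tau> (Suc i)" using s by (auto simp: simple_integrand_def)
  then show ?case by simp
qed

lemma elementary_inner:
  fixes \<xi> :: "nat \<Rightarrow> 'a \<Rightarrow> 'b::euclidean_space"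
  assumes s: "simple_integrand M \<F> k \<tau> \<xi>"
  shows "elementary {..<k} \<tau> (\<lambda>i. \<tau> (Suc i)) (\<lambda>i \<omega>. u \<bullet> \<xi> i \<omega>)"
    "elementary_process {..<k} \<tau> (\<lambda>i. \<tau> (Suc i)) (\<lambda>i \<omega>. u \<bullet> \<xi> i \<omega>) t \<omega> = u \<bullet> simple_process k \<tau> \<xi> t \<omega>"
    "elementary_integral {..<k} \<tau> (\<lambda>i. \<tau> (Suc i)) (\<lambda>i \<omega>. u \<bullet> \<xi> i \<omega>) T \<omega> = u \<bullet> simple_integral W k \<tau> \<xi> T \<omega>"
proof -
  have pos: "0 \<le> \<tau> i" if "i \<le> k" for i
    using s that by (rule simple_integrand_times_nonneg)
  have bd: "\<exists>K. \<forall>\<omega>\<in>space M. \<bar>u \<bullet> \<xi> i \<omega>\<bar> \<le> K" if i: "i < k" for i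
  proof -
    obtain B where "\<forall>\<omega>\<in>space M. norm (\<xi> i \<omega>) \<le> B"
      using s i unfolding simple_integrand_def bounded_iff by blast
    then have "\<forall>\<omega>\<in>space M. \<bar>u \<bullet> \<xi> i \<omega>\<bar> \<le> norm u * B"
      by (meson Cauchy_Schwarz_ineq2 mult_left_mono norm_ge_zero order_trans)
    then show ?thesis by blast
  qed
  show "elementary {..<k} \<tau> (\<lambda>i. \<tau> (Suc i)) (\<lambda>i \<omega>. u \<bullet> \<xi> i \<omega>)"
    unfolding elementary_def using s pos bd by (auto simp: simple_integrand_def)
  show "elementary_process {..<k} \<tau> (\<lambda>i. \<tau> (Suc i)) (\<lambda>i \<omega>. u \<bullet> \<xi> i \<omega>) t \<omega> = u \<bullet> simple_process k \<tau> \<xi> t \<omega>"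
    unfolding elementary_process_def simple_process_def inner_sum_right by (simp only: inner_scaleR_right)
  show "elementary_integral {..<k} \<tau> (\<lambda>i. \<tau> (Suc i)) (\<lambda>i \<omega>. u \<bullet> \<xi> i \<omega>) T \<omega> = u \<bullet> simple_integral W k \<tau> \<xi> T \<omega>"
    unfolding elementary_integral_def simple_integral_def inner_sum_right by (simp only: inner_scaleR_right mult.commute)
qed

lemma simple_integral_measurable:
  fixes \<xi> :: "nat \<Rightarrow> 'a \<Rightarrow> 'b::euclidean_space"
  assumes s: "simple_integrand M \<F> k \<tau> \<xi>" and T: "0 \<le> T"
  shows "simple_integral W k \<tau> \<xi> T \<in> borel_measurable M"
proof -
  have [measurable]: "\<xi> i \<in> borel_measurable M" if "i < k" for i
    using assms that measurable_augmented_filtration unfolding simple_integrand_def by blast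
  have pos: "0 \<le> \<tau> i" if "i \<le> k" for i
    using s that by (rule simple_integrand_times_nonneg)
  have [measurable]: "W (min T (\<tau> i)) \<in> borel_measurable M" if "i \<le> k" for i
    using pos[OF that] T by (intro measurable_W) auto
  show ?thesis unfolding simple_integral_def[abs_def] by measurable
qed

text \<open>Taking the inner product with \<open>u\<close> commutes with simple processes and their
  integrals, and enlarges squared errors at most by the factor |u|^2. This reduces vector integrals
  to scalar ones.\<close>

lemma has_ito_integral_inner:
  fixes H :: "real \<Rightarrow> 'a \<Rightarrow> 'b::euclidean_space"
  assumes H: "has_ito_integral M W H T Y" and T: "0 \<le> T"
  shows "ito (\<lambda>t \<omega>. u \<bullet> H t \<omega>) T (\<lambda>\<omega>. u \<bullet> Y \<omega>)"
proof -
  have prog: "progressively_measurable \<F> H" and ms: "mean_square M {0..T} H < \<infinity>" and [measurable]: "Y \<in> borel_measurable M"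
    using H by (auto simp: has_ito_integral_def)
  obtain k \<tau> \<xi> where s: "\<And>j::nat. simple_integrand M \<F> (k j) (\<tau> j) (\<xi> j)"
    and l1: "(\<lambda>j. mean_square M {0..T} (\<lambda>t \<omega>. H t \<omega> - simple_process (k j) (\<tau> j) (\<xi> j) t \<omega>)) \<longlonglongrightarrow> 0"
    and l2: "(\<lambda>j. \<integral>\<^sup>+ \<omega>. ennreal ((norm (Y \<omega> - simple_integral W (k j) (\<tau> j) (\<xi> j) T \<omega>))\<^sup>2) \<partial>M) \<longlonglongrightarrow> 0"
    using H unfolding has_ito_integral_def by blast
  define a where "a = \<tau>"
  define b where "b = (\<lambda>j i. \<tau> j (Suc i))"
  define \<eta> where "\<eta> = (\<lambda>j i \<omega>. u \<bullet> \<xi> j i \<omega>)"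
  have el: "elementary {..<k j} (a j) (b j) (\<eta> j)" for j
    unfolding a_def b_def \<eta>_def by (rule elementary_inner(1)[OF s])
  have ep: "elementary_process {..<k j} (a j) (b j) (\<eta> j) t \<omega> = u \<bullet> simple_process (k j) (\<tau> j) (\<xi> j) t \<omega>" for j t \<omega>
    unfolding a_def b_def \<eta>_def by (rule elementary_inner(2)[OF s])
  have ei: "elementary_integral {..<k j} (a j) (b j) (\<eta> j) T \<omega> = u \<bullet> simple_integral W (k j) (\<tau> j) (\<xi> j) T \<omega>" for j \<omega>
    unfolding a_def b_def \<eta>_def by (rule elementary_inner(3)[OF s])
  have [measurable]: "cutoff {0..T} H \<in> borel_measurable \<mu>" by (rule progressively_measurable_cutoff[OF prog T])
  have [measurable]: "cutoff {0..T} (simple_process (k j) (\<tau> j) (\<xi> j)) \<in> borel_measurable \<mu>" for j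
    by (rule simple_process_measurable[OF s]) simp
  have [measurable]: "simple_integral W (k j) (\<tau> j) (\<xi> j) T \<in> borel_measurable M" for j
    by (rule simple_integral_measurable[OF s T])
  have HL2: "L2 \<mu> (cutoff {0..T} (\<lambda>t \<omega>. u \<bullet> H t \<omega>))" by (rule L2_cutoff_inner[OF _ ms]) measurable
  have "(\<lambda>j. \<integral>\<^sup>+ z. ennreal ((cutoff {0..T} (\<lambda>t \<omega>. u \<bullet> H t \<omega>) z
     - cutoff {0..T} (elementary_process {..<k j} (a j) (b j) (\<eta> j)) z)\<^sup>2) \<partial>\<mu>) \<longlonglongrightarrow> 0"
  proof (rule tendsto_zero_ennreal_mult_bound[OF _ l1])
    fix j
    have [measurable]: "cutoff {0..T} (\<lambda>t \<omega>. H t \<omega> - simple_process (k j) (\<tau> j) (\<xi> j) t \<omega>) \<in> borel_measurable \<mu>"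
      unfolding cutoff_diff[abs_def] by measurable
    have "cutoff {0..T} (\<lambda>t \<omega>. u \<bullet> H t \<omega>) z - cutoff {0..T} (elementary_process {..<k j} (a j) (b j) (\<eta> j)) z
      = u \<bullet> cutoff {0..T} (\<lambda>t \<omega>. H t \<omega> - simple_process (k j) (\<tau> j) (\<xi> j) t \<omega>) z" for z
      unfolding ep[abs_def] cutoff_inner cutoff_diff inner_diff_right ..
    then show "(\<integral>\<^sup>+ z. ennreal ((cutoff {0..T} (\<lambda>t \<omega>. u \<bullet> H t \<omega>) z
     - cutoff {0..T} (elementary_process {..<k j} (a j) (b j) (\<eta> j)) z)\<^sup>2) \<partial>\<mu>)
      \<le> ennreal ((norm u)\<^sup>2) * mean_square M {0..T} (\<lambda>t \<omega>. H t \<omega> - simple_process (k j) (\<tau> j) (\<xi> j) t \<omega>)"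
      by (subst mean_square_eq_cutoff) (simp_all add: nn_integral_inner_square_le)
  qed
  then have L1: "(\<lambda>j. LINT z|\<mu>. (cutoff {0..T} (\<lambda>t \<omega>. u \<bullet> H t \<omega>) z
     - cutoff {0..T} (elementary_process {..<k j} (a j) (b j) (\<eta> j)) z)\<^sup>2) \<longlonglongrightarrow> 0"
    by (subst (asm) tendsto_nn_integral_L2_iff) (rule L2_diff[OF HL2 elementary_isometry(2)[OF el T]])
  have n2: "(\<lambda>j. \<integral>\<^sup>+ \<omega>. ennreal ((u \<bullet> Y \<omega> - elementary_integral {..<k j} (a j) (b j) (\<eta> j) T \<omega>)\<^sup>2) \<partial>M) \<longlonglongrightarrow> 0"
  proof (rule tendsto_zero_ennreal_mult_bound[OF _ l2])
    fix j
    show "(\<integral>\<^sup>+ \<omega>. ennreal ((u \<bullet> Y \<omega> - elementary_integral {..<k j} (a j) (b j) (\<eta> j) T \<omega>)\<^sup>2) \<partial>M)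
      \<le> ennreal ((norm u)\<^sup>2) * (\<integral>\<^sup>+ \<omega>. ennreal ((norm (Y \<omega> - simple_integral W (k j) (\<tau> j) (\<xi> j) T \<omega>))\<^sup>2) \<partial>M)"
      unfolding ei inner_diff_right[symmetric] by (rule nn_integral_inner_square_le) measurable
  qed
  have "L2 M (\<lambda>\<omega>. u \<bullet> Y \<omega>)"
  proof -
    \<comment> \<open>Convergence to 0 makes some approximation error finite; adding the square
      integrable elementary integral back shows that \<open>u \<bullet> Y\<close> is square
      integrable.\<close>
    have "eventually (\<lambda>j. (\<integral>\<^sup>+ \<omega>. ennreal ((u \<bullet> Y \<omega> - elementary_integral {..<k j} (a j) (b j) (\<eta> j) T \<omega>)\<^sup>2) \<partial>M) < 1) sequentially"
      using order_tendstoD(2)[OF n2, of 1] by simp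
    then obtain j where j: "(\<integral>\<^sup>+ \<omega>. ennreal ((u \<bullet> Y \<omega> - elementary_integral {..<k j} (a j) (b j) (\<eta> j) T \<omega>)\<^sup>2) \<partial>M) < 1"
      by (auto simp: eventually_sequentially)
    have "L2 M (\<lambda>\<omega>. u \<bullet> Y \<omega> - elementary_integral {..<k j} (a j) (b j) (\<eta> j) T \<omega>)"
    proof (rule L2I_nn_integral)
      show "(\<lambda>\<omega>. u \<bullet> Y \<omega> - elementary_integral {..<k j} (a j) (b j) (\<eta> j) T \<omega>) \<in> borel_measurable M"
        unfolding ei by measurable
      show "(\<integral>\<^sup>+ \<omega>. ennreal ((u \<bullet> Y \<omega> - elementary_integral {..<k j} (a j) (b j) (\<eta> j) T \<omega>)\<^sup>2) \<partial>M) < \<infinity>"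
        using j by (rule less_trans) simp
    qed
    from L2_add[OF this elementary_isometry(1)[OF el[of j] T]] show ?thesis by simp
  qed
  moreover from n2 have "(\<lambda>j. LINT \<omega>|M. (u \<bullet> Y \<omega> - elementary_integral {..<k j} (a j) (b j) (\<eta> j) T \<omega>)\<^sup>2) \<longlonglongrightarrow> 0"
    by (subst (asm) tendsto_nn_integral_L2_iff) (rule L2_diff[OF calculation elementary_isometry(1)[OF el T]])
  ultimately show ?thesis
    unfolding ito_def using T HL2 el L1 by blast
qed

lemma ito_isometry:
  assumes "ito H T Y"
  shows "(LINT \<omega>|M. (Y \<omega>)\<^sup>2) = (LINT z|\<mu>. (cutoff {0..T} H z)\<^sup>2)"
proof -
  obtain k a b \<xi> where el: "\<And>j::nat. elementary {..<k j::nat} (a j) (b j) (\<xi> j)"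
    and l1: "(\<lambda>j. LINT z|\<mu>. (cutoff {0..T} H z - cutoff {0..T} (elementary_process {..<k j} (a j) (b j) (\<xi> j)) z)\<^sup>2) \<longlonglongrightarrow> 0"
    and l2: "(\<lambda>j. LINT \<omega>|M. (Y \<omega> - elementary_integral {..<k j} (a j) (b j) (\<xi> j) T \<omega>)\<^sup>2) \<longlonglongrightarrow> 0"
    and T: "0 \<le> T" and H: "L2 \<mu> (cutoff {0..T} H)" and Y: "L2 M Y"
    using assms unfolding ito_def by blast
  note iso = elementary_isometry[OF el T]
  from L2_tendsto_norm[OF iso(1) Y l2] L2_tendsto_norm[OF iso(2) H l1] iso(3)
  show ?thesis using LIMSEQ_unique by simp
qed

lemma L2_cutoff_subset:
  assumes "L2 \<mu> (cutoff {0..T} H)" "t \<le> T"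
  shows "L2 \<mu> (cutoff {0..t} H)" "(LINT z|\<mu>. (cutoff {0..t} H z)\<^sup>2) \<le> (LINT z|\<mu>. (cutoff {0..T} H z)\<^sup>2)"
proof -
  have eq: "cutoff {0..t} H z = indicator ({0..t} \<times> UNIV) z * cutoff {0..T} H z" for z :: "real \<times> 'a"
    using assms(2) by (cases z) (auto simp: cutoff_def indicator_def)
  have [measurable]: "cutoff {0..T} H \<in> borel_measurable \<mu>" using L2_measurable[OF assms(1)] .
  have "cutoff {0..t} H = (\<lambda>z. indicator {0..t} (fst z) * cutoff {0..T} H z)"
    unfolding eq[abs_def] by (auto simp: fun_eq_iff indicator_def)
  then have m: "cutoff {0..t} H \<in> borel_measurable \<mu>" by simp
  have le: "\<bar>cutoff {0..t} H z\<bar> \<le> \<bar>cutoff {0..T} H z\<bar>" for z by (auto simp: eq indicator_def)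
  show *: "L2 \<mu> (cutoff {0..t} H)" by (rule L2_bound[OF assms(1) m]) (use le in simp)
  show "(LINT z|\<mu>. (cutoff {0..t} H z)\<^sup>2) \<le> (LINT z|\<mu>. (cutoff {0..T} H z)\<^sup>2)"
    using le by (intro integral_mono L2_square * assms(1)) (simp add: abs_le_square_iff)
qed

text \<open>The approximating sequences belonging to the horizons \<open>t\<close> and \<open>T\<close> are unrelated; by the isometry
  the one for \<open>T\<close> also computes the integral up to \<open>t\<close>.\<close>

lemma ito_martingale:
  assumes "ito H T Y" "ito H t Y'" "t \<le> T"
    and Z: "Z \<in> borel_measurable (\<F> t)" "L2 M Z"
  shows "(LINT \<omega>|M. Y \<omega> * Z \<omega>) = (LINT \<omega>|M. Y' \<omega> * Z \<omega>)"
proof -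
  obtain k a b \<xi> where el: "\<And>j::nat. elementary {..<k j::nat} (a j) (b j) (\<xi> j)"
    and l1: "(\<lambda>j. LINT z|\<mu>. (cutoff {0..T} H z - cutoff {0..T} (elementary_process {..<k j} (a j) (b j) (\<xi> j)) z)\<^sup>2) \<longlonglongrightarrow> 0"
    and l2: "(\<lambda>j. LINT \<omega>|M. (Y \<omega> - elementary_integral {..<k j} (a j) (b j) (\<xi> j) T \<omega>)\<^sup>2) \<longlonglongrightarrow> 0"
    and T: "0 \<le> T" and H: "L2 \<mu> (cutoff {0..T} H)" and Y: "L2 M Y"
    using assms(1) unfolding ito_def by blast
  obtain k' a' b' \<xi>' where el': "\<And>j::nat. elementary {..<k' j::nat} (a' j) (b' j) (\<xi>' j)"
    and l1': "(\<lambda>j. LINT z|\<mu>. (cutoff {0..t} H z - cutoff {0..t} (elementary_process {..<k' j} (a' j) (b' j) (\<xi>' j)) z)\<^sup>2) \<longlonglongrightarrow> 0"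
    and l2': "(\<lambda>j. LINT \<omega>|M. (Y' \<omega> - elementary_integral {..<k' j} (a' j) (b' j) (\<xi>' j) t \<omega>)\<^sup>2) \<longlonglongrightarrow> 0"
    and t: "0 \<le> t" and H': "L2 \<mu> (cutoff {0..t} H)" and Y': "L2 M Y'"
    using assms(2) unfolding ito_def by blast
  let ?p = "\<lambda>j. elementary_process {..<k j} (a j) (b j) (\<xi> j)"
  let ?p' = "\<lambda>j. elementary_process {..<k' j} (a' j) (b' j) (\<xi>' j)"
  let ?i = "\<lambda>j. elementary_integral {..<k j} (a j) (b j) (\<xi> j)"
  let ?i' = "\<lambda>j. elementary_integral {..<k' j} (a' j) (b' j) (\<xi>' j)"
  note iso = elementary_isometry[OF el T] and isot = elementary_isometry[OF el t] and iso' = elementary_isometry[OF el' t]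
  have "(\<lambda>j. LINT z|\<mu>. (cutoff {0..t} H z - cutoff {0..t} (?p j) z)\<^sup>2) \<longlonglongrightarrow> 0"
  proof (rule tendsto_sandwich[OF _ _ tendsto_const l1])
    have "(LINT z|\<mu>. (cutoff {0..t} H z - cutoff {0..t} (?p j) z)\<^sup>2) \<le> (LINT z|\<mu>. (cutoff {0..T} H z - cutoff {0..T} (?p j) z)\<^sup>2)" for j
      using L2_cutoff_subset(2)[of T "\<lambda>t \<omega>. H t \<omega> - ?p j t \<omega>" t] L2_diff[OF H iso(2)] assms(3)
      unfolding cutoff_diff[abs_def] by simp
    then show "\<forall>\<^sub>F j in sequentially. (LINT z|\<mu>. (cutoff {0..t} H z - cutoff {0..t} (?p j) z)\<^sup>2)
      \<le> (LINT z|\<mu>. (cutoff {0..T} H z - cutoff {0..T} (?p j) z)\<^sup>2)" by simp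
  qed auto
  moreover have "(\<lambda>j. LINT z|\<mu>. (cutoff {0..t} (?p' j) z - cutoff {0..t} H z)\<^sup>2) \<longlonglongrightarrow> 0"
    using l1' by (simp only: power2_commute)
  ultimately have "(\<lambda>j. LINT z|\<mu>. (cutoff {0..t} (?p' j) z - cutoff {0..t} (?p j) z)\<^sup>2) \<longlonglongrightarrow> 0"
    by (intro L2_tendsto_zero_triangle[where f="\<lambda>j. cutoff {0..t} (?p' j)" and g="\<lambda>j. cutoff {0..t} H" and h="\<lambda>j. cutoff {0..t} (?p j)"]
        iso'(2) H' isot(2))
  then have "(\<lambda>j. LINT \<omega>|M. (?i' j t \<omega> - ?i j t \<omega>)\<^sup>2) \<longlonglongrightarrow> 0"
    unfolding elementary_isometry_diff[OF el' el t] .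
  then have l3: "(\<lambda>j. LINT \<omega>|M. (Y' \<omega> - ?i j t \<omega>)\<^sup>2) \<longlonglongrightarrow> 0"
    using l2' by (intro L2_tendsto_zero_triangle[where f="\<lambda>j. Y'" and g="\<lambda>j. ?i' j t" and h="\<lambda>j. ?i j t"]
        iso'(1) Y' isot(1))
  have "(\<lambda>j. LINT \<omega>|M. ?i j T \<omega> * Z \<omega>) \<longlonglongrightarrow> (LINT \<omega>|M. Y \<omega> * Z \<omega>)"
    by (rule L2_tendsto_inner[OF iso(1) Y Z(2) l2])
  moreover have "(\<lambda>j. LINT \<omega>|M. ?i j t \<omega> * Z \<omega>) \<longlonglongrightarrow> (LINT \<omega>|M. Y' \<omega> * Z \<omega>)"
    by (rule L2_tendsto_inner[OF isot(1) Y' Z(2) l3])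
  ultimately show ?thesis
    unfolding elementary_martingale[OF el t assms(3) Z] using LIMSEQ_unique by blast
qed

end

section \<open>Expectation of Ito's formula\<close>

lemma (in pair_sigma_finite) AE_integrable_snd':
  fixes f :: "_ \<Rightarrow> _::{banach, second_countable_topology}"
  assumes "integrable (M1 \<Otimes>\<^sub>M M2) f"
  shows "AE y in M2. integrable M1 (\<lambda>x. f (x, y))"
  using AE_integrable_snd[of "\<lambda>x y. f (x, y)"] assms by (simp add: case_prod_beta)

lemma (in pair_sigma_finite) integral_snd':
  fixes f :: "_ \<Rightarrow> _::{banach, second_countable_topology}"
  assumes "integrable (M1 \<Otimes>\<^sub>M M2) f"
  shows "integrable M2 (\<lambda>y. LINT x|M1. f (x, y))"
    "(LINT y|M2. (LINT x|M1. f (x, y))) = integral\<^sup>L (M1 \<Otimes>\<^sub>M M2) f"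
  using integrable_snd[of "\<lambda>x y. f (x, y)"] integral_snd[of "\<lambda>x y. f (x, y)"] assms
  by (simp_all add: case_prod_beta)

text \<open>The square is the integral of \<open>f t * f s\<close> over the plane. The half-planes s
  \<le> t and s > t contribute equally, by swapping the variables and because the diagonal is a null
  set.\<close>

lemma square_integral_eq_triangle:
  fixes f :: "real \<Rightarrow> real"
  assumes f: "integrable lborel f"
  shows "(LINT t|lborel. f t)\<^sup>2 = 2 * (LINT t|lborel. f t * (LINT s|lborel. indicator {..t} s * f s))"
proof -
  let ?P = "lborel \<Otimes>\<^sub>M (lborel :: real measure)"
  have [measurable]: "f \<in> borel_measurable borel" using f by auto
  note g = pair_sigma_finite.integral_mult_pair[OF lborel_pair.pair_sigma_finite_axioms f f]
  have i1: "integrable ?P (\<lambda>(t, s). f t * (indicator {..t} s * f s))"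
  proof (rule Bochner_Integration.integrable_bound[OF g(1)])
    have "(\<lambda>z. f (fst z) * ((if snd z \<le> fst z then 1 else 0) * f (snd z))) \<in> borel_measurable ?P" by measurable
    then show "(\<lambda>(t, s). f t * (indicator {..t} s * f s)) \<in> borel_measurable ?P"
      by (rule measurable_cong[THEN iffD1, rotated]) (auto simp: indicator_def)
  qed (auto simp: indicator_def)
  have i2: "integrable ?P (\<lambda>(t, s). f t * (indicator {..<t} s * f s))"
  proof (rule Bochner_Integration.integrable_bound[OF g(1)])
    have "(\<lambda>z. f (fst z) * ((if snd z < fst z then 1 else 0) * f (snd z))) \<in> borel_measurable ?P" by measurable
    then show "(\<lambda>(t, s). f t * (indicator {..<t} s * f s)) \<in> borel_measurable ?P"
      by (rule measurable_cong[THEN iffD1, rotated]) (auto simp: indicator_def)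
  qed (auto simp: indicator_def)
  have i3: "integrable ?P (\<lambda>(t, s). f s * (indicator {..<s} t * f t))"
    using lborel_pair.integrable_product_swap[OF i2] by simp
  have "(LINT t|lborel. f t)\<^sup>2 = (LINT z|?P. (case z of (t, s) \<Rightarrow> f t * f s))"
    using g(2) by (simp add: power2_eq_square)
  also have "\<dots> = (LINT z|?P. (case z of (t, s) \<Rightarrow> f t * (indicator {..t} s * f s)) + (case z of (t, s) \<Rightarrow> f s * (indicator {..<s} t * f t)))"
    by (intro Bochner_Integration.integral_cong) (auto simp: indicator_def)
  also have "\<dots> = (LINT z|?P. (case z of (t, s) \<Rightarrow> f t * (indicator {..t} s * f s))) + (LINT z|?P. (case z of (t, s) \<Rightarrow> f s * (indicator {..<s} t * f t)))"
    using i1 i3 by (rule Bochner_Integration.integral_add)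
  also have "(LINT z|?P. (case z of (t, s) \<Rightarrow> f t * (indicator {..t} s * f s))) = (LINT t|lborel. f t * (LINT s|lborel. indicator {..t} s * f s))"
    using lborel_pair.integral_fst'[OF i1] by simp
  also have "(LINT z|?P. (case z of (t, s) \<Rightarrow> f s * (indicator {..<s} t * f t))) = (LINT z|?P. (case z of (t, s) \<Rightarrow> f t * (indicator {..<t} s * f s)))"
    using lborel_pair.integral_product_swap[OF borel_measurable_integrable[OF i2]] by simp
  also have "\<dots> = (LINT t|lborel. f t * (LINT s|lborel. indicator {..<t} s * f s))"
    using lborel_pair.integral_fst'[OF i2] by simp
  also have "\<dots> = (LINT t|lborel. f t * (LINT s|lborel. indicator {..t} s * f s))"
  proof -
    have "AE s in lborel. s \<noteq> t" for t :: real by (rule AE_lborel_singleton)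
    then have "AE s in lborel. indicator {..<t} s * f s = indicator {..t} s * f s" for t
      by eventually_elim (auto simp: indicator_def)
    then have "(LINT s|lborel. indicator {..<t} s * f s) = (LINT s|lborel. indicator {..t} s * f s)" for t
      by (intro integral_cong_AE) measurable
    then show ?thesis by simp
  qed
  finally show ?thesis by simp
qed

section \<open>Ito's formula for the square of a scalar process\<close>

context standard_brownian_motion
begin

lemma L2_const_M: "L2 M (\<lambda>_. c)"
  by (simp add: L2_def)

lemma L2_time_mult:
  assumes "L2 M f"
  shows "L2 \<mu> (\<lambda>(t, \<omega>). indicator {0..T} t * f \<omega>)"
  unfolding L2_def
proof
  have [measurable]: "f \<in> borel_measurable M" using L2_measurable[OF assms] .
  have "(\<lambda>z. indicator {0..T} (fst z) :: real) \<in> borel_measurable \<mu>"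
    by (rule measurable_compose[OF measurable_fst borel_measurable_indicator]) simp
  moreover have "(\<lambda>z. f (snd z)) \<in> borel_measurable \<mu>"
    by (rule measurable_compose[OF measurable_snd]) simp
  ultimately show "(\<lambda>(t, \<omega>). indicator {0..T} t * f \<omega>) \<in> borel_measurable \<mu>"
    unfolding case_prod_beta by (rule borel_measurable_times)
  have "integrable lborel (indicator {0..T} :: real \<Rightarrow> real)"
    by (rule integrable_real_indicator) (simp_all add: emeasure_lborel_Icc_eq)
  from time_prob.integral_mult_pair(1)[OF this L2_square[OF assms]]
  show "integrable \<mu> (\<lambda>x. (case x of (t, \<omega>) \<Rightarrow> indicator {0..T} t * f \<omega>)\<^sup>2)"
    by (rule Bochner_Integration.integrable_cong[THEN iffD1, rotated -1]) (auto simp: indicator_def power_mult_distrib)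
qed

text \<open>The martingale property with the constant 1 moves the mean to horizon 0, where the
  isometry over the null time set \<open>{0..0}\<close> makes the integral vanish almost surely.
  Hence the second assumption.\<close>

lemma ito_zero_mean:
  assumes "ito H T Y" "ito H 0 Y0"
  shows "(LINT \<omega>|M. Y \<omega>) = 0"
proof -
  have T: "0 \<le> T" and Y0: "L2 M Y0" and H: "L2 \<mu> (cutoff {0..0} H)" using assms by (auto simp: ito_def)
  have "(LINT \<omega>|M. (Y0 \<omega>)\<^sup>2) = (LINT z|\<mu>. (cutoff {0..0} H z)\<^sup>2)" by (rule ito_isometry[OF assms(2)])
  also have "\<dots> = (LINT t|lborel. (LINT \<omega>|M. (cutoff {0..0} H (t, \<omega>))\<^sup>2))"
    by (rule time_prob.integral_fst'[OF L2_square[OF H], symmetric])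
  also have "\<dots> = 0"
  proof (rule integral_eq_zero_AE)
    have "AE t in lborel. t \<noteq> (0::real)" by (rule AE_lborel_singleton)
    then show "AE t in lborel. (LINT \<omega>|M. (cutoff {0..0} H (t, \<omega>))\<^sup>2) = 0"
      by eventually_elim (simp add: cutoff_def)
  qed
  finally have "(LINT \<omega>|M. Y0 \<omega> * 1)\<^sup>2 \<le> 0" using L2_Cauchy_Schwarz[OF Y0 L2_const_M[of 1]] by simp
  moreover have "(LINT \<omega>|M. Y \<omega> * 1) = (LINT \<omega>|M. Y0 \<omega> * 1)"
    by (rule ito_martingale[OF assms T _ L2_const_M]) simp
  ultimately show ?thesis by simp
qed

text \<open>The stochastic integral is required at every horizon up to \<open>T\<close>: the mixed
  term uses the intermediate ones, and the zero mean uses horizon 0.\<close>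

lemma ito_formula_square:
  fixes b X \<sigma> :: "real \<Rightarrow> 'a \<Rightarrow> real"
  assumes T: "0 \<le> T"
    and X: "L2 \<mu> (cutoff {0..T} X)" and b: "L2 \<mu> (cutoff {0..T} b)"
    and adapted: "\<And>t. 0 \<le> t \<Longrightarrow> t \<le> T \<Longrightarrow> b t \<in> borel_measurable (\<F> t)"
    and ito: "\<And>t. 0 \<le> t \<Longrightarrow> t \<le> T \<Longrightarrow> ito \<sigma> t (\<lambda>\<omega>. X t \<omega> - x - (LINT s:{0..t}|lborel. b s \<omega>))"
  shows "L2 M (X T)"
    "(LINT \<omega>|M. (X T \<omega>)\<^sup>2) = x\<^sup>2 + 2 * (LINT z|\<mu>. cutoff {0..T} b z * cutoff {0..T} X z)
       + (LINT z|\<mu>. (cutoff {0..T} \<sigma> z)\<^sup>2)"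
proof -
  define B where "B = cutoff {0..T} b"
  \<comment> \<open>As \<open>B\<close> vanishes outside [0, T], \<open>{..t}\<close> stands for
    [0, t]. This shape matches the triangle identity and makes \<open>V T\<close> the integral of
    \<open>B\<close> over the whole line.\<close>
  define V where "V = (\<lambda>t \<omega>. LINT s|lborel. indicator {..t} s * B (s, \<omega>))"
  define N where "N = (\<lambda>t \<omega>. X t \<omega> - x - V t \<omega>)"
  have BL: "L2 \<mu> B" using b by (simp add: B_def)
  have Bm[measurable]: "B \<in> borel_measurable \<mu>" using L2_measurable[OF BL] .
  have V_eq: "V t \<omega> = (LINT s:{0..t}|lborel. b s \<omega>)" if "0 \<le> t" "t \<le> T" for t \<omega>
    unfolding V_def B_def cutoff_def set_lebesgue_integral_def using that
    by (intro Bochner_Integration.integral_cong) (auto simp: indicator_def)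
  have N: "ito \<sigma> t (N t)" if "0 \<le> t" "t \<le> T" for t
    using ito[OF that] unfolding N_def V_eq[OF that] .
  have NL: "L2 M (N t)" if "0 \<le> t" "t \<le> T" for t using N[OF that] by (simp add: ito_def)
  have good: "AE \<omega> in M. L2 lborel (\<lambda>t. B (t, \<omega>))"
  proof -
    have "AE \<omega> in M. integrable lborel (\<lambda>t. (B (t, \<omega>))\<^sup>2)"
      by (rule time_prob.AE_integrable_snd'[OF L2_square[OF BL]])
    with AE_space show ?thesis
      by eventually_elim (simp add: L2_def)
  qed
  define G where "G = (\<lambda>\<omega>. LINT t|lborel. (B (t, \<omega>))\<^sup>2)"
  have Gi: "integrable M G"
    unfolding G_def by (rule time_prob.integral_snd'(1)[OF L2_square[OF BL]])
  have G0: "0 \<le> G \<omega>" for \<omega> unfolding G_def by (rule integral_nonneg_AE) simp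
  \<comment> \<open>Cauchy-Schwarz in time gives V(t)^2 \<le> T * G. The bound is uniform in
    \<open>t\<close>, so it yields square integrability both of \<open>V T\<close> and of
    \<open>V\<close> on the product space.\<close>
  have V_bound: "\<bar>V t \<omega>\<bar> \<le> \<bar>sqrt T * sqrt (G \<omega>)\<bar>" if "L2 lborel (\<lambda>t. B (t, \<omega>))" for t \<omega>
  proof -
    let ?g = "\<lambda>s. indicator ({0..T} \<inter> {..t}) s :: real"
    have fin: "emeasure lborel ({0..T} \<inter> {..t}) < \<infinity>"
    proof -
      have "emeasure lborel ({0..T} \<inter> {..t}) \<le> emeasure lborel {0..T}" by (rule emeasure_mono) auto
      also have "\<dots> < \<infinity>" by (simp add: emeasure_lborel_Icc_eq)
      finally show ?thesis .
    qed
    have ii: "integrable lborel ?g" by (rule integrable_real_indicator[OF _ fin]) simp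
    have g2: "(?g s)\<^sup>2 = ?g s" for s by (auto simp: indicator_def)
    have gL: "L2 lborel ?g" unfolding L2_def g2 using ii by simp
    have "V t \<omega> = (LINT s|lborel. B (s, \<omega>) * ?g s)"
      unfolding V_def B_def cutoff_def by (intro Bochner_Integration.integral_cong) (auto simp: indicator_def)
    then have "(V t \<omega>)\<^sup>2 \<le> G \<omega> * (LINT s|lborel. ?g s)"
      using L2_Cauchy_Schwarz[OF that gL] unfolding G_def g2 by (simp only:)
    also have "(LINT s|lborel. ?g s) \<le> (LINT s|lborel. indicator {0..T} s)"
    proof (rule integral_mono[OF ii])
      show "integrable lborel (indicator {0..T} :: real \<Rightarrow> real)"
        by (rule integrable_real_indicator) (simp_all add: emeasure_lborel_Icc_eq)
    qed (auto simp: indicator_def)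
    then have "G \<omega> * (LINT s|lborel. ?g s) \<le> G \<omega> * T"
      using T by (intro mult_left_mono G0) simp
    finally have "(V t \<omega>)\<^sup>2 \<le> (sqrt T * sqrt (G \<omega>))\<^sup>2"
      using T G0 by (simp add: power_mult_distrib mult.commute)
    then show ?thesis by (simp add: abs_le_square_iff)
  qed
  have sG: "L2 M (\<lambda>\<omega>. sqrt T * sqrt (G \<omega>))"
  proof -
    have "(\<lambda>\<omega>. sqrt T * sqrt (G \<omega>)) \<in> borel_measurable M" using Gi by measurable
    moreover have "integrable M (\<lambda>\<omega>. T * G \<omega>)" using Gi by simp
    ultimately show ?thesis using T G0 by (simp add: L2_def power_mult_distrib)
  qed
  have Vjm: "(\<lambda>z. V (fst z) (snd z)) \<in> borel_measurable \<mu>"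
  proof -
    have "(\<lambda>z. LINT s|lborel. (if s \<le> fst z then B (s, snd z) else 0)) \<in> borel_measurable \<mu>"
      by measurable
    moreover have "(LINT s|lborel. (if s \<le> t then B (s, \<omega>) else 0)) = V t \<omega>" for t \<omega>
      unfolding V_def by (intro Bochner_Integration.integral_cong) auto
    ultimately show ?thesis by simp
  qed
  have Vm: "V t \<in> borel_measurable M" for t
    using measurable_compose[OF measurable_Pair1' Vjm, of t] by simp
  have VTL: "L2 M (V T)"
    by (rule L2_bound[OF sG Vm]) (use good V_bound in \<open>auto elim: eventually_mono\<close>)
  have VL: "L2 \<mu> (cutoff {0..T} V)"
  proof (rule L2_bound[OF L2_time_mult[OF sG]])
    have "cutoff {0..T} V = (\<lambda>z. indicator {0..T} (fst z) * V (fst z) (snd z))"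
      by (auto simp: cutoff_def)
    moreover have "(\<lambda>z. indicator {0..T} (fst z) :: real) \<in> borel_measurable \<mu>"
      by (rule measurable_compose[OF measurable_fst borel_measurable_indicator]) simp
    ultimately show "cutoff {0..T} V \<in> borel_measurable \<mu>" using Vjm by simp
    have "AE z in \<mu>. L2 lborel (\<lambda>t. B (t, snd z))"
    proof -
      have "AE z in \<mu>. integrable lborel (\<lambda>t. (B (t, snd z))\<^sup>2)"
      proof (rule time_prob.AE_pair_measure)
        show "{x \<in> space \<mu>. integrable lborel (\<lambda>t. (B (t, snd x))\<^sup>2)} \<in> sets \<mu>" by measurable
        show "AE t in lborel. AE \<omega> in M. integrable lborel (\<lambda>s. (B (s, snd (t, \<omega>)))\<^sup>2)"
          using good by (auto simp: L2_def elim: eventually_mono)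
      qed
      with AE_space show ?thesis
        by eventually_elim (auto simp: L2_def space_pair_measure)
    qed
    then show "AE z in \<mu>. \<bar>cutoff {0..T} V z\<bar> \<le> \<bar>case z of (t, \<omega>) \<Rightarrow> indicator {0..T} t * (sqrt T * sqrt (G \<omega>))\<bar>"
    proof eventually_elim
      case (elim z)
      then show ?case using V_bound[of "snd z" "fst z"]
        by (cases z) (auto simp: cutoff_def indicator_def)
    qed
  qed
  \<comment> \<open>The cutoff of the constant 1, which turns the initial value \<open>x\<close>
    into a function on the product space.\<close>
  define U where "U = (\<lambda>z::real \<times> 'a. indicator {0..T} (fst z) :: real)"
  have UL: "L2 \<mu> U" using L2_time_mult[OF L2_const_M[of 1], of T] by (simp add: U_def case_prod_beta')
  have NcL: "L2 \<mu> (cutoff {0..T} N)"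
  proof -
    have "cutoff {0..T} N z = cutoff {0..T} X z - x * U z - cutoff {0..T} V z" for z
      by (cases z) (simp add: N_def U_def cutoff_def algebra_simps)
    then have "cutoff {0..T} N = (\<lambda>z. cutoff {0..T} X z - x * U z - cutoff {0..T} V z)" by auto
    then show ?thesis using X UL VL by (simp add: L2_diff L2_cmult)
  qed
  have B0: "B (t, \<omega>) = indicator {0..T} t * B (t, \<omega>)" for t \<omega> by (auto simp: B_def cutoff_def indicator_def)
  have BU: "B z * U z = B z" for z using B0 by (cases z) (simp add: U_def mult.commute)
  have VT: "V T \<omega> = (LINT t|lborel. B (t, \<omega>))" for \<omega>
    unfolding V_def by (intro Bochner_Integration.integral_cong) (auto simp: B_def cutoff_def indicator_def)
  have EV: "(LINT \<omega>|M. V T \<omega>) = (LINT z|\<mu>. B z)"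
  proof -
    have i: "integrable \<mu> B" using L2_mult[OF BL UL] unfolding BU .
    then show ?thesis using time_prob.integral_snd'(2)[OF i] by (simp add: VT)
  qed
  have EVV: "(LINT \<omega>|M. (V T \<omega>)\<^sup>2) = 2 * (LINT z|\<mu>. B z * cutoff {0..T} V z)"
  proof -
    have i: "integrable \<mu> (\<lambda>(t, \<omega>). B (t, \<omega>) * V t \<omega>)"
      using L2_mult[OF BL VL] by (rule Bochner_Integration.integrable_cong[THEN iffD1, rotated -1]) (auto simp: B_def cutoff_def indicator_def)
    have "(LINT \<omega>|M. (V T \<omega>)\<^sup>2) = (LINT \<omega>|M. 2 * (LINT t|lborel. B (t, \<omega>) * V t \<omega>))"
    proof (rule integral_cong_AE)
      show "AE \<omega> in M. (V T \<omega>)\<^sup>2 = 2 * (LINT t|lborel. B (t, \<omega>) * V t \<omega>)"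
        using good
      proof eventually_elim
        case (elim \<omega>)
        have "L2 lborel (indicator {0..T} :: real \<Rightarrow> real)"
        proof -
          have "integrable lborel (indicator {0..T} :: real \<Rightarrow> real)"
            by (rule integrable_real_indicator) (simp_all add: emeasure_lborel_Icc_eq)
          moreover have "(indicator {0..T} t :: real)\<^sup>2 = indicator {0..T} t" for t by (simp add: indicator_def)
          ultimately show ?thesis by (simp add: L2_def)
        qed
        from L2_mult[OF this elim] have "integrable lborel (\<lambda>t. B (t, \<omega>))" by (simp flip: B0)
        from square_integral_eq_triangle[OF this]
        have "(LINT t|lborel. B (t, \<omega>))\<^sup>2 = 2 * (LINT t|lborel. B (t, \<omega>) * V t \<omega>)" by (simp add: V_def)
        then show ?case by (simp add: VT)
      qed
      show "(\<lambda>\<omega>. (V T \<omega>)\<^sup>2) \<in> borel_measurable M" using Vm by measurable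
      show "(\<lambda>\<omega>. 2 * (LINT t|lborel. B (t, \<omega>) * V t \<omega>)) \<in> borel_measurable M"
        using time_prob.integrable_snd[OF i] by simp
    qed
    also have "\<dots> = 2 * (LINT \<omega>|M. (LINT t|lborel. B (t, \<omega>) * V t \<omega>))" by simp
    also have "(LINT \<omega>|M. (LINT t|lborel. B (t, \<omega>) * V t \<omega>)) = (LINT z|\<mu>. (case z of (t, \<omega>) \<Rightarrow> B (t, \<omega>) * V t \<omega>))"
      by (rule time_prob.integral_snd[OF i])
    also have "\<dots> = (LINT z|\<mu>. B z * cutoff {0..T} V z)"
      by (rule Bochner_Integration.integral_cong) (auto simp: B_def cutoff_def indicator_def)
    finally show ?thesis .
  qed
  \<comment> \<open>After Fubini, the slice of \<open>B\<close> at time \<open>t\<close> is known at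
    \<open>t\<close>, so \<open>N T\<close> may be replaced by \<open>N t\<close>. This happens for
    almost every \<open>t\<close>, since only almost every slice of \<open>b\<close> is known to be
    square integrable.\<close>
  have ENV: "(LINT \<omega>|M. V T \<omega> * N T \<omega>) = (LINT z|\<mu>. B z * cutoff {0..T} N z)"
  proof -
    have i: "integrable \<mu> (\<lambda>(t, \<omega>). B (t, \<omega>) * N T \<omega>)"
      using L2_mult[OF BL L2_time_mult[OF NL[OF T order.refl], of T]]
      by (rule Bochner_Integration.integrable_cong[THEN iffD1, rotated -1]) (auto simp: B_def cutoff_def indicator_def)
    have i': "integrable \<mu> (\<lambda>(t, \<omega>). B (t, \<omega>) * N t \<omega>)"
      using L2_mult[OF BL NcL]
      by (rule Bochner_Integration.integrable_cong[THEN iffD1, rotated -1]) (auto simp: B_def cutoff_def indicator_def)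
    have "(LINT \<omega>|M. V T \<omega> * N T \<omega>) = (LINT \<omega>|M. (LINT t|lborel. B (t, \<omega>) * N T \<omega>))"
      by (simp add: VT)
    also have "\<dots> = (LINT t|lborel. (LINT \<omega>|M. B (t, \<omega>) * N T \<omega>))"
      by (rule time_prob.Fubini_integral[OF i])
    also have "\<dots> = (LINT t|lborel. (LINT \<omega>|M. B (t, \<omega>) * N t \<omega>))"
    proof (rule integral_cong_AE)
      have "AE t in lborel. integrable M (\<lambda>\<omega>. (B (t, \<omega>))\<^sup>2)"
        using time_prob.AE_integrable_fst'[OF L2_square[OF BL]] .
      then show "AE t in lborel. (LINT \<omega>|M. B (t, \<omega>) * N T \<omega>) = (LINT \<omega>|M. B (t, \<omega>) * N t \<omega>)"
      proof eventually_elim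
        case (elim t)
        show ?case
        proof (cases "t \<in> {0..T}")
          case True
          then have t: "0 \<le> t" "t \<le> T" by auto
          have Bt: "(\<lambda>\<omega>. B (t, \<omega>)) = b t" using t by (auto simp: B_def cutoff_def)
          have "L2 M (b t)" using elim measurable_augmented_filtration[OF adapted[OF t]] unfolding Bt[symmetric] by (simp add: L2_def)
          from ito_martingale[OF N[OF T order.refl] N[OF t] t(2) adapted[OF t] this]
          show ?thesis using Bt by (simp add: fun_eq_iff mult.commute)
        next
          case False
          then show ?thesis by (simp add: B_def cutoff_def)
        qed
      qed
      show "(\<lambda>t. LINT \<omega>|M. B (t, \<omega>) * N T \<omega>) \<in> borel_measurable lborel"
        using time_prob.integrable_fst'[OF i] by simp
      show "(\<lambda>t. LINT \<omega>|M. B (t, \<omega>) * N t \<omega>) \<in> borel_measurable lborel"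
        using time_prob.integrable_fst'[OF i'] by simp
    qed
    also have "\<dots> = (LINT z|\<mu>. (case z of (t, \<omega>) \<Rightarrow> B (t, \<omega>) * N t \<omega>))"
      using time_prob.integral_fst'[OF i'] by simp
    also have "\<dots> = (LINT z|\<mu>. B z * cutoff {0..T} N z)"
      by (rule Bochner_Integration.integral_cong) (auto simp: B_def cutoff_def indicator_def)
    finally show ?thesis .
  qed
  have EN: "(LINT \<omega>|M. N T \<omega>) = 0"
    using ito_zero_mean[OF N[OF T order.refl] N[OF order.refl T]] .
  have ENN: "(LINT \<omega>|M. (N T \<omega>)\<^sup>2) = (LINT z|\<mu>. (cutoff {0..T} \<sigma> z)\<^sup>2)"
    by (rule ito_isometry[OF N[OF T order.refl]])
  have XT: "X T = (\<lambda>\<omega>. x + V T \<omega> + N T \<omega>)" by (auto simp: N_def)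
  have NTL: "L2 M (N T)" by (rule NL[OF T order.refl])
  show "L2 M (X T)" unfolding XT by (intro L2_add L2_const_M VTL NTL)
  have iV: "integrable M (V T)" using L2_mult[OF VTL L2_const_M[of 1]] by simp
  have iN: "integrable M (N T)" using L2_mult[OF NTL L2_const_M[of 1]] by simp
  have "(LINT \<omega>|M. (X T \<omega>)\<^sup>2) = (LINT \<omega>|M. x\<^sup>2 + 2 * x * V T \<omega> + 2 * x * N T \<omega> + (V T \<omega>)\<^sup>2 + 2 * (V T \<omega> * N T \<omega>) + (N T \<omega>)\<^sup>2)"
    unfolding XT by (intro Bochner_Integration.integral_cong) (auto simp: power2_eq_square algebra_simps)
  also have "\<dots> = x\<^sup>2 + 2 * x * (LINT \<omega>|M. V T \<omega>) + 2 * x * (LINT \<omega>|M. N T \<omega>) + (LINT \<omega>|M. (V T \<omega>)\<^sup>2)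
      + 2 * (LINT \<omega>|M. V T \<omega> * N T \<omega>) + (LINT \<omega>|M. (N T \<omega>)\<^sup>2)"
    using iV iN L2_square[OF VTL] L2_square[OF NTL] L2_mult[OF VTL NTL] by (simp add: prob_space)
  also have "\<dots> = x\<^sup>2 + 2 * (x * (LINT z|\<mu>. B z * U z) + (LINT z|\<mu>. B z * cutoff {0..T} V z) + (LINT z|\<mu>. B z * cutoff {0..T} N z))
      + (LINT z|\<mu>. (cutoff {0..T} \<sigma> z)\<^sup>2)"
    unfolding EV EVV ENV EN ENN BU by (simp add: algebra_simps)
  also have "x * (LINT z|\<mu>. B z * U z) + (LINT z|\<mu>. B z * cutoff {0..T} V z) + (LINT z|\<mu>. B z * cutoff {0..T} N z)
     = (LINT z|\<mu>. x * (B z * U z) + B z * cutoff {0..T} V z + B z * cutoff {0..T} N z)"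
    using L2_mult[OF BL UL] L2_mult[OF BL VL] L2_mult[OF BL NcL] by simp
  \<comment> \<open>On [0, T] the process is \<open>x + V + N\<close>, so the three drift
    contributions recombine to one with \<open>X\<close>.\<close>
  also have "\<dots> = (LINT z|\<mu>. B z * cutoff {0..T} X z)"
    by (intro Bochner_Integration.integral_cong) (auto simp: N_def U_def cutoff_def algebra_simps)
  finally show "(LINT \<omega>|M. (X T \<omega>)\<^sup>2) = x\<^sup>2 + 2 * (LINT z|\<mu>. cutoff {0..T} b z * cutoff {0..T} X z)
       + (LINT z|\<mu>. (cutoff {0..T} \<sigma> z)\<^sup>2)"
    unfolding B_def .
qed

end

section \<open>Quadratic forms in coordinates and linear operations on processes\<close>

lemma matrix_vector_inner_eq_sum:
  fixes P :: "real ^ 'n ^ 'n"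
  shows "(P *v y) \<bullet> z = (\<Sum>i\<in>UNIV. \<Sum>j\<in>UNIV. P $ i $ j * ((axis i 1 \<bullet> z) * (axis j 1 \<bullet> y)))"
proof -
  have "(P *v y) \<bullet> z = (\<Sum>i\<in>UNIV. (P *v y) $ i * z $ i)" by (simp add: inner_vec_def)
  then show ?thesis
    by (simp add: matrix_vector_mult_def inner_axis' sum_distrib_right sum_distrib_left mult_ac)
qed

lemma symmetric_matrix_inner:
  fixes P :: "real ^ 'n ^ 'n"
  assumes "symmetric_matrix P"
  shows "(P *v y) \<bullet> z = y \<bullet> (P *v z)"
  using assms dot_lmul_matrix[of y P z] unfolding symmetric_matrix_def
  by (metis transpose_matrix_vector)

lemma measurable_matrix_vector_mult [measurable (raw)]:
  fixes A :: "real ^ 'n ^ 'm"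
  assumes "f \<in> borel_measurable N"
  shows "(\<lambda>x. A *v f x) \<in> borel_measurable N"
  by (rule measurable_compose[OF assms borel_measurable_continuous_onI[OF linear_continuous_on[OF matrix_vector_mul_bounded_linear]]])

lemma progressively_measurable_add:
  fixes X Y :: "real \<Rightarrow> 'a \<Rightarrow> 'b::{real_normed_vector, second_countable_topology}"
  assumes "progressively_measurable F X" "progressively_measurable F Y"
  shows "progressively_measurable F (\<lambda>t \<omega>. X t \<omega> + Y t \<omega>)"
  using assms unfolding progressively_measurable_def case_prod_beta' by (auto intro: borel_measurable_add)

lemma progressively_measurable_matrix:
  fixes A :: "real ^ 'n ^ 'm"
  assumes "progressively_measurable F X"
  shows "progressively_measurable F (\<lambda>t \<omega>. A *v X t \<omega>)"
  using assms unfolding progressively_measurable_def case_prod_beta' by (auto intro: measurable_matrix_vector_mult)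

lemma cutoff_matrix: "cutoff I (\<lambda>t \<omega>. (A::real^'n^'m) *v X t \<omega>) z = A *v cutoff I X z"
  by (cases z) (simp add: cutoff_def matrix_vector_mult_scaleR)

lemma cutoff_add: "cutoff I (\<lambda>t \<omega>. X t \<omega> + Y t \<omega>) z = cutoff I X z + cutoff I Y z"
  by (cases z) (simp add: cutoff_def scaleR_add_right)

lemma L2_inner_polarization:
  fixes f :: "'c \<Rightarrow> 'b::real_inner"
  assumes "\<And>u. L2 N (\<lambda>x. u \<bullet> f x)"
  shows "4 * (LINT x|N. (u \<bullet> f x) * (w \<bullet> f x)) = (LINT x|N. ((u + w) \<bullet> f x)\<^sup>2) - (LINT x|N. ((u - w) \<bullet> f x)\<^sup>2)"
proof -
  have "(LINT x|N. ((u + w) \<bullet> f x)\<^sup>2) - (LINT x|N. ((u - w) \<bullet> f x)\<^sup>2)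
     = (LINT x|N. ((u + w) \<bullet> f x)\<^sup>2 - ((u - w) \<bullet> f x)\<^sup>2)"
    using L2_square[OF assms] by simp
  also have "\<dots> = (LINT x|N. 4 * ((u \<bullet> f x) * (w \<bullet> f x)))"
    by (intro Bochner_Integration.integral_cong) (auto simp: inner_add_left inner_diff_left power2_eq_square algebra_simps)
  finally show ?thesis by simp
qed

section \<open>Second moments of vector-valued solutions\<close>

context standard_brownian_motion
begin

lemma ito_cong_AE:
  assumes ito: "ito H T Y" and Y': "Y' \<in> borel_measurable M" and eq: "AE \<omega> in M. Y \<omega> = Y' \<omega>"
  shows "ito H T Y'"
proof -
  have Y: "L2 M Y" using ito by (simp add: ito_def)
  have L: "L2 M Y'" by (rule L2_bound[OF Y Y']) (use eq in \<open>auto elim: eventually_mono\<close>)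
  have "(LINT \<omega>|M. (Y \<omega> - f \<omega>)\<^sup>2) = (LINT \<omega>|M. (Y' \<omega> - f \<omega>)\<^sup>2)" if [measurable]: "f \<in> borel_measurable M" for f :: "'a \<Rightarrow> real"
    using L2_measurable[OF Y] Y' eq by (intro integral_cong_AE) (auto elim: eventually_mono)
  note cong = this[OF L2_measurable[OF elementary_isometry(1)]]
  obtain k a b \<xi> where el: "\<And>j::nat. elementary {..<k j::nat} (a j) (b j) (\<xi> j)"
    and l1: "(\<lambda>j. LINT z|\<mu>. (cutoff {0..T} H z - cutoff {0..T} (elementary_process {..<k j} (a j) (b j) (\<xi> j)) z)\<^sup>2) \<longlonglongrightarrow> 0"
    and l2: "(\<lambda>j. LINT \<omega>|M. (Y \<omega> - elementary_integral {..<k j} (a j) (b j) (\<xi> j) T \<omega>)\<^sup>2) \<longlonglongrightarrow> 0"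
    and T: "0 \<le> T"
    using ito unfolding ito_def by blast
  have "(\<lambda>j. LINT \<omega>|M. (Y' \<omega> - elementary_integral {..<k j} (a j) (b j) (\<xi> j) T \<omega>)\<^sup>2) \<longlonglongrightarrow> 0"
    using l2 unfolding cong[OF el T] .
  then show ?thesis using ito el l1 L unfolding ito_def by blast
qed

lemma integral_cutoff_measurable:
  fixes b :: "real \<Rightarrow> 'a \<Rightarrow> real"
  assumes "cutoff {0..t} b \<in> borel_measurable \<mu>"
  shows "(\<lambda>\<omega>. LINT s:{0..t}|lborel. b s \<omega>) \<in> borel_measurable M"
proof -
  have "(\<lambda>\<omega>. LINT s|lborel. cutoff {0..t} b (s, \<omega>)) \<in> borel_measurable M"
    using measurable_pair_swap[OF assms] by (intro lborel.borel_measurable_lebesgue_integral) simp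
  then show ?thesis by (simp add: cutoff_def set_lebesgue_integral_def)
qed

text \<open>Mean square finite on every bounded horizon, with no claim about [0,\<infinity>). State,
  control, drift and diffusion all live in this class, which is closed under sums and
  matrices.\<close>

definition ms_process :: "(real \<Rightarrow> 'a \<Rightarrow> 'b::{real_normed_vector, second_countable_topology}) \<Rightarrow> bool" where
  "ms_process X \<longleftrightarrow> progressively_measurable \<F> X \<and> (\<forall>T\<ge>0. mean_square M {0..T} X < \<infinity>)"

lemma mean_square_finite_iff:
  fixes X :: "real \<Rightarrow> 'a \<Rightarrow> 'b::{real_normed_vector, second_countable_topology}"
  assumes [measurable]: "cutoff I X \<in> borel_measurable \<mu>"
  shows "mean_square M I X < \<infinity> \<longleftrightarrow> L2 \<mu> (\<lambda>z. norm (cutoff I X z))"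
  unfolding mean_square_eq_cutoff[OF assms] L2_def integrable_iff_bounded by auto

lemma ms_process_L2:
  "ms_process X \<Longrightarrow> 0 \<le> T \<Longrightarrow> L2 \<mu> (\<lambda>z. norm (cutoff {0..T} X z))"
  using mean_square_finite_iff[of "{0..T}" X] progressively_measurable_cutoff[of X T] by (auto simp: ms_process_def)

lemma ms_processI:
  assumes "progressively_measurable \<F> X"
    "\<And>T. 0 \<le> T \<Longrightarrow> L2 \<mu> (g T)" "\<And>T z. 0 \<le> T \<Longrightarrow> norm (cutoff {0..T} X z) \<le> g T z"
  shows "ms_process X"
  unfolding ms_process_def
proof (intro conjI allI impI)
  fix T :: real assume T: "0 \<le> T"
  have [measurable]: "cutoff {0..T} X \<in> borel_measurable \<mu>"
    by (rule progressively_measurable_cutoff[OF assms(1) T])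
  have "L2 \<mu> (\<lambda>z. norm (cutoff {0..T} X z))"
  proof (rule L2_bound[OF assms(2)[OF T]])
    show "AE z in \<mu>. \<bar>norm (cutoff {0..T} X z)\<bar> \<le> \<bar>g T z\<bar>"
      using order_trans[OF assms(3)[OF T] abs_ge_self] by simp
  qed measurable
  then show "mean_square M {0..T} X < \<infinity>" by (subst mean_square_finite_iff) auto
qed fact

lemma ms_process_add:
  assumes "ms_process X" "ms_process Y"
  shows "ms_process (\<lambda>t \<omega>. X t \<omega> + Y t \<omega>)"
proof (rule ms_processI)
  show "progressively_measurable \<F> (\<lambda>t \<omega>. X t \<omega> + Y t \<omega>)"
    using assms by (auto simp: ms_process_def intro: progressively_measurable_add)
  show "L2 \<mu> (\<lambda>z. norm (cutoff {0..T} X z) + norm (cutoff {0..T} Y z))" if "0 \<le> T" for T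
    using assms that by (intro L2_add ms_process_L2)
qed (simp add: cutoff_add norm_triangle_ineq)

lemma ms_process_matrix:
  fixes A :: "real ^ 'n ^ 'm"
  assumes "ms_process X"
  shows "ms_process (\<lambda>t \<omega>. A *v X t \<omega>)"
proof (rule ms_processI)
  show "progressively_measurable \<F> (\<lambda>t \<omega>. A *v X t \<omega>)"
    using assms by (auto simp: ms_process_def intro: progressively_measurable_matrix)
  show "L2 \<mu> (\<lambda>z. onorm ((*v) A) * norm (cutoff {0..T} X z))" if "0 \<le> T" for T
    using assms that by (intro L2_cmult ms_process_L2)
qed (simp add: cutoff_matrix onorm matrix_vector_mul_bounded_linear)

lemma ms_process_inner_L2:
  fixes X :: "real \<Rightarrow> 'a \<Rightarrow> 'b::euclidean_space"
  shows "ms_process X \<Longrightarrow> 0 \<le> T \<Longrightarrow> L2 \<mu> (\<lambda>z. u \<bullet> cutoff {0..T} X z)"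
  using L2_cutoff_inner[of "{0..T}" X u] progressively_measurable_cutoff[of X T]
  by (auto simp: ms_process_def cutoff_inner[abs_def])

text \<open>The process \<open>u \<bullet> X\<close> solves a scalar equation. Pulling
  \<open>u\<close> into the time integral works on paths with integrable drift, hence almost surely;
  \<open>ito_cong_AE\<close> absorbs the exceptional set.\<close>

lemma solution_inner:
  fixes X :: "real \<Rightarrow> 'a \<Rightarrow> 'b::euclidean_space"
  assumes sol: "is_solution M W x b \<sigma> X" and b: "ms_process (\<lambda>t \<omega>. b t \<omega> (X t \<omega>))" and T: "0 \<le> T"
  defines "Xc \<equiv> cutoff {0..T} X" and "bc \<equiv> cutoff {0..T} (\<lambda>t \<omega>. b t \<omega> (X t \<omega>))"
    and "sc \<equiv> cutoff {0..T} (\<lambda>t \<omega>. \<sigma> t \<omega> (X t \<omega>))"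
  shows "L2 M (\<lambda>\<omega>. u \<bullet> X T \<omega>)"
    and "(LINT \<omega>|M. (u \<bullet> X T \<omega>)\<^sup>2) = (u \<bullet> x)\<^sup>2 + 2 * (LINT z|\<mu>. (u \<bullet> bc z) * (u \<bullet> Xc z)) + (LINT z|\<mu>. (u \<bullet> sc z)\<^sup>2)"
proof -
  have X: "ms_process X" using sol by (auto simp: is_solution_def ms_process_def)
  have int: "AE \<omega> in M. set_integrable lborel {0..t} (\<lambda>s. b s \<omega> (X s \<omega>))"
    and I: "has_ito_integral M W (\<lambda>t \<omega>. \<sigma> t \<omega> (X t \<omega>)) t
          (\<lambda>\<omega>. X t \<omega> - x - (LINT s:{0..t}|lborel. b s \<omega> (X s \<omega>)))" if "0 \<le> t" for t
    using sol that by (auto simp: is_solution_def)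
  have Xt: "X t \<in> borel_measurable M" if "0 \<le> t" for t
    using X that by (auto simp: ms_process_def intro: measurable_augmented_filtration progressively_measurable_augmented_section)
  have bL: "L2 \<mu> (cutoff {0..t} (\<lambda>t \<omega>. u \<bullet> b t \<omega> (X t \<omega>)))" if "0 \<le> t" for t
    unfolding cutoff_inner[abs_def] by (rule ms_process_inner_L2[OF b that])
  have XL: "L2 \<mu> (cutoff {0..T} (\<lambda>t \<omega>. u \<bullet> X t \<omega>))"
    unfolding cutoff_inner[abs_def] by (rule ms_process_inner_L2[OF X T])
  have adapted: "(\<lambda>\<omega>. u \<bullet> b t \<omega> (X t \<omega>)) \<in> borel_measurable (\<F> t)" if "0 \<le> t" for t
  proof -
    have "(\<lambda>\<omega>. b t \<omega> (X t \<omega>)) \<in> borel_measurable (\<F> t)"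
      using b that by (auto simp: ms_process_def intro: progressively_measurable_augmented_section[of M W "\<lambda>t \<omega>. b t \<omega> (X t \<omega>)"])
    then show ?thesis by measurable
  qed
  have ito: "ito (\<lambda>t \<omega>. u \<bullet> \<sigma> t \<omega> (X t \<omega>)) t (\<lambda>\<omega>. u \<bullet> X t \<omega> - u \<bullet> x - (LINT s:{0..t}|lborel. u \<bullet> b s \<omega> (X s \<omega>)))"
    if t: "0 \<le> t" for t
    proof (rule ito_cong_AE[OF has_ito_integral_inner[OF I[OF t] t]])
      show "(\<lambda>\<omega>. u \<bullet> X t \<omega> - u \<bullet> x - (LINT s:{0..t}|lborel. u \<bullet> b s \<omega> (X s \<omega>))) \<in> borel_measurable M"
        using Xt[OF t] integral_cutoff_measurable[OF L2_measurable[OF bL[OF t]]] by measurable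
      show "AE \<omega> in M. u \<bullet> (X t \<omega> - x - (LINT s:{0..t}|lborel. b s \<omega> (X s \<omega>)))
         = u \<bullet> X t \<omega> - u \<bullet> x - (LINT s:{0..t}|lborel. u \<bullet> b s \<omega> (X s \<omega>))"
        using int[OF t]
      proof eventually_elim
        case (elim \<omega>)
        then show ?case
          unfolding set_integrable_def set_lebesgue_integral_def
          by (simp add: inner_diff_right integral_inner_right[symmetric])
      qed
    qed
  note formula = ito_formula_square[where X="\<lambda>t \<omega>. u \<bullet> X t \<omega>" and b="\<lambda>t \<omega>. u \<bullet> b t \<omega> (X t \<omega>)"
    and \<sigma>="\<lambda>t \<omega>. u \<bullet> \<sigma> t \<omega> (X t \<omega>)" and x="u \<bullet> x", OF T XL bL[OF T] adapted ito]
  show "L2 M (\<lambda>\<omega>. u \<bullet> X T \<omega>)"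
    and "(LINT \<omega>|M. (u \<bullet> X T \<omega>)\<^sup>2) = (u \<bullet> x)\<^sup>2 + 2 * (LINT z|\<mu>. (u \<bullet> bc z) * (u \<bullet> Xc z)) + (LINT z|\<mu>. (u \<bullet> sc z)\<^sup>2)"
    using formula unfolding cutoff_inner Xc_def bc_def sc_def by simp_all
qed

text \<open>The integrand is the Ito drift of a product of two linear functionals of the state,
  obtained as a quarter of the difference of the drifts for \<open>u + w\<close> and
  \<open>u - w\<close>.\<close>

lemma solution_inner_product:
  fixes X :: "real \<Rightarrow> 'a \<Rightarrow> 'b::euclidean_space"
  assumes sol: "is_solution M W x b \<sigma> X" and b: "ms_process (\<lambda>t \<omega>. b t \<omega> (X t \<omega>))"
    and s: "ms_process (\<lambda>t \<omega>. \<sigma> t \<omega> (X t \<omega>))" and T: "0 \<le> T"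
  defines "Xc \<equiv> cutoff {0..T} X" and "bc \<equiv> cutoff {0..T} (\<lambda>t \<omega>. b t \<omega> (X t \<omega>))"
    and "sc \<equiv> cutoff {0..T} (\<lambda>t \<omega>. \<sigma> t \<omega> (X t \<omega>))"
  shows "(LINT \<omega>|M. (u \<bullet> X T \<omega>) * (w \<bullet> X T \<omega>)) = (u \<bullet> x) * (w \<bullet> x)
     + (LINT z|\<mu>. (u \<bullet> bc z) * (w \<bullet> Xc z) + (w \<bullet> bc z) * (u \<bullet> Xc z) + (u \<bullet> sc z) * (w \<bullet> sc z))"
    and "integrable \<mu> (\<lambda>z. (u \<bullet> bc z) * (w \<bullet> Xc z) + (w \<bullet> bc z) * (u \<bullet> Xc z) + (u \<bullet> sc z) * (w \<bullet> sc z))"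
proof -
  have X: "ms_process X" using sol by (auto simp: is_solution_def ms_process_def)
  have L: "L2 \<mu> (\<lambda>z. u \<bullet> Xc z)" "L2 \<mu> (\<lambda>z. u \<bullet> bc z)" "L2 \<mu> (\<lambda>z. u \<bullet> sc z)" for u
    unfolding Xc_def bc_def sc_def by (rule ms_process_inner_L2; fact)+
  note f = solution_inner[OF sol b T, folded Xc_def bc_def sc_def]
  have i: "integrable \<mu> (\<lambda>z. (u \<bullet> bc z) * (w \<bullet> Xc z))" for u w by (rule L2_mult[OF L(2,1)])
  have "4 * (LINT \<omega>|M. (u \<bullet> X T \<omega>) * (w \<bullet> X T \<omega>))
     = (((u + w) \<bullet> x)\<^sup>2 - ((u - w) \<bullet> x)\<^sup>2) + 2 * ((LINT z|\<mu>. ((u + w) \<bullet> bc z) * ((u + w) \<bullet> Xc z)) - (LINT z|\<mu>. ((u - w) \<bullet> bc z) * ((u - w) \<bullet> Xc z)))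
       + ((LINT z|\<mu>. ((u + w) \<bullet> sc z)\<^sup>2) - (LINT z|\<mu>. ((u - w) \<bullet> sc z)\<^sup>2))"
    unfolding L2_inner_polarization[OF f(1)] f(2) by simp
  also have "((u + w) \<bullet> x)\<^sup>2 - ((u - w) \<bullet> x)\<^sup>2 = 4 * ((u \<bullet> x) * (w \<bullet> x))"
    by (simp add: inner_add_left inner_diff_left power2_eq_square algebra_simps)
  also have "(LINT z|\<mu>. ((u + w) \<bullet> bc z) * ((u + w) \<bullet> Xc z)) - (LINT z|\<mu>. ((u - w) \<bullet> bc z) * ((u - w) \<bullet> Xc z))
     = (LINT z|\<mu>. ((u + w) \<bullet> bc z) * ((u + w) \<bullet> Xc z) - ((u - w) \<bullet> bc z) * ((u - w) \<bullet> Xc z))"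
    using i by simp
  also have "\<dots> = (LINT z|\<mu>. 2 * ((u \<bullet> bc z) * (w \<bullet> Xc z) + (w \<bullet> bc z) * (u \<bullet> Xc z)))"
    by (intro Bochner_Integration.integral_cong) (auto simp: inner_add_left inner_diff_left algebra_simps)
  also have "\<dots> = 2 * (LINT z|\<mu>. (u \<bullet> bc z) * (w \<bullet> Xc z) + (w \<bullet> bc z) * (u \<bullet> Xc z))"
    by (rule integral_mult_right_zero)
  also have "(LINT z|\<mu>. ((u + w) \<bullet> sc z)\<^sup>2) - (LINT z|\<mu>. ((u - w) \<bullet> sc z)\<^sup>2) = 4 * (LINT z|\<mu>. (u \<bullet> sc z) * (w \<bullet> sc z))"
    by (rule L2_inner_polarization[OF L(3), symmetric])
  finally have "(LINT \<omega>|M. (u \<bullet> X T \<omega>) * (w \<bullet> X T \<omega>)) = (u \<bullet> x) * (w \<bullet> x)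
     + ((LINT z|\<mu>. (u \<bullet> bc z) * (w \<bullet> Xc z) + (w \<bullet> bc z) * (u \<bullet> Xc z)) + (LINT z|\<mu>. (u \<bullet> sc z) * (w \<bullet> sc z)))"
    by linarith
  then show "(LINT \<omega>|M. (u \<bullet> X T \<omega>) * (w \<bullet> X T \<omega>)) = (u \<bullet> x) * (w \<bullet> x)
     + (LINT z|\<mu>. (u \<bullet> bc z) * (w \<bullet> Xc z) + (w \<bullet> bc z) * (u \<bullet> Xc z) + (u \<bullet> sc z) * (w \<bullet> sc z))"
    using i L2_mult[OF L(3,3)] by simp
  show "integrable \<mu> (\<lambda>z. (u \<bullet> bc z) * (w \<bullet> Xc z) + (w \<bullet> bc z) * (u \<bullet> Xc z) + (u \<bullet> sc z) * (w \<bullet> sc z))"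
    using i L2_mult[OF L(3,3)] by simp
qed

lemma solution_quadratic_form:
  fixes X :: "real \<Rightarrow> 'a \<Rightarrow> real ^ 'n" and P :: "real ^ 'n ^ 'n"
  assumes sol: "is_solution M W x b \<sigma> X" and b: "ms_process (\<lambda>t \<omega>. b t \<omega> (X t \<omega>))"
    and s: "ms_process (\<lambda>t \<omega>. \<sigma> t \<omega> (X t \<omega>))" and P: "symmetric_matrix P" and T: "0 \<le> T"
  defines "g \<equiv> cutoff {0..T} (\<lambda>t \<omega>. 2 * ((P *v X t \<omega>) \<bullet> b t \<omega> (X t \<omega>)) + (P *v \<sigma> t \<omega> (X t \<omega>)) \<bullet> \<sigma> t \<omega> (X t \<omega>))"
  shows "integrable M (\<lambda>\<omega>. (P *v X T \<omega>) \<bullet> X T \<omega>)" and "integrable \<mu> g"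
    and "(LINT \<omega>|M. (P *v X T \<omega>) \<bullet> X T \<omega>) = (P *v x) \<bullet> x + (LINT z|\<mu>. g z)"
proof -
  define Xc where "Xc = cutoff {0..T} X"
  define bc where "bc = cutoff {0..T} (\<lambda>t \<omega>. b t \<omega> (X t \<omega>))"
  define sc where "sc = cutoff {0..T} (\<lambda>t \<omega>. \<sigma> t \<omega> (X t \<omega>))"
  note f = solution_inner_product[OF sol b s T, folded Xc_def bc_def sc_def]
  let ?h = "\<lambda>i j z. (axis i 1 \<bullet> bc z) * (axis j 1 \<bullet> Xc z) + (axis j 1 \<bullet> bc z) * (axis i 1 \<bullet> Xc z) + (axis i 1 \<bullet> sc z) * (axis j 1 \<bullet> sc z)"
  have g: "g z = (\<Sum>i\<in>UNIV. \<Sum>j\<in>UNIV. P $ i $ j * ?h i j z)" for z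
  proof -
    \<comment> \<open>Symmetry of \<open>P\<close> is what merges the two drift terms of the product
      rule into the factor 2.\<close>
    have "g z = (P *v Xc z) \<bullet> bc z + (P *v bc z) \<bullet> Xc z + (P *v sc z) \<bullet> sc z"
    proof -
      have "(P *v bc z) \<bullet> Xc z = (P *v Xc z) \<bullet> bc z"
        using symmetric_matrix_inner[OF P, of "bc z" "Xc z"] by (simp add: inner_commute)
      moreover have "g z = 2 * ((P *v Xc z) \<bullet> bc z) + (P *v sc z) \<bullet> sc z"
        unfolding g_def Xc_def bc_def sc_def by (cases z) (auto simp: cutoff_def indicator_def)
      ultimately show ?thesis by simp
    qed
    also have "\<dots> = (\<Sum>i\<in>UNIV. \<Sum>j\<in>UNIV. P $ i $ j * ?h i j z)"
      unfolding matrix_vector_inner_eq_sum sum.distrib[symmetric] by (intro sum.cong refl) (simp add: algebra_simps)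
    finally show ?thesis .
  qed
  have i: "integrable M (\<lambda>\<omega>. (axis i 1 \<bullet> X T \<omega>) * (axis j 1 \<bullet> X T \<omega>))" for i j
    by (rule L2_mult[OF solution_inner(1)[OF sol b T] solution_inner(1)[OF sol b T]])
  show "integrable M (\<lambda>\<omega>. (P *v X T \<omega>) \<bullet> X T \<omega>)"
    unfolding matrix_vector_inner_eq_sum by (intro Bochner_Integration.integrable_sum integrable_mult_right i)
  show "integrable \<mu> g"
    unfolding g[abs_def] by (intro Bochner_Integration.integrable_sum integrable_mult_right f(2))
  have "(LINT \<omega>|M. (P *v X T \<omega>) \<bullet> X T \<omega>) = (\<Sum>i\<in>UNIV. \<Sum>j\<in>UNIV. P $ i $ j * (LINT \<omega>|M. (axis i 1 \<bullet> X T \<omega>) * (axis j 1 \<bullet> X T \<omega>)))"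
    unfolding matrix_vector_inner_eq_sum using i by simp
  also have "\<dots> = (\<Sum>i\<in>UNIV. \<Sum>j\<in>UNIV. P $ i $ j * ((axis i 1 \<bullet> x) * (axis j 1 \<bullet> x))) + (\<Sum>i\<in>UNIV. \<Sum>j\<in>UNIV. P $ i $ j * (LINT z|\<mu>. ?h i j z))"
    unfolding f(1) by (simp only: distrib_left sum.distrib)
  also have "(\<Sum>i\<in>UNIV. \<Sum>j\<in>UNIV. P $ i $ j * (LINT z|\<mu>. ?h i j z)) = (LINT z|\<mu>. g z)"
  proof -
    have "(LINT z|\<mu>. g z) = (\<Sum>i\<in>UNIV. (LINT z|\<mu>. (\<Sum>j\<in>UNIV. P $ i $ j * ?h i j z)))"
      unfolding g by (rule Bochner_Integration.integral_sum) (intro Bochner_Integration.integrable_sum integrable_mult_right f(2))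
    also have "\<dots> = (\<Sum>i\<in>UNIV. \<Sum>j\<in>UNIV. (LINT z|\<mu>. P $ i $ j * ?h i j z))"
      by (intro sum.cong refl Bochner_Integration.integral_sum integrable_mult_right f(2))
    finally show ?thesis by (simp only: integral_mult_right_zero)
  qed
  finally show "(LINT \<omega>|M. (P *v X T \<omega>) \<bullet> X T \<omega>) = (P *v x) \<bullet> x + (LINT z|\<mu>. g z)"
    unfolding matrix_vector_inner_eq_sum .
qed

end

section \<open>Lyapunov operators and stability\<close>

lemma matrix_form_bound:
  fixes N :: "real ^ 'n ^ 'm"
  obtains K where "K > 0" "\<And>x y. \<bar>(N *v x) \<bullet> y\<bar> \<le> K * norm x * norm y"
proof
  \<comment> \<open>The \<open>+ 1\<close> keeps the constant positive for \<open>N = 0\<close>;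
    later arguments divide by it.\<close>
  show "onorm ((*v) N) + 1 > 0"
    using onorm_pos_le[OF matrix_vector_mul_bounded_linear, of N] by linarith
  fix x y
  have "\<bar>(N *v x) \<bullet> y\<bar> \<le> norm (N *v x) * norm y" by (rule Cauchy_Schwarz_ineq2)
  also have "\<dots> \<le> (onorm ((*v) N) * norm x) * norm y"
    by (intro mult_right_mono onorm matrix_vector_mul_bounded_linear norm_ge_zero)
  also have "\<dots> \<le> (onorm ((*v) N) + 1) * norm x * norm y"
    by (intro mult_right_mono) auto
  finally show "\<bar>(N *v x) \<bullet> y\<bar> \<le> (onorm ((*v) N) + 1) * norm x * norm y" .
qed

lemma transpose_add: "transpose (X + Y) = transpose X + transpose (Y :: real ^ 'n ^ 'm)"
  and transpose_diff: "transpose (X - Y) = transpose X - transpose (Y :: real ^ 'n ^ 'm)"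
  by (simp_all add: transpose_def vec_eq_iff)

lemma matrix_vector_mult_minus_left: "(- X) *v y = - (X *v (y :: real ^ 'n))"
  by (simp add: matrix_vector_mult_def vec_eq_iff sum_negf)

lemma matrix_mult_add_left: "(X + Y) ** Z = X ** Z + Y ** (Z :: real ^ 'n ^ 'm)"
  by (simp add: matrix_matrix_mult_def vec_eq_iff sum.distrib distrib_right)

lemma symmetric_form_zero_imp_zero:
  fixes P :: "real ^ 'n ^ 'n"
  assumes P: "symmetric_matrix P" and zero: "\<And>x. (P *v x) \<bullet> x = 0"
  shows "P = 0"
proof -
  have "(P *v x) \<bullet> y = 0" for x y
    using zero[of "x + y"] zero[of x] zero[of y] symmetric_matrix_inner[OF P, of y x]
    by (simp add: matrix_vector_right_distrib inner_add_left inner_add_right inner_commute)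
  then have "P *v x = 0" for x using inner_eq_zero_iff by blast
  then show ?thesis by (simp add: matrix_eq)
qed

text \<open>For dX = A X dt + C X dW and symmetric \<open>P\<close>, the Ito drift of <P X, X> is
  the quadratic form of this matrix at \<open>X\<close>.\<close>

definition lyapunov_operator :: "real ^ 'n ^ 'n \<Rightarrow> real ^ 'n ^ 'n \<Rightarrow> real ^ 'n ^ 'n \<Rightarrow> real ^ 'n ^ 'n" where
  "lyapunov_operator A C P = P ** A + transpose A ** P + transpose C ** P ** C"

lemma lyapunov_operator_form:
  assumes "symmetric_matrix P"
  shows "(lyapunov_operator A C P *v y) \<bullet> y = 2 * ((P *v y) \<bullet> (A *v y)) + (P *v (C *v y)) \<bullet> (C *v y)"
proof -
  have "(lyapunov_operator A C P *v y) \<bullet> y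
      = (P *v (A *v y)) \<bullet> y + (P *v y) \<bullet> (A *v y) + (P *v (C *v y)) \<bullet> (C *v y)"
    by (simp add: lyapunov_operator_def matrix_vector_mult_add_rdistrib inner_add_left dot_lmul_matrix
      flip: matrix_vector_mul_assoc)
  then show ?thesis
    using symmetric_matrix_inner[OF assms, of "A *v y" y] inner_commute[of "A *v y" "P *v y"] by linarith
qed

lemma transpose_lyapunov_operator:
  assumes "symmetric_matrix P"
  shows "transpose (lyapunov_operator A C P) = lyapunov_operator A C P"
  using assms
  by (simp add: lyapunov_operator_def symmetric_matrix_def matrix_transpose_mul transpose_add matrix_mul_assoc add.commute)

lemma linear_lyapunov_operator: "linear (lyapunov_operator A C)"
  by (rule linearI) (simp_all add: lyapunov_operator_def matrix_add_ldistrib matrix_mult_add_left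
      scaleR_add_right scalar_matrix_assoc matrix_scalar_ac)

text \<open>On symmetric matrices the Lyapunov operator is an endomorphism, so injectivity gives surjectivity.
  Adding the antisymmetric part turns this into a statement about all square matrices.\<close>

lemma lyapunov_operator_surj:
  fixes A C Z :: "real ^ 'n ^ 'n"
  assumes inj: "\<And>P. symmetric_matrix P \<Longrightarrow> lyapunov_operator A C P = 0 \<Longrightarrow> P = 0"
    and Z: "symmetric_matrix Z"
  shows "\<exists>P. symmetric_matrix P \<and> lyapunov_operator A C P = Z"
proof -
  define F where "F = (\<lambda>P. lyapunov_operator A C (P + transpose P) + (P - transpose P))"
  have sym: "symmetric_matrix (P + transpose P)" for P :: "real ^ 'n ^ 'n"
    by (simp add: symmetric_matrix_def transpose_add add.commute)
  \<comment> \<open>Transposition only changes the sign of the antisymmetric summand of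
    \<open>F P\<close>, so a symmetric value forces that summand to be 0.\<close>
  have F_sym: "P = transpose P \<and> lyapunov_operator A C (P + transpose P) = F P" if "symmetric_matrix (F P)" for P
  proof -
    have "transpose (F P) = lyapunov_operator A C (P + transpose P) - (P - transpose P)"
      unfolding F_def transpose_add transpose_diff transpose_lyapunov_operator[OF sym] by simp
    then have "2 *\<^sub>R (P - transpose P) = 0"
      using that unfolding symmetric_matrix_def by (simp add: F_def scaleR_2)
    then show ?thesis by (simp add: F_def)
  qed
  have lin: "linear F"
  proof (rule linearI)
    fix X Y :: "real ^ 'n ^ 'n"
    have "X + Y + transpose (X + Y) = (X + transpose X) + (Y + transpose Y)" by (simp add: transpose_add)
    then show "F (X + Y) = F X + F Y"
      unfolding F_def by (simp add: linear_add[OF linear_lyapunov_operator] transpose_add)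
  next
    fix c and X :: "real ^ 'n ^ 'n"
    have e: "c *\<^sub>R X + transpose (c *\<^sub>R X) = c *\<^sub>R (X + transpose X)" by (simp add: transpose_scalar scaleR_add_right)
    show "F (c *\<^sub>R X) = c *\<^sub>R F X"
      unfolding F_def e linear_scale[OF linear_lyapunov_operator]
      by (simp add: transpose_scalar scaleR_add_right scaleR_diff_right)
  qed
  moreover have "inj F"
    unfolding linear_injective_0[OF lin]
  proof (intro allI impI)
    fix P assume F0: "F P = 0"
    then have "symmetric_matrix (F P)" by (simp add: symmetric_matrix_def transpose_def vec_eq_iff)
    from F_sym[OF this] have 1: "P = transpose P" and "lyapunov_operator A C (P + transpose P) = 0" using F0 by auto
    with inj[OF sym] have "P + transpose P = 0" by blast
    with 1 have "2 *\<^sub>R P = 0" by (simp add: scaleR_2)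
    then show "P = 0" by simp
  qed
  ultimately have "surj F" using linear_injective_imp_surjective[of F] by blast
  then obtain P where P: "F P = Z" by (metis surjD)
  have "lyapunov_operator A C (P + transpose P) = Z" using F_sym[of P, unfolded P, OF Z] by blast
  with sym show ?thesis by blast
qed

text \<open>Here \<open>A\<close> and \<open>C\<close> are the closed-loop matrices. The right side
  minus the left is a sum of three nonnegative terms: the Lyapunov form at \<open>x\<close>, the
  Schur form at \<open>v\<close>, and the \<open>Q0\<close> form at a shifted
  \<open>x\<close>.\<close>

lemma completed_square_bound:
  fixes A C Q Q0 P :: "real ^ 'n ^ 'n" and B D :: "real ^ 'm ^ 'n"
    and R :: "real ^ 'm ^ 'm" and S \<Theta> :: "real ^ 'n ^ 'm" and \<delta> :: real
  assumes R: "symmetric_matrix R" and Q0: "pos_def Q0" and P: "symmetric_matrix P"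
    and lyap: "pos_semidef (P ** A + transpose A ** P + transpose C ** P ** C
       + transpose S ** \<Theta> + transpose \<Theta> ** S + transpose \<Theta> ** R ** \<Theta> + Q - Q0)"
    and K: "K = P ** B + transpose C ** P ** D + transpose S + transpose \<Theta> ** R"
    and schur: "pos_semidef (R + transpose D ** P ** D - transpose K ** matrix_inv Q0 ** K - \<delta> *\<^sub>R mat 1)"
  shows "\<delta> * (norm v)\<^sup>2 \<le>
    (((Q + transpose S ** \<Theta> + transpose \<Theta> ** S + transpose \<Theta> ** R ** \<Theta>) *v x) \<bullet> x
      + 2 * (((S + R ** \<Theta>) *v x) \<bullet> v) + (R *v v) \<bullet> v)
    + (2 * ((P *v x) \<bullet> (A *v x + B *v v)) + (P *v (C *v x + D *v v)) \<bullet> (C *v x + D *v v))"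
proof -
  have mv: "(X - Y) *v z = X *v z - Y *v z" for X Y :: "real ^ 'i ^ 'j" and z
    by (simp add: matrix_vector_mult_diff_rdistrib)
  have sQ0: "symmetric_matrix Q0" using Q0 by (simp add: pos_def_def)
  \<comment> \<open>\<open>matrix_inv\<close> is defined by choice, so invertibility comes first: a
    positive definite matrix has trivial kernel.\<close>
  have "\<exists>B. B ** Q0 = mat 1"
    unfolding matrix_left_invertible_ker using Q0 by (metis inner_zero_left less_irrefl pos_def_def)
  then have inv: "Q0 ** matrix_inv Q0 = mat 1"
    using someI_ex[of "\<lambda>A'. Q0 ** A' = mat 1 \<and> A' ** Q0 = mat 1"] invertible_left_inverse[of Q0]
    unfolding matrix_inv_def invertible_def by blast
  \<comment> \<open>The minimizer over \<open>x\<close> of the \<open>Q0\<close> form plus twice <K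
    v, x> is \<open>- w\<close>, and the minimum -<w, K v> is exactly the term subtracted in the
    Schur condition.\<close>
  define w where "w = matrix_inv Q0 *v (K *v v)"
  have Q0w: "Q0 *v w = K *v v" unfolding w_def by (simp add: matrix_vector_mul_assoc matrix_mul_assoc inv)
  have "0 \<le> (Q0 *v (x + w)) \<bullet> (x + w)"
    using Q0 unfolding pos_def_def by (cases "x + w = 0") (auto intro: less_imp_le)
  also have "\<dots> = (Q0 *v x) \<bullet> x + 2 * ((K *v v) \<bullet> x) + w \<bullet> (K *v v)"
    using symmetric_matrix_inner[OF sQ0, of x w] Q0w
    by (simp add: matrix_vector_right_distrib inner_add_left inner_add_right inner_commute)
  finally have 1: "0 \<le> (Q0 *v x) \<bullet> x + 2 * ((K *v v) \<bullet> x) + w \<bullet> (K *v v)" .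
  have "0 \<le> ((R + transpose D ** P ** D - transpose K ** matrix_inv Q0 ** K - \<delta> *\<^sub>R mat 1) *v v) \<bullet> v"
    using schur by (simp add: pos_semidef_def)
  then have 2: "0 \<le> (R *v v) \<bullet> v + (P *v (D *v v)) \<bullet> (D *v v) - w \<bullet> (K *v v) - \<delta> * (norm v)\<^sup>2"
    by (simp add: mv matrix_vector_mult_add_rdistrib inner_add_left inner_diff_left dot_lmul_matrix w_def
        scaleR_matrix_vector_assoc[symmetric] power2_norm_eq_inner flip: matrix_vector_mul_assoc)
  have "0 \<le> ((P ** A + transpose A ** P + transpose C ** P ** C
       + transpose S ** \<Theta> + transpose \<Theta> ** S + transpose \<Theta> ** R ** \<Theta> + Q - Q0) *v x) \<bullet> x"
    using lyap by (simp add: pos_semidef_def)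
  then have 3: "0 \<le> ((lyapunov_operator A C P) *v x) \<bullet> x
      + ((Q + transpose S ** \<Theta> + transpose \<Theta> ** S + transpose \<Theta> ** R ** \<Theta>) *v x) \<bullet> x - (Q0 *v x) \<bullet> x"
    unfolding lyapunov_operator_def
    by (simp only: mv matrix_vector_mult_add_rdistrib inner_add_left inner_diff_left)
  have 4: "(K *v v) \<bullet> x = (P *v x) \<bullet> (B *v v) + (P *v (C *v x)) \<bullet> (D *v v) + (S *v x) \<bullet> v + (R *v (\<Theta> *v x)) \<bullet> v"
  proof -
    have "(K *v v) \<bullet> x = (P *v (B *v v)) \<bullet> x + (P *v (D *v v)) \<bullet> (C *v x) + v \<bullet> (S *v x) + (R *v v) \<bullet> (\<Theta> *v x)"
      unfolding K by (simp add: matrix_vector_mult_add_rdistrib inner_add_left dot_lmul_matrix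
        flip: matrix_vector_mul_assoc)
    moreover have "(P *v (B *v v)) \<bullet> x = (P *v x) \<bullet> (B *v v)"
      "(P *v (D *v v)) \<bullet> (C *v x) = (P *v (C *v x)) \<bullet> (D *v v)" "v \<bullet> (S *v x) = (S *v x) \<bullet> v"
      "(R *v v) \<bullet> (\<Theta> *v x) = (R *v (\<Theta> *v x)) \<bullet> v"
      using symmetric_matrix_inner[OF P] symmetric_matrix_inner[OF R] inner_commute by metis+
    ultimately show ?thesis by simp
  qed
  have 5: "((S + R ** \<Theta>) *v x) \<bullet> v = (S *v x) \<bullet> v + (R *v (\<Theta> *v x)) \<bullet> v"
    by (simp add: matrix_vector_mult_add_rdistrib inner_add_left flip: matrix_vector_mul_assoc)
  have 6: "2 * ((P *v x) \<bullet> (A *v x + B *v v)) + (P *v (C *v x + D *v v)) \<bullet> (C *v x + D *v v)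
    = (lyapunov_operator A C P *v x) \<bullet> x + 2 * ((P *v x) \<bullet> (B *v v)) + 2 * ((P *v (C *v x)) \<bullet> (D *v v)) + (P *v (D *v v)) \<bullet> (D *v v)"
    unfolding lyapunov_operator_form[OF P]
    using symmetric_matrix_inner[OF P, of "D *v v" "C *v x"]
    by (simp add: matrix_vector_right_distrib inner_add_left inner_add_right inner_commute)
  \<comment> \<open>With the forms abstracted to real numbers, the goal is the sum of the three
    inequalities: \<open>q\<close> and \<open>w\<close> cancel and \<open>k\<close> is
    expanded.\<close>
  have "e \<le> (n + 2 * (s + t) + r) + (l + 2 * b + 2 * c + d)"
    if "0 \<le> q + 2 * k + w" "0 \<le> r + d - w - e" "0 \<le> l + n - q" "k = b + c + s + t"
    for e n s t r l b c d q k w :: real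
    using that by argo
  from this[OF 1 2 3 4] show ?thesis unfolding 5 6 .
qed

section \<open>Lyapunov equations of stable systems\<close>

context standard_brownian_motion
begin

lemma cutoff_tendsto_infinite:
  fixes X :: "real \<Rightarrow> 'a \<Rightarrow> 'b::real_normed_vector"
  assumes "filterlim T at_top F"
  shows "((\<lambda>n. cutoff {0..T n} X z) \<longlongrightarrow> cutoff {0..} X z) F"
proof (rule tendsto_eventually)
  have "eventually (\<lambda>n. fst z \<le> T n) F" using assms by (simp add: filterlim_at_top)
  then show "eventually (\<lambda>n. cutoff {0..T n} X z = cutoff {0..} X z) F"
    by eventually_elim (cases z, auto simp: cutoff_def indicator_def)
qed

lemma progressively_measurable_cutoff_infinite:
  fixes X :: "real \<Rightarrow> 'a \<Rightarrow> 'b::{real_normed_vector, second_countable_topology}"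
  assumes "progressively_measurable \<F> X"
  shows "cutoff {0..} X \<in> borel_measurable \<mu>"
proof (rule borel_measurable_LIMSEQ_metric)
  show "cutoff {0..real n} X \<in> borel_measurable \<mu>" for n
    by (rule progressively_measurable_cutoff[OF assms]) simp
  show "(\<lambda>n. cutoff {0..real n} X z) \<longlonglongrightarrow> cutoff {0..} X z" for z
    by (rule cutoff_tendsto_infinite[OF filterlim_real_sequentially])
qed

text \<open>By Fubini, E|X(T)|^2 is an integrable function of \<open>T\<close>, and a positive lower
  bound on a half-line would make its integral infinite. This is weaker than convergence to 0 and
  enough for every boundary term.\<close>

lemma L2_infinite_not_bounded_below:
  fixes X :: "real \<Rightarrow> 'a \<Rightarrow> 'b::{real_normed_vector, second_countable_topology}"
  assumes X: "L2 \<mu> (\<lambda>z. norm (cutoff {0..} X z))" and \<epsilon>: "0 < \<epsilon>" and T0: "0 \<le> T0"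
    and lower: "\<And>T. T0 \<le> T \<Longrightarrow> \<epsilon> \<le> (LINT \<omega>|M. (norm (X T \<omega>))\<^sup>2)"
  shows False
proof -
  define h where "h = (\<lambda>t. LINT \<omega>|M. (norm (cutoff {0..} X (t, \<omega>)))\<^sup>2)"
  have h: "integrable lborel h" unfolding h_def by (rule time_prob.integrable_fst'[OF L2_square[OF X]])
  have h0: "0 \<le> h t" for t unfolding h_def by (rule integral_nonneg_AE) simp
  have "real n * \<epsilon> \<le> (LINT t|lborel. h t)" for n
  proof -
    have "real n * \<epsilon> = (LINT t|lborel. indicator {T0..T0 + real n} t * \<epsilon>)" by simp
    also have "\<dots> \<le> (LINT t|lborel. h t)"
    proof (rule integral_mono[OF _ h])
      show "integrable lborel (\<lambda>t. indicator {T0..T0 + real n} t * \<epsilon>)"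
        by (intro integrable_mult_left integrable_real_indicator) (auto simp: emeasure_lborel_Icc_eq)
      fix t
      show "indicator {T0..T0 + real n} t * \<epsilon> \<le> h t"
        using lower[of t] T0 h0[of t] by (auto simp: indicator_def h_def cutoff_def)
    qed
    finally show ?thesis .
  qed
  moreover obtain n where "(LINT t|lborel. h t) / \<epsilon> < real n" using reals_Archimedean2 by blast
  then have "(LINT t|lborel. h t) < real n * \<epsilon>" using \<epsilon> by (simp add: pos_divide_less_eq)
  ultimately show False by (meson not_le)
qed

lemma solution_norm_integrable:
  fixes X :: "real \<Rightarrow> 'a \<Rightarrow> real ^ 'n"
  assumes sol: "is_solution M W x b \<sigma> X" and b: "ms_process (\<lambda>t \<omega>. b t \<omega> (X t \<omega>))"
    and s: "ms_process (\<lambda>t \<omega>. \<sigma> t \<omega> (X t \<omega>))" and T: "0 \<le> T"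
  shows "integrable M (\<lambda>\<omega>. (norm (X T \<omega>))\<^sup>2)"
  using solution_quadratic_form(1)[OF sol b s _ T, of "mat 1"]
  by (simp add: symmetric_matrix_def power2_norm_eq_inner)

lemma solution_form_le_norm:
  fixes X :: "real \<Rightarrow> 'a \<Rightarrow> real ^ 'n" and P :: "real ^ 'n ^ 'n"
  assumes sol: "is_solution M W x b \<sigma> X" and b: "ms_process (\<lambda>t \<omega>. b t \<omega> (X t \<omega>))"
    and s: "ms_process (\<lambda>t \<omega>. \<sigma> t \<omega> (X t \<omega>))" and P: "symmetric_matrix P" and T: "0 \<le> T"
    and K: "\<And>y z. \<bar>(P *v y) \<bullet> z\<bar> \<le> K * norm y * norm z"
  shows "\<bar>LINT \<omega>|M. (P *v X T \<omega>) \<bullet> X T \<omega>\<bar> \<le> K * (LINT \<omega>|M. (norm (X T \<omega>))\<^sup>2)"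
proof -
  note i = solution_norm_integrable[OF sol b s T]
  have "\<bar>LINT \<omega>|M. (P *v X T \<omega>) \<bullet> X T \<omega>\<bar> \<le> (LINT \<omega>|M. \<bar>(P *v X T \<omega>) \<bullet> X T \<omega>\<bar>)"
    by (rule integral_abs_bound)
  also have "\<dots> \<le> (LINT \<omega>|M. K * (norm (X T \<omega>))\<^sup>2)"
    using K i by (intro integral_mono integrable_abs solution_quadratic_form(1)[OF sol b s P T] integrable_mult_right)
      (auto simp: power2_eq_square mult.assoc)
  finally show ?thesis by simp
qed

text \<open>A nonpositive drift gives E<P X(T), X(T)> \<le> <P x, x>. If the right side were
  negative, E|X(T)|^2 would stay above a positive constant for all \<open>T\<close>.\<close>

lemma stable_lyapunov_nonneg:
  fixes X :: "real \<Rightarrow> 'a \<Rightarrow> real ^ 'n" and A C P :: "real ^ 'n ^ 'n"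
  assumes sol: "is_solution M W x (\<lambda>t \<omega> y. A *v y) (\<lambda>t \<omega> y. C *v y) X"
    and fin: "mean_square M {0..} X < \<infinity>" and P: "symmetric_matrix P"
    and neg: "\<And>y. (lyapunov_operator A C P *v y) \<bullet> y \<le> 0"
  shows "0 \<le> (P *v x) \<bullet> x"
proof (rule ccontr)
  assume "\<not> 0 \<le> (P *v x) \<bullet> x"
  then have c: "0 < - ((P *v x) \<bullet> x)" by simp
  have X: "ms_process X" using sol by (auto simp: is_solution_def ms_process_def)
  have b: "ms_process (\<lambda>t \<omega>. A *v X t \<omega>)" and s: "ms_process (\<lambda>t \<omega>. C *v X t \<omega>)"
    by (rule ms_process_matrix[OF X])+
  obtain K where K: "K > 0" "\<And>y z. \<bar>(P *v y) \<bullet> z\<bar> \<le> K * norm y * norm z" using matrix_form_bound by blast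
  have XL: "L2 \<mu> (\<lambda>z. norm (cutoff {0..} X z))"
    using fin X by (subst (asm) mean_square_finite_iff) (auto simp: ms_process_def intro: progressively_measurable_cutoff_infinite)
  show False
  proof (rule L2_infinite_not_bounded_below[OF XL _ order.refl])
    show "0 < - ((P *v x) \<bullet> x) / K" using c K(1) by (rule divide_pos_pos)
    fix T :: real assume T: "0 \<le> T"
    have "(LINT \<omega>|M. (P *v X T \<omega>) \<bullet> X T \<omega>) = (P *v x) \<bullet> x
      + (LINT z|\<mu>. cutoff {0..T} (\<lambda>t \<omega>. 2 * ((P *v X t \<omega>) \<bullet> (A *v X t \<omega>)) + (P *v (C *v X t \<omega>)) \<bullet> (C *v X t \<omega>)) z)"
      by (rule solution_quadratic_form(3)[OF sol b s P T])
    also have "\<dots> = (P *v x) \<bullet> x - (LINT z|\<mu>. - cutoff {0..T} (\<lambda>t \<omega>. (lyapunov_operator A C P *v X t \<omega>) \<bullet> X t \<omega>) z)"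
      unfolding lyapunov_operator_form[OF P] by simp
    also have "\<dots> \<le> (P *v x) \<bullet> x - 0"
      using neg by (intro diff_left_mono integral_nonneg_AE) (auto simp: cutoff_def indicator_def)
    finally have "- ((P *v x) \<bullet> x) \<le> \<bar>LINT \<omega>|M. (P *v X T \<omega>) \<bullet> X T \<omega>\<bar>" by linarith
    also have "\<dots> \<le> K * (LINT \<omega>|M. (norm (X T \<omega>))\<^sup>2)"
      by (rule solution_form_le_norm[OF sol b s P T K(2)])
    finally show "- ((P *v x) \<bullet> x) / K \<le> (LINT \<omega>|M. (norm (X T \<omega>))\<^sup>2)"
      by (subst pos_divide_le_eq[OF K(1)]) (simp add: mult.commute)
  qed
qed

text \<open>For \<open>P\<close> in the kernel, \<open>stable_lyapunov_nonneg\<close> applies to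
  both \<open>P\<close> and \<open>- P\<close>, so the form of \<open>P\<close> vanishes. Applied to
  the solution with value \<open>- mat 1\<close>, the same lemma gives its sign.\<close>

lemma stable_lyapunov_solution:
  fixes A C :: "real ^ 'n ^ 'n"
  assumes stable: "\<And>x. \<exists>X. is_solution M W x (\<lambda>t \<omega> y. A *v y) (\<lambda>t \<omega> y. C *v y) X \<and> mean_square M {0..} X < \<infinity>"
  shows "\<exists>P. symmetric_matrix P \<and> lyapunov_operator A C P = - mat 1 \<and> (\<forall>x. 0 \<le> (P *v x) \<bullet> x)"
proof -
  have nonneg: "0 \<le> (P *v x) \<bullet> x" if "symmetric_matrix P" "\<And>y. (lyapunov_operator A C P *v y) \<bullet> y \<le> 0" for P x
    using stable[of x] stable_lyapunov_nonneg[OF _ _ that] by blast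
  have "\<exists>P. symmetric_matrix P \<and> lyapunov_operator A C P = - mat 1"
  proof (rule lyapunov_operator_surj)
    fix P assume P: "symmetric_matrix P" and 0: "lyapunov_operator A C P = 0"
    have mP: "symmetric_matrix (- P)" using P by (simp add: symmetric_matrix_def transpose_def vec_eq_iff)
    have m0: "lyapunov_operator A C (- P) = 0"
      using 0 linear_neg[OF linear_lyapunov_operator, of A C P] by simp
    have "(P *v x) \<bullet> x = 0" for x
      using nonneg[OF P, of x] nonneg[OF mP, of x] by (simp add: 0 m0 matrix_vector_mult_minus_left)
    then show "P = 0" by (rule symmetric_form_zero_imp_zero[OF P])
  qed (simp add: symmetric_matrix_def transpose_def mat_def vec_eq_iff eq_commute)
  then obtain P where P: "symmetric_matrix P" "lyapunov_operator A C P = - mat 1" by blast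
  have "0 \<le> (P *v x) \<bullet> x" for x by (rule nonneg[OF P(1)]) (simp add: P(2) matrix_vector_mult_minus_left)
  with P show ?thesis by blast
qed

end

section \<open>The state under a square integrable control\<close>

lemma integrable_matrix_form:
  fixes N :: "real ^ 'n ^ 'm"
  assumes [measurable]: "f \<in> borel_measurable \<mu>" "g \<in> borel_measurable \<mu>"
    and f: "L2 \<mu> (\<lambda>z. norm (f z))" and g: "L2 \<mu> (\<lambda>z. norm (g z))"
  shows "integrable \<mu> (\<lambda>z. (N *v f z) \<bullet> g z)"
proof -
  obtain K where K: "K > 0" "\<And>x y. \<bar>(N *v x) \<bullet> y\<bar> \<le> K * norm x * norm y" using matrix_form_bound by blast
  show ?thesis
  proof (rule Bochner_Integration.integrable_bound[OF integrable_mult_right[OF L2_mult[OF f g], of K]])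
    show "AE z in \<mu>. norm ((N *v f z) \<bullet> g z) \<le> norm (K * (norm (f z) * norm (g z)))"
      using K by (auto simp: abs_mult mult.assoc)
  qed measurable
qed

text \<open>The value \<open>- mat 1\<close> contributes -|x|^2; Young's inequality spends half of
  it on the cross term between \<open>x\<close> and \<open>v\<close>.\<close>

lemma lyapunov_dissipation_bound:
  fixes A C P :: "real ^ 'n ^ 'n" and B D :: "real ^ 'm ^ 'n"
  assumes P: "symmetric_matrix P" and L: "lyapunov_operator A C P = - mat 1"
  shows "\<exists>c\<ge>0. \<forall>x v. 2 * ((P *v x) \<bullet> (A *v x + B *v v)) + (P *v (C *v x + D *v v)) \<bullet> (C *v x + D *v v)
    \<le> - (norm x)\<^sup>2 / 2 + c * (norm v)\<^sup>2"
proof -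
  \<comment> \<open>Twice the form of \<open>?N\<close> is the whole cross term, collected from
    drift and diffusion by the symmetry of \<open>P\<close>.\<close>
  let ?N = "transpose B ** P + transpose D ** P ** C"
  obtain K1 where K1: "K1 > 0" "\<And>x y. \<bar>(?N *v x) \<bullet> y\<bar> \<le> K1 * norm x * norm y" using matrix_form_bound by blast
  obtain K2 where K2: "K2 > 0" "\<And>x y. \<bar>((transpose D ** P ** D) *v x) \<bullet> y\<bar> \<le> K2 * norm x * norm y" using matrix_form_bound by blast
  show ?thesis
  proof (intro exI conjI allI)
    \<comment> \<open>The summand \<open>2 * K1\<^sup>2\<close> is the price of the cross term in
      Young's inequality, and \<open>K2\<close> bounds the part quadratic in
      \<open>v\<close>.\<close>
    show "0 \<le> 2 * K1\<^sup>2 + K2" using K2 by simp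
    fix x v
    have "(lyapunov_operator A C P *v x) \<bullet> x = - (norm x)\<^sup>2"
      unfolding L power2_norm_eq_inner by (simp add: matrix_vector_mult_minus_left)
    moreover have "2 * ((P *v x) \<bullet> (A *v x + B *v v)) + (P *v (C *v x + D *v v)) \<bullet> (C *v x + D *v v)
      = (lyapunov_operator A C P *v x) \<bullet> x + 2 * ((?N *v x) \<bullet> v) + ((transpose D ** P ** D) *v v) \<bullet> v"
    proof -
      have "(?N *v x) \<bullet> v = (P *v x) \<bullet> (B *v v) + (P *v (C *v x)) \<bullet> (D *v v)"
        by (simp add: matrix_vector_mult_add_rdistrib inner_add_left dot_lmul_matrix flip: matrix_vector_mul_assoc)
      moreover have "((transpose D ** P ** D) *v v) \<bullet> v = (P *v (D *v v)) \<bullet> (D *v v)"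
        by (simp add: dot_lmul_matrix flip: matrix_vector_mul_assoc)
      moreover have "(P *v (D *v v)) \<bullet> (C *v x) = (P *v (C *v x)) \<bullet> (D *v v)"
        using symmetric_matrix_inner[OF P] inner_commute by metis
      ultimately show ?thesis
        by (simp add: lyapunov_operator_form[OF P] matrix_vector_right_distrib inner_add_left inner_add_right)
    qed
    moreover have "2 * ((?N *v x) \<bullet> v) \<le> (norm x)\<^sup>2 / 2 + 2 * K1\<^sup>2 * (norm v)\<^sup>2"
    proof -
      have "2 * ((?N *v x) \<bullet> v) \<le> 2 * (K1 * norm x * norm v)" using K1(2)[of x v] by linarith
      also have "\<dots> \<le> (norm x)\<^sup>2 / 2 + 2 * K1\<^sup>2 * (norm v)\<^sup>2"
        using sum_squares_bound[of "norm x" "2 * K1 * norm v"] by (simp add: power_mult_distrib field_simps)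
      finally show ?thesis .
    qed
    moreover have "((transpose D ** P ** D) *v v) \<bullet> v \<le> K2 * (norm v)\<^sup>2"
      using K2(2)[of v v] by (simp add: power2_eq_square mult.assoc)
    ultimately show "2 * ((P *v x) \<bullet> (A *v x + B *v v)) + (P *v (C *v x + D *v v)) \<bullet> (C *v x + D *v v)
    \<le> - (norm x)\<^sup>2 / 2 + (2 * K1\<^sup>2 + K2) * (norm v)\<^sup>2"
      unfolding distrib_right by linarith
  qed
qed

context standard_brownian_motion
begin

lemma cutoff_mono_integral:
  fixes f g :: "real \<Rightarrow> 'a \<Rightarrow> real"
  assumes "integrable \<mu> (cutoff I f)" "integrable \<mu> (cutoff I g)" "\<And>t \<omega>. f t \<omega> \<le> g t \<omega>"
  shows "(LINT z|\<mu>. cutoff I f z) \<le> (LINT z|\<mu>. cutoff I g z)"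
  using assms by (intro integral_mono) (auto simp: cutoff_def indicator_def)

lemma cutoff_norm_square:
  fixes X :: "real \<Rightarrow> 'a \<Rightarrow> 'b::real_normed_vector"
  shows "cutoff I (\<lambda>t \<omega>. (norm (X t \<omega>))\<^sup>2) z = (norm (cutoff I X z))\<^sup>2"
  by (cases z) (auto simp: cutoff_def indicator_def)

text \<open>A semidefinite \<open>P\<close> makes the left side of Ito's formula nonnegative, and
  the initial state is 0. The dissipation bound then controls the state on [0, T] by the control,
  uniformly in \<open>T\<close>.\<close>

lemma controlled_mean_square_finite:
  fixes A C :: "real ^ 'n ^ 'n" and B D :: "real ^ 'm ^ 'n"
  assumes stable: "\<And>x. \<exists>X. is_solution M W x (\<lambda>t \<omega> y. A *v y) (\<lambda>t \<omega> y. C *v y) X \<and> mean_square M {0..} X < \<infinity>"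
    and sol: "is_solution M W 0 (\<lambda>t \<omega> y. A *v y + B *v v t \<omega>) (\<lambda>t \<omega> y. C *v y + D *v v t \<omega>) X"
    and v: "ms_process v" and vL: "L2 \<mu> (\<lambda>z. norm (cutoff {0..} v z))"
  shows "L2 \<mu> (\<lambda>z. norm (cutoff {0..} X z))"
proof -
  obtain P where P: "symmetric_matrix P" "lyapunov_operator A C P = - mat 1" "\<And>x. 0 \<le> (P *v x) \<bullet> x"
    using stable_lyapunov_solution[OF stable] by blast
  obtain c where c0: "c \<ge> 0" and c: "\<And>x v. 2 * ((P *v x) \<bullet> (A *v x + B *v v)) + (P *v (C *v x + D *v v)) \<bullet> (C *v x + D *v v)
    \<le> - (norm x)\<^sup>2 / 2 + c * (norm v)\<^sup>2"
    using lyapunov_dissipation_bound[OF P(1,2), of B D] by blast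
  have X: "ms_process X" using sol by (auto simp: is_solution_def ms_process_def)
  have b: "ms_process (\<lambda>t \<omega>. A *v X t \<omega> + B *v v t \<omega>)" and s: "ms_process (\<lambda>t \<omega>. C *v X t \<omega> + D *v v t \<omega>)"
    by (intro ms_process_add ms_process_matrix X v)+
  define V where "V = (LINT z|\<mu>. (norm (cutoff {0..} v z))\<^sup>2)"
  have bound: "(LINT z|\<mu>. (norm (cutoff {0..T} X z))\<^sup>2) \<le> 2 * c * V" if T: "0 \<le> T" for T
  proof -
    let ?g = "\<lambda>t \<omega>. 2 * ((P *v X t \<omega>) \<bullet> (A *v X t \<omega> + B *v v t \<omega>)) + (P *v (C *v X t \<omega> + D *v v t \<omega>)) \<bullet> (C *v X t \<omega> + D *v v t \<omega>)"
    let ?h = "\<lambda>t \<omega>. - (norm (X t \<omega>))\<^sup>2 / 2 + c * (norm (v t \<omega>))\<^sup>2"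
    note q = solution_quadratic_form[OF sol b s P(1) T]
    have h: "cutoff {0..T} ?h z = - (norm (cutoff {0..T} X z))\<^sup>2 / 2 + c * (norm (cutoff {0..T} v z))\<^sup>2" for z
      by (cases z) (auto simp: cutoff_def indicator_def)
    have i: "integrable \<mu> (\<lambda>z. (norm (cutoff {0..T} X z))\<^sup>2)" "integrable \<mu> (\<lambda>z. (norm (cutoff {0..T} v z))\<^sup>2)"
      using L2_square[OF ms_process_L2[OF X T]] L2_square[OF ms_process_L2[OF v T]] .
    have hi: "integrable \<mu> (cutoff {0..T} ?h)" unfolding h[abs_def] using i by simp
    have "0 \<le> (LINT \<omega>|M. (P *v X T \<omega>) \<bullet> X T \<omega>)" using P(3) by (intro integral_nonneg_AE) simp
    also have "\<dots> = (LINT z|\<mu>. cutoff {0..T} ?g z)" unfolding q(3) by simp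
    also have "\<dots> \<le> (LINT z|\<mu>. cutoff {0..T} ?h z)"
      by (rule cutoff_mono_integral[OF q(2) hi]) (rule c)
    also have "\<dots> = - (LINT z|\<mu>. (norm (cutoff {0..T} X z))\<^sup>2) / 2 + c * (LINT z|\<mu>. (norm (cutoff {0..T} v z))\<^sup>2)"
      unfolding h using i by simp
    also have "(LINT z|\<mu>. (norm (cutoff {0..T} v z))\<^sup>2) \<le> V"
      unfolding V_def using i(2) L2_square[OF vL] by (rule integral_mono) (auto simp: cutoff_def indicator_def split: prod.splits)
    finally show ?thesis using c0 by (simp add: mult_left_mono)
  qed
  have Xm: "cutoff {0..} X \<in> borel_measurable \<mu>"
    using X by (auto simp: ms_process_def intro: progressively_measurable_cutoff_infinite)
  have Xnm[measurable]: "cutoff {0..real n} X \<in> borel_measurable \<mu>" for n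
    using X by (auto simp: ms_process_def intro: progressively_measurable_cutoff)
  \<comment> \<open>Fatou's lemma turns the uniform bound over [0, n] into finiteness over
    [0,\<infinity>).\<close>
  have "(\<integral>\<^sup>+ z. ennreal ((norm (cutoff {0..} X z))\<^sup>2) \<partial>\<mu>)
     = (\<integral>\<^sup>+ z. liminf (\<lambda>n. ennreal ((norm (cutoff {0..real n} X z))\<^sup>2)) \<partial>\<mu>)"
  proof (rule nn_integral_cong)
    fix z :: "real \<times> 'a"
    have "(\<lambda>n. ennreal ((norm (cutoff {0..real n} X z))\<^sup>2)) \<longlonglongrightarrow> ennreal ((norm (cutoff {0..} X z))\<^sup>2)"
      by (intro tendsto_ennrealI tendsto_intros cutoff_tendsto_infinite filterlim_real_sequentially)
    then show "ennreal ((norm (cutoff {0..} X z))\<^sup>2) = liminf (\<lambda>n. ennreal ((norm (cutoff {0..real n} X z))\<^sup>2))"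
      by (intro lim_imp_Liminf[symmetric]) auto
  qed
  also have "\<dots> \<le> liminf (\<lambda>n. \<integral>\<^sup>+ z. ennreal ((norm (cutoff {0..real n} X z))\<^sup>2) \<partial>\<mu>)"
    by (rule nn_integral_liminf) measurable
  also have "\<dots> \<le> liminf (\<lambda>n::nat. ennreal (2 * c * V))"
  proof (rule Liminf_mono[OF always_eventually], rule allI)
    fix n
    show "(\<integral>\<^sup>+ z. ennreal ((norm (cutoff {0..real n} X z))\<^sup>2) \<partial>\<mu>) \<le> ennreal (2 * c * V)"
      using L2_nn_integral[OF ms_process_L2[OF X, of "real n"]] bound[of "real n"] by (simp add: ennreal_leI)
  qed
  also have "\<dots> < \<infinity>" by (simp add: Liminf_const)
  finally show ?thesis using Xm by (intro L2I_nn_integral) auto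
qed


section \<open>The infinite-horizon cost\<close>

lemma admissible_controls_ms_process:
  assumes "v \<in> admissible_controls M W"
  shows "ms_process v" "L2 \<mu> (\<lambda>z. norm (cutoff {0..} v z))"
proof -
  have v: "progressively_measurable \<F> v" "mean_square M {0..} v < \<infinity>"
    using assms by (auto simp: admissible_controls_def)
  have "mean_square M {0..T} v \<le> mean_square M {0..} v" for T
    unfolding mean_square_def by (intro nn_integral_mono mult_left_mono) (auto simp: indicator_def)
  with v show "ms_process v"
    unfolding ms_process_def by (meson le_less_trans)
  show "L2 \<mu> (\<lambda>z. norm (cutoff {0..} v z))"
    using v(2) by (subst (asm) mean_square_finite_iff) (auto intro: progressively_measurable_cutoff_infinite v(1))
qed

text \<open>If the integral were negative, the truncated ones would eventually lie below half of it,
  and the assumed bound would keep E|X(T)|^2 away from 0 at all late times. The boundary term thus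
  disappears without being shown to converge.\<close>

lemma cutoff_infinite_nonneg_of_form_bound:
  fixes X :: "real \<Rightarrow> 'a \<Rightarrow> real ^ 'n" and h :: "real \<Rightarrow> 'a \<Rightarrow> real"
  assumes XL: "L2 \<mu> (\<lambda>z. norm (cutoff {0..} X z))" and h: "integrable \<mu> (cutoff {0..} h)" and K: "0 < K"
    and lower: "\<And>T. 0 \<le> T \<Longrightarrow> - K * (LINT \<omega>|M. (norm (X T \<omega>))\<^sup>2) \<le> (LINT z|\<mu>. cutoff {0..T} h z)"
  shows "0 \<le> (LINT z|\<mu>. cutoff {0..} h z)"
proof (rule ccontr)
  let ?I = "LINT z|\<mu>. cutoff {0..} h z"
  assume "\<not> 0 \<le> ?I"
  then have neg: "?I < 0" by simp
  have eq: "cutoff {0..T} h = (\<lambda>z. indicator {..T} (fst z) * cutoff {0..} h z)" for T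
    by (auto simp: cutoff_def indicator_def)
  have m: "cutoff {0..T} h \<in> borel_measurable \<mu>" for T
  proof -
    have "(\<lambda>z::real \<times> 'a. indicator {..T} (fst z) :: real) \<in> borel_measurable \<mu>"
      by (rule measurable_compose[OF measurable_fst borel_measurable_indicator]) simp
    then show ?thesis unfolding eq using h by simp
  qed
  have "((\<lambda>T. LINT z|\<mu>. cutoff {0..T} h z) \<longlongrightarrow> ?I) at_top"
  proof (rule integral_dominated_convergence_at_top[OF borel_measurable_integrable[OF h] m integrable_norm[OF h]])
    show "\<forall>\<^sub>F T in at_top. AE z in \<mu>. norm (cutoff {0..T} h z) \<le> norm (cutoff {0..} h z)"
      by (auto simp: eq indicator_def)
    show "AE z in \<mu>. ((\<lambda>T. cutoff {0..T} h z) \<longlongrightarrow> cutoff {0..} h z) at_top"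
      by (intro always_eventually allI cutoff_tendsto_infinite filterlim_ident)
  qed
  from order_tendstoD(2)[OF this, of "?I / 2"] neg
  obtain T1 where T1: "\<And>T. T1 \<le> T \<Longrightarrow> (LINT z|\<mu>. cutoff {0..T} h z) < ?I / 2"
    by (auto simp: eventually_at_top_linorder)
  show False
  proof (rule L2_infinite_not_bounded_below[OF XL, of "- ?I / 2 / K" "max 0 T1"])
    show "0 < - ?I / 2 / K" using neg K by (intro divide_pos_pos) auto
    fix T assume "max 0 T1 \<le> T"
    then have "- K * (LINT \<omega>|M. (norm (X T \<omega>))\<^sup>2) < ?I / 2"
      using lower[of T] T1[of T] by linarith
    then show "- ?I / 2 / K \<le> (LINT \<omega>|M. (norm (X T \<omega>))\<^sup>2)"
      by (subst pos_divide_le_eq[OF K]) (simp add: mult.commute)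
  qed simp
qed

text \<open>An iterated Bochner integral takes the default value 0 where integrability fails; joint
  integrability makes it the true integral over the product space.\<close>

lemma iterated_integral_eq_cutoff:
  fixes f :: "real \<Rightarrow> 'a \<Rightarrow> real"
  assumes "integrable \<mu> (cutoff I f)"
  shows "(LINT \<omega>|M. (LINT t:I|lborel. f t \<omega>)) = (LINT z|\<mu>. cutoff I f z)"
  using time_prob.integral_snd'(2)[OF assms] by (simp add: cutoff_def set_lebesgue_integral_def)

end

theorem lemma4p3:
  fixes M :: "'a measure" and W :: "real \<Rightarrow> 'a \<Rightarrow> real"
    and A C Q Q0 P :: "real ^ 'n ^ 'n" and B D :: "real ^ 'm ^ 'n"
    and R :: "real ^ 'm ^ 'm" and S \<Theta> :: "real ^ 'n ^ 'm" and \<delta> :: real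
  assumes "standard_brownian_motion M W"
    and "symmetric_matrix Q" and "symmetric_matrix R"
    and "\<Theta> \<in> stabilizers M W A C B D"
    and "pos_def Q0"
    and "symmetric_matrix P"
    and "pos_semidef
      (P ** (A + B ** \<Theta>) + transpose (A + B ** \<Theta>) ** P
       + transpose (C + D ** \<Theta>) ** P ** (C + D ** \<Theta>)
       + transpose S ** \<Theta> + transpose \<Theta> ** S + transpose \<Theta> ** R ** \<Theta> + Q - Q0)"
    and "\<delta> > 0"
    and "let K = P ** B + transpose (C + D ** \<Theta>) ** P ** D + transpose S + transpose \<Theta> ** R
      in pos_semidef
        (R + transpose D ** P ** D - transpose K ** matrix_inv Q0 ** K - \<delta> *\<^sub>R mat 1)"
  shows "\<exists>\<delta>'>0. \<forall>v \<in> admissible_controls M W. \<forall>X. is_state M W A C B D \<Theta> v X \<longrightarrow>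
    stabilized_cost M Q S R \<Theta> X v
      \<ge> \<delta>' * (LINT \<omega>|M. (LINT t:{0..}|lborel. (norm (v t \<omega>))\<^sup>2))"
proof (intro exI conjI ballI allI impI)
  show "\<delta> > 0" by fact
  interpret standard_brownian_motion M W by fact
  fix v X assume v: "v \<in> admissible_controls M W" and "is_state M W A C B D \<Theta> v X"
  define A' where "A' = A + B ** \<Theta>"
  define C' where "C' = C + D ** \<Theta>"
  define Q' where "Q' = Q + transpose S ** \<Theta> + transpose \<Theta> ** S + transpose \<Theta> ** R ** \<Theta>"
  define S' where "S' = S + R ** \<Theta>"
  have sol: "is_solution M W 0 (\<lambda>t \<omega> y. A' *v y + B *v v t \<omega>) (\<lambda>t \<omega> y. C' *v y + D *v v t \<omega>) X"
    using \<open>is_state M W A C B D \<Theta> v X\<close> unfolding is_state_def A'_def C'_def .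
  have stable: "\<exists>X. is_solution M W x (\<lambda>t \<omega> y. A' *v y) (\<lambda>t \<omega> y. C' *v y) X \<and> mean_square M {0..} X < \<infinity>" for x
    using assms(4) unfolding stabilizers_def A'_def C'_def by blast
  note v = admissible_controls_ms_process[OF v]
  note XL = controlled_mean_square_finite[OF stable sol v]
  have X: "ms_process X" using sol by (auto simp: is_solution_def ms_process_def)
  have b: "ms_process (\<lambda>t \<omega>. A' *v X t \<omega> + B *v v t \<omega>)" and s: "ms_process (\<lambda>t \<omega>. C' *v X t \<omega> + D *v v t \<omega>)"
    by (intro ms_process_add ms_process_matrix X v)+
  define cost where "cost = (\<lambda>t \<omega>. (Q' *v X t \<omega>) \<bullet> X t \<omega> + 2 * ((S' *v X t \<omega>) \<bullet> v t \<omega>) + (R *v v t \<omega>) \<bullet> v t \<omega>)"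
  define drift where "drift = (\<lambda>t \<omega>. 2 * ((P *v X t \<omega>) \<bullet> (A' *v X t \<omega> + B *v v t \<omega>))
    + (P *v (C' *v X t \<omega> + D *v v t \<omega>)) \<bullet> (C' *v X t \<omega> + D *v v t \<omega>))"
  \<comment> \<open>The theorem amounts to a nonnegative integral of this difference over
    [0,\<infinity>).\<close>
  define gap where "gap = (\<lambda>t \<omega>. cost t \<omega> - \<delta> * (norm (v t \<omega>))\<^sup>2)"
  have pointwise: "\<delta> * (norm (v t \<omega>))\<^sup>2 \<le> cost t \<omega> + drift t \<omega>" for t \<omega>
    unfolding cost_def drift_def Q'_def S'_def
    by (rule completed_square_bound[OF assms(3,5,6) assms(7)[folded A'_def C'_def] refl
        assms(9)[unfolded Let_def, folded C'_def]])
  have meas: "cutoff {0..} X \<in> borel_measurable \<mu>" "cutoff {0..} v \<in> borel_measurable \<mu>"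
    using X v(1) by (auto simp: ms_process_def intro: progressively_measurable_cutoff_infinite)
  have iv: "integrable \<mu> (cutoff {0..} (\<lambda>t \<omega>. (norm (v t \<omega>))\<^sup>2))"
    unfolding cutoff_norm_square[abs_def] by (rule L2_square[OF v(2)])
  \<comment> \<open>Integrability of the cost over the infinite horizon needs the square integrable
    state, and so the stabilizer, through \<open>XL\<close>.\<close>
  have ic: "integrable \<mu> (cutoff {0..} cost)"
  proof -
    have "cutoff {0..} cost = (\<lambda>z. (Q' *v cutoff {0..} X z) \<bullet> cutoff {0..} X z
      + 2 * ((S' *v cutoff {0..} X z) \<bullet> cutoff {0..} v z) + (R *v cutoff {0..} v z) \<bullet> cutoff {0..} v z)"
      by (auto simp: cost_def cutoff_def indicator_def)
    then show ?thesis using meas XL v(2) by (simp add: integrable_matrix_form)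
  qed
  have gap: "cutoff I gap z = cutoff I cost z - \<delta> * cutoff I (\<lambda>t \<omega>. (norm (v t \<omega>))\<^sup>2) z" for I z
    by (cases z) (simp add: gap_def cutoff_def algebra_simps)
  have ig: "integrable \<mu> (cutoff {0..} gap)" unfolding gap[abs_def] using ic iv by simp
  obtain K where K: "K > 0" "\<And>x y. \<bar>(P *v x) \<bullet> y\<bar> \<le> K * norm x * norm y" using matrix_form_bound by blast
  have "0 \<le> (LINT z|\<mu>. cutoff {0..} gap z)"
  proof (rule cutoff_infinite_nonneg_of_form_bound[OF XL ig K(1)])
    fix T :: real assume T: "0 \<le> T"
    note q = solution_quadratic_form[OF sol b s assms(6) T, folded drift_def]
    have ig_T: "integrable \<mu> (cutoff {0..T} gap)"
    proof (rule Bochner_Integration.integrable_bound[OF ig])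
      have eq: "cutoff {0..T} gap = (\<lambda>z. indicator {..T} (fst z) * cutoff {0..} gap z)"
        by (auto simp: cutoff_def indicator_def)
      have "(\<lambda>z::real \<times> 'a. indicator {..T} (fst z) :: real) \<in> borel_measurable \<mu>"
        by (rule measurable_compose[OF measurable_fst borel_measurable_indicator]) simp
      then show "cutoff {0..T} gap \<in> borel_measurable \<mu>" unfolding eq using ig by simp
      show "AE z in \<mu>. norm (cutoff {0..T} gap z) \<le> norm (cutoff {0..} gap z)"
        by (simp add: eq indicator_def)
    qed
    \<comment> \<open>Pointwise, \<open>gap\<close> is at least minus the drift; as \<open>X\<close>
      starts at 0, the integrated drift is exactly the boundary term at \<open>T\<close>.\<close>
    have "- (LINT z|\<mu>. cutoff {0..T} drift z) = (LINT z|\<mu>. - cutoff {0..T} drift z)" by simp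
    also have "\<dots> \<le> (LINT z|\<mu>. cutoff {0..T} gap z)"
    proof (rule integral_mono[OF _ ig_T])
      show "integrable \<mu> (\<lambda>z. - cutoff {0..T} drift z)" using q(2) by simp
      show "- cutoff {0..T} drift z \<le> cutoff {0..T} gap z" for z
        using pointwise[of "fst z" "snd z"] by (cases z) (auto simp: cutoff_def indicator_def gap_def)
    qed
    finally have "- (LINT \<omega>|M. (P *v X T \<omega>) \<bullet> X T \<omega>) \<le> (LINT z|\<mu>. cutoff {0..T} gap z)"
      unfolding q(3) by simp
    then show "- K * (LINT \<omega>|M. (norm (X T \<omega>))\<^sup>2) \<le> (LINT z|\<mu>. cutoff {0..T} gap z)"
      using solution_form_le_norm[OF sol b s assms(6) T K(2)] by linarith
  qed
  then have "\<delta> * (LINT z|\<mu>. cutoff {0..} (\<lambda>t \<omega>. (norm (v t \<omega>))\<^sup>2) z) \<le> (LINT z|\<mu>. cutoff {0..} cost z)"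
    unfolding gap using ic iv by simp
  moreover have "stabilized_cost M Q S R \<Theta> X v = (LINT z|\<mu>. cutoff {0..} cost z)"
    unfolding iterated_integral_eq_cutoff[OF ic, symmetric]
    by (simp add: stabilized_cost_def Let_def cost_def Q'_def S'_def)
  ultimately show "stabilized_cost M Q S R \<Theta> X v \<ge> \<delta> * (LINT \<omega>|M. (LINT t:{0..}|lborel. (norm (v t \<omega>))\<^sup>2))"
    unfolding iterated_integral_eq_cutoff[OF iv] by simp
qed

end
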